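(* Let $p$ be a prime with $p\equiv 1\pmod 8$ and let $\kappa=\pi\sqrt{2/3}$. Then for even $n=2m$ one has, as $m\to\infty$, $$\log^+ \mathfrak{p}(2m,\chi_p)\sim \tfrac12\kappa\sqrt{\left(1-\tfrac1p\right)(2m)},$$ and for odd $n=2m+1$ one has, as $m\to\infty$, $$\mathfrak{p}(2m+1,\chi_p)=O\!\left(m^{-19/20}\exp\!\left(\tfrac12\kappa\sqrt{\left(1-\tfrac1p\right)(2m+1)}\right)\right).$$
   Context: For $f:\mathbb{N}\to\{0,\pm1\}$ and a partition $\pi=(a_1,\dots,a_k)$ of $n$, put $f(\pi)=f(a_1)\cdots f(a_k)$, and define $\mathfrak{p}(n,f)=\sum_{\pi}f(\pi)$, the sum over all partitions $\pi$ of $n$. For an odd prime $p$, $\chi_p(n)$ is the Legendre symbol $(\frac np)$ (value $0$ when $p\mid n$). $\log^+ x:=\max\{0,\log x\}$ (and $0$ for $x\le0$). *)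

theory Defs
  imports
    "HOL-Library.Multiset"
    "HOL-Library.Landau_Symbols"
    "HOL-Number_Theory.Number_Theory"
begin

definition partitions :: "nat \<Rightarrow> nat multiset set" where
  "partitions n = {P. 0 \<notin># P \<and> sum_mset P = n}"

lemma partitions_sizes:
  assumes "P \<in> partitions n"
  shows "set_mset P \<subseteq> {1..n}" and "size P \<le> n"
proof -
  have P: "0 \<notin># P" "sum_mset P = n"
    using assms by (auto simp: partitions_def)
  show "set_mset P \<subseteq> {1..n}"
  proof
    fix x assume x: "x \<in># P"
    then have "x \<le> n"
      using P(2) by (auto dest!: multi_member_split)
    moreover have "x \<noteq> 0"
      using x P(1) by (cases x) auto
    ultimately show "x \<in> {1..n}"
      by simp
  qed
  have "0 \<notin># Q \<Longrightarrow> size Q \<le> sum_mset Q" for Q :: "nat multiset"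
    by (induction Q) auto
  with P show "size P \<le> n"
    by blast
qed

lemma finite_partitions: "finite (partitions n)"
proof (rule finite_subset)
  show "partitions n \<subseteq> mset ` {xs. set xs \<subseteq> {1..n} \<and> length xs \<le> n}"
  proof
    fix P assume P: "P \<in> partitions n"
    obtain xs where xs: "P = mset xs"
      using ex_mset[of P] by blast
    have "set xs \<subseteq> {1..n}" and "length xs \<le> n"
      using partitions_sizes[OF P] unfolding xs set_mset_mset size_mset .
    then show "P \<in> mset ` {xs. set xs \<subseteq> {1..n} \<and> length xs \<le> n}"
      unfolding xs by blast
  qed
  show "finite (mset ` {xs. set xs \<subseteq> {1..n} \<and> length xs \<le> n})"
    by (intro finite_imageI finite_lists_length_le) simp
qed

definition partition_weight :: "(nat \<Rightarrow> int) \<Rightarrow> nat multiset \<Rightarrow> int" where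
  "partition_weight f P = (\<Prod>a\<in>#P. f a)"

definition signed_partition_number :: "nat \<Rightarrow> (nat \<Rightarrow> int) \<Rightarrow> int" where
  "signed_partition_number n f = (\<Sum>P\<in>partitions n. partition_weight f P)"

definition legendre_char :: "nat \<Rightarrow> nat \<Rightarrow> int" where
  "legendre_char p n = Legendre (int n) (int p)"

text \<open>The case distinction matters: the library's \<open>ln\<close> satisfies \<open>ln (- x) = ln x\<close>, so
  \<open>max 0 (ln x)\<close> alone is positive for \<open>x < - 1\<close>.\<close>

definition log_plus :: "real \<Rightarrow> real" where
  "log_plus x = (if x \<le> 0 then 0 else max 0 (ln x))"

definition kappa :: real where
  "kappa = pi * sqrt (2 / 3)"

end

theory Submission
  imports
    Defs
    "HOL-Complex_Analysis.Complex_Analysis"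
    "HOL-Probability.Sinc_Integral"
    "HOL-Real_Asymp.Real_Asymp"
begin

text \<open>The proof is the circle method. Let \<open>F\<close> be the product of \<open>1 / (1 - \<chi>\<^sub>p(n) z\<^sup>n)\<close>, so that \<open>log F(z)\<close> is the sum
  over \<open>k\<close> of \<open>\<Phi>\<^sub>k(z\<^sup>k) / k\<close>, where \<open>\<Phi>\<^sub>k(w)\<close> is the power series with the periodic coefficients \<open>\<chi>\<^sub>p(n)\<^sup>k\<close>.
  Because these coefficients are even functions, \<open>log F(exp (- s)) - A / s\<close> stays bounded in every sector around
  the positive axis. The substitution \<open>z \<mapsto> - z\<close> only affects odd \<open>k\<close>, and since \<open>\<chi>\<^sub>p(2) = 1\<close> the difference
  \<open>log F(- exp (- s)) - log F(exp (- s))\<close> equals \<open>2 (G(2 s) - G(s))\<close>, where \<open>G(s)\<close> is the part of \<open>log F(exp (- s))\<close>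
  with odd \<open>k\<close>. Its derivative is bounded, so the difference is \<open>O(s)\<close>. Hence the contributions of \<open>1\<close> and \<open>- 1\<close>
  add up for even \<open>n\<close> and cancel for odd \<open>n\<close>. Elsewhere on the circle the partial fraction expansion of \<open>\<Phi>\<^sub>k\<close>,
  whose coefficients for odd \<open>k\<close> are normalized Gauss sums of size \<open>1 / sqrt p\<close>, makes \<open>F\<close> exponentially smaller.\<close>

subsection \<open>The Legendre symbol modulo a prime congruent to 1 modulo 8\<close>

text \<open>Evenness matters because a nonzero constant term of \<open>Phi (exp (- x))\<close> at 0
  would be summed with weights 1 / k up to k of size 1 / |s|; this would add a logarithm of s to log
  F, hence a power of s to F. The bounded derivative of G cannot be obtained term by term: about 1 /
  |s| of its terms have size O(1), so they have to cancel, and this is seen by comparing them with a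
  telescoping sum. The sizes are governed by the saddle point r = sqrt (A / n). The peak of the
  integrand has width r^(3/2), which gives the even case. For odd n the cancellation gains another
  factor r, so that r^(5/2) remains, of order n^(-5/4) and thus within the claimed power -19/20. The
  tight place is the rest of the circle. Bounding every term there by its largest residue gives |log
  F| at most about (A + pi^2 / (8 sqrt p)) / Re s, which exceeds the size A / Re s at the peak. The
  excess has to be recovered from a few small k, and for p = 17 there is little room.\<close>

locale prime_1_mod_8 =
  fixes p :: nat
  assumes prime_p: "prime p" and p_mod_8: "[p = 1] (mod 8)"
begin

lemma p_gt_2: "2 < p"
proof -
  have "p \<noteq> 2" using p_mod_8 by (auto simp: unique_euclidean_semiring_class.cong_def)
  then show ?thesis using prime_ge_2_nat[OF prime_p] by simp
qed

text \<open>Below 17 only 1 and 9 are 1 modulo 8, and neither is prime. The numerical estimates away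
  from the singularities rest on this bound.\<close>

lemma p_ge_17: "17 \<le> p"
proof (rule ccontr)
  assume "\<not> 17 \<le> p"
  then have "p < 17" by simp
  moreover have "p mod 8 = 1" using p_mod_8 by (simp add: unique_euclidean_semiring_class.cong_def)
  ultimately have "p = 1 \<or> p = 9" by presburger
  moreover have "\<not> prime (9::nat)"
    using prime_product[of 3 "3::nat"] by auto
  ultimately show False using prime_p by auto
qed

abbreviation leg :: "nat \<Rightarrow> int" where
  "leg \<equiv> legendre_char p"

lemma legendre_char_cong:
  assumes "[a = b] (mod p)"
  shows "leg a = leg b"
proof -
  have "[int a = int b] (mod int p)" using assms by (simp add: cong_int_iff)
  then have "[int a = c] (mod int p) \<longleftrightarrow> [int b = c] (mod int p)"
      and "[c = int a] (mod int p) \<longleftrightarrow> [c = int b] (mod int p)" for c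
    by (auto simp: unique_euclidean_semiring_class.cong_def)
  then show ?thesis
    unfolding legendre_char_def Legendre_def QuadRes_def by simp
qed

lemma legendre_char_eq_0_iff: "leg a = 0 \<longleftrightarrow> p dvd a"
  unfolding legendre_char_def Legendre_def
  by (auto simp: cong_0_iff)

lemma abs_legendre_char: "\<not> p dvd a \<Longrightarrow> \<bar>leg a\<bar> = 1"
  unfolding legendre_char_def Legendre_def
  by (auto simp: cong_0_iff)

lemma legendre_char_cases: "leg a \<in> {-1, 0, 1}"
  unfolding legendre_char_def Legendre_def by auto

lemma legendre_char_square: "(leg a)\<^sup>2 = (if p dvd a then 0 else 1)"
  using abs_legendre_char[of a] legendre_char_eq_0_iff[of a]
  by (auto simp: power2_eq_1_iff abs_if split: if_splits)

text \<open>Euler's criterion gives the congruence modulo \<open>p\<close>; both sides lie in {-1,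
  0, 1} and \<open>p\<close> exceeds 2, so they are equal.\<close>

lemma legendre_char_mult: "leg (a * b) = leg a * leg b"
proof -
  have "[leg (a * b) = int (a * b) ^ ((p - 1) div 2)] (mod int p)"
    unfolding legendre_char_def by (rule euler_criterion[OF prime_p p_gt_2])
  moreover have "[leg a * leg b =
      int a ^ ((p - 1) div 2) * int b ^ ((p - 1) div 2)] (mod int p)"
    unfolding legendre_char_def by (intro cong_mult euler_criterion[OF prime_p p_gt_2])
  ultimately have "[leg (a * b) = leg a * leg b] (mod int p)"
    by (metis cong_sym cong_trans of_nat_mult power_mult_distrib)
  then have d: "int p dvd leg (a * b) - leg a * leg b"
    by (simp add: cong_iff_dvd_diff)
  have "\<bar>leg (a * b) - leg a * leg b\<bar> < int p"
    using legendre_char_cases[of "a * b"] legendre_char_cases[of a] legendre_char_cases[of b] p_gt_2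
    by auto
  with d have "leg (a * b) - leg a * leg b = 0"
    by (metis dvd_imp_le_int abs_of_nat not_less)
  then show ?thesis by simp
qed

lemma legendre_char_of_square:
  assumes "[x\<^sup>2 = a] (mod p)" and "\<not> p dvd a"
  shows "leg a = 1"
proof -
  have "leg a = (leg x)\<^sup>2"
    by (metis assms(1) cong_sym legendre_char_cong legendre_char_mult power2_eq_square)
  then show ?thesis
    using legendre_char_square[of x] legendre_char_eq_0_iff[of a] assms(2) by (auto split: if_splits)
qed

text \<open>With a primitive root \<open>r\<close>, the power \<open>g = r ^ ((p - 1) div 8)\<close>
  has order 8, so \<open>g ^ 4\<close> is a square root of 1 other than 1.\<close>

lemma exists_4th_root_neg_1: "\<exists>g. [g ^ 4 = p - 1] (mod p)"
proof -
  obtain r where r: "residue_primroot p r"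
    using prime_p prime_primitive_root_exists prime_gt_1_nat by blast
  define g where "g = r ^ ((p - 1) div 8)"
  have d8: "8 dvd p - 1"
    using p_mod_8 prime_gt_1_nat[OF prime_p] by (metis cong_altdef_nat cong_sym less_imp_le_nat)
  have co: "coprime p r" and ordr: "ord p r = p - 1"
    using r prime_p by (auto simp: residue_primroot_def totient_prime)
  have g4: "g ^ 4 = r ^ ((p - 1) div 2)"
    unfolding g_def power_mult[symmetric] using d8 by (auto elim!: dvdE simp: mult.commute)
  have "g ^ 8 = r ^ (p - 1)"
    unfolding g_def power_mult[symmetric] using d8 by (auto elim!: dvdE)
  then have "[g ^ 8 = 1] (mod p)"
    using co by (metis ord ordr)
  moreover have "\<not> [g ^ 4 = 1] (mod p)"
    unfolding g4 ord_divides ordr using p_gt_2 by (auto dest!: dvd_imp_le)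
  moreover have "x ^ 8 - 1 = (x ^ 4 - 1) * (x ^ 4 + 1)" for x :: int
    by (simp add: algebra_simps eval_nat_numeral)
  from this[of "int g"] have "int (g ^ 8) - 1 = (int (g ^ 4) - 1) * (int (g ^ 4) + 1)"
    by simp
  ultimately have "int p dvd (int (g ^ 4) - 1) * (int (g ^ 4) + 1)"
      and "\<not> int p dvd int (g ^ 4) - 1"
    using cong_int_iff[of "g ^ 8" 1 p] cong_int_iff[of "g ^ 4" 1 p] by (auto simp: cong_iff_dvd_diff)
  moreover have "prime (int p)" using prime_p by simp
  ultimately have "int p dvd int (g ^ 4) + 1"
    using prime_dvd_mult_iff by blast
  then have "int p dvd (int (g ^ 4) + 1) - int p" by (rule dvd_diff) simp
  moreover have "(int (g ^ 4) + 1) - int p = int (g ^ 4) - int (p - 1)"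
    using p_gt_2 by (simp add: of_nat_diff)
  ultimately have "[int (g ^ 4) = int (p - 1)] (mod int p)"
    by (simp only: cong_iff_dvd_diff)
  then show ?thesis using cong_int_iff by blast
qed

lemma legendre_char_neg_1: "leg (p - 1) = 1"
proof -
  obtain g where "[g ^ 4 = p - 1] (mod p)" using exists_4th_root_neg_1 by blast
  then have "[(g\<^sup>2)\<^sup>2 = p - 1] (mod p)" by (simp flip: power_mult)
  moreover have "\<not> p dvd p - 1" using p_gt_2 by (auto dest!: dvd_imp_le)
  ultimately show ?thesis by (rule legendre_char_of_square)
qed

text \<open>If \<open>g\<close> is a primitive 8th root of unity modulo \<open>p\<close>, then \<open>(g + 1/g)\<^sup>2 = 2\<close>.\<close>

lemma legendre_char_2: "leg 2 = 1"
proof -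
  obtain g where "[g ^ 4 = p - 1] (mod p)" using exists_4th_root_neg_1 by blast
  then have "[int g ^ 4 = int p - 1] (mod int p)"
    using cong_int_iff[of "g ^ 4" "p - 1" p] p_gt_2 by (simp add: of_nat_diff)
  then have "int p dvd (int g ^ 4 - (int p - 1)) + int p"
    by (intro dvd_add) (simp_all only: cong_iff_dvd_diff dvd_refl)
  then have d: "int p dvd int g ^ 4 + 1" by (simp add: algebra_simps)
  \<comment> \<open>\<open>x ^ 7\<close> plays the role of the inverse of \<open>x\<close>, since
    \<open>x ^ 8\<close> is 1 once \<open>x ^ 4\<close> is -1. The identity exhibits the factor
    \<open>x ^ 4 + 1\<close>, which \<open>p\<close> divides at \<open>g\<close>.\<close>
  have "(x + x ^ 7)\<^sup>2 - 2 = (x ^ 4 + 1) * (x ^ 10 - x ^ 6 + 2 * x ^ 4 + x ^ 2 - 2)" for x :: int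
    by (simp add: algebra_simps eval_nat_numeral)
  from this[of "int g"] have "int ((g + g ^ 7)\<^sup>2) - int 2 = (int g ^ 4 + 1) * (int g ^ 10 - int g ^ 6 + 2 * int g ^ 4 + int g ^ 2 - 2)"
    by simp
  then have "[(g + g ^ 7)\<^sup>2 = 2] (mod p)"
    using d by (metis cong_iff_dvd_diff cong_int_iff dvd_mult2)
  moreover have "\<not> p dvd 2" using p_gt_2 by (auto dest!: dvd_imp_le)
  ultimately show ?thesis by (rule legendre_char_of_square)
qed

text \<open>Evenness of the character: among natural numbers \<open>p - 1\<close> represents -1, and
  its symbol is 1.\<close>

lemma legendre_char_reflect:
  assumes "a \<le> p"
  shows "leg (p - a) = leg a"
proof -
  have "[(p - 1) * a = p - a] (mod p)"
  proof -
    have "int ((p - 1) * a) - int (p - a) = int p * (int a - 1)"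
      using assms p_gt_2 by (simp add: of_nat_diff algebra_simps)
    then show ?thesis by (metis cong_iff_dvd_diff cong_int_iff dvd_triv_left)
  qed
  then have "leg (p - a) = leg (p - 1) * leg a"
    by (metis legendre_char_cong legendre_char_mult)
  then show ?thesis by (simp only: legendre_char_neg_1 mult_1)
qed

lemma bij_betw_mult_mod:
  assumes "\<not> p dvd b"
  shows "bij_betw (\<lambda>a. a * b mod p) {..<p} {..<p}"
proof -
  have "inj_on (\<lambda>a. a * b mod p) {..<p}"
  proof (rule inj_onI)
    fix x y assume *: "x \<in> {..<p}" "y \<in> {..<p}" "x * b mod p = y * b mod p"
    have "coprime b p" using assms prime_p by (metis coprime_commute prime_imp_coprime)
    then have "[x = y] (mod p)"
      using *(3) by (simp add: unique_euclidean_semiring_class.cong_def[symmetric] cong_mult_rcancel_nat)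
    then show "x = y" using * by (simp add: unique_euclidean_semiring_class.cong_def)
  qed
  moreover have "(\<lambda>a. a * b mod p) ` {..<p} \<subseteq> {..<p}" using p_gt_2 by auto
  ultimately show ?thesis
    by (simp add: bij_betw_def endo_inj_surj)
qed

text \<open>A primitive root is a nonresidue: otherwise Euler's criterion would make its order
  divide \<open>(p - 1) div 2\<close>.\<close>

lemma exists_nonresidue: "\<exists>r. leg r = -1"
proof -
  obtain r where r: "residue_primroot p r"
    using prime_p prime_primitive_root_exists prime_gt_1_nat by blast
  have co: "coprime p r" and ordr: "ord p r = p - 1"
    using r prime_p by (auto simp: residue_primroot_def totient_prime)
  have nd: "\<not> p dvd r" using co p_gt_2
    by (metis coprime_absorb_left nat_dvd_1_iff_1 less_numeral_extra(4) not_less_iff_gr_or_eq one_less_numeral_iff order_less_trans semiring_norm(76))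
  have "leg r \<noteq> 1"
  proof
    assume "leg r = 1"
    then have "[1 = int r ^ ((p - 1) div 2)] (mod int p)"
      using euler_criterion[OF prime_p p_gt_2, of "int r"] unfolding legendre_char_def by simp
    then have "[r ^ ((p - 1) div 2) = 1] (mod p)"
      by (metis cong_int_iff cong_sym of_nat_1 of_nat_power)
    then have "p - 1 dvd (p - 1) div 2" by (simp only: ord_divides ordr)
    then show False using p_gt_2 by (auto dest!: dvd_imp_le)
  qed
  then show ?thesis
    using legendre_char_cases[of r] legendre_char_eq_0_iff[of r] nd by blast
qed

text \<open>Multiplication by a nonresidue permutes the residues and changes the sign of every
  summand.\<close>

lemma sum_legendre_char: "(\<Sum>a<p. leg a) = 0"
proof -
  obtain r where r: "leg r = -1" using exists_nonresidue by blast
  then have nd: "\<not> p dvd r" using legendre_char_eq_0_iff[of r] by auto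
  have "(\<Sum>a<p. leg a) = (\<Sum>a<p. leg (a * r mod p))"
    by (rule sum.reindex_bij_betw[OF bij_betw_mult_mod[OF nd], symmetric])
  also have "\<dots> = (\<Sum>a<p. - leg a)"
    by (intro sum.cong refl) (metis cong_mod_left cong_refl legendre_char_cong legendre_char_mult r mult_minus1_right)
  finally show ?thesis by (simp add: sum_negf)
qed

end

subsection \<open>Finite Fourier analysis\<close>

definition zeta :: "nat \<Rightarrow> nat \<Rightarrow> complex" where
  "zeta q b = cis (2 * pi * real b / real q)"

text \<open>The factor 1 / \<open>q\<close> sits here, so inversion carries none and the values are
  directly the residue coefficients in the partial fractions of \<open>Phi\<close>.\<close>

definition dft :: "nat \<Rightarrow> (nat \<Rightarrow> complex) \<Rightarrow> nat \<Rightarrow> complex" where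
  "dft q f b = (\<Sum>a<q. f a * cnj (zeta q (a * b))) / of_nat q"

lemma norm_zeta [simp]: "norm (zeta q b) = 1"
  by (simp add: zeta_def)

lemma zeta_nonzero [simp]: "zeta q b \<noteq> 0"
  using norm_zeta[of q b] by (metis norm_zero zero_neq_one)

lemma zeta_0 [simp]: "zeta q 0 = 1"
  by (simp add: zeta_def)

lemma zeta_add: "zeta q (a + b) = zeta q a * zeta q b"
  by (simp add: zeta_def cis_mult distrib_left add_divide_distrib)

lemma zeta_power: "zeta q b ^ n = zeta q (n * b)"
  by (induction n) (simp_all add: zeta_add mult.commute)

lemma zeta_mult_cnj [simp]: "zeta q b * cnj (zeta q b) = 1"
  by (simp add: zeta_def cis_cnj cis_mult)

lemma zeta_eq_iff:
  assumes "q > 0"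
  shows "zeta q a = zeta q b \<longleftrightarrow> a mod q = b mod q"
proof -
  have "zeta q a = exp (2 * of_real pi * \<i> * of_nat a / of_nat q)" for a
    by (simp add: zeta_def cis_conv_exp mult_ac)
  then show ?thesis using complex_root_unity_eq[of q a b] assms by simp
qed

lemma zeta_mod: "q > 0 \<Longrightarrow> zeta q (a mod q) = zeta q a"
  by (simp add: zeta_eq_iff)

lemma zeta_self [simp]: "q > 0 \<Longrightarrow> zeta q q = 1"
  using zeta_eq_iff[of q q 0] by simp

text \<open>A geometric sum whose ratio is a \<open>q\<close>-th root of unity, equal to 1 exactly
  when \<open>a\<close> and \<open>n\<close> agree modulo \<open>q\<close>.\<close>

lemma sum_zeta_orthogonal:
  assumes "q > 0"
  shows "(\<Sum>b<q. cnj (zeta q (a * b)) * zeta q (n * b)) = (if a mod q = n mod q then of_nat q else 0)"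
proof -
  define u where "u = cnj (zeta q a) * zeta q n"
  have u: "cnj (zeta q (a * b)) * zeta q (n * b) = u ^ b" for b
    by (simp add: u_def power_mult_distrib zeta_power mult.commute flip: complex_cnj_power)
  have "u = 1 \<longleftrightarrow> zeta q a = zeta q n"
  proof
    assume "u = 1"
    then have "zeta q a * u = zeta q a" by simp
    then show "zeta q a = zeta q n" by (simp add: u_def flip: mult.assoc)
  qed (simp add: u_def mult.commute)
  then have u1: "u = 1 \<longleftrightarrow> a mod q = n mod q" by (simp add: zeta_eq_iff assms)
  have "u ^ q = 1"
  proof -
    have "zeta q b ^ q = 1" for b
      using assms by (metis zeta_power mult.commute zeta_self power_one)
    then show ?thesis by (simp add: u_def power_mult_distrib flip: complex_cnj_power)
  qed
  then have "(\<Sum>b<q. u ^ b) = 0" if "u \<noteq> 1"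
    using that by (simp add: sum_gp_strict)
  then show ?thesis unfolding u using u1 by auto
qed

lemma dft_inversion:
  assumes "q > 0" and "\<And>a. f (a mod q) = f a"
  shows "f n = (\<Sum>b<q. dft q f b * zeta q b ^ n)"
proof -
  have "(\<Sum>b<q. dft q f b * zeta q b ^ n)
      = (\<Sum>b<q. \<Sum>a<q. f a / of_nat q * (cnj (zeta q (a * b)) * zeta q (n * b)))"
    by (simp add: dft_def zeta_power sum_distrib_left sum_divide_distrib mult_ac)
  also have "\<dots> = (\<Sum>a<q. f a / of_nat q * (\<Sum>b<q. cnj (zeta q (a * b)) * zeta q (n * b)))"
    by (subst sum.swap) (simp add: sum_distrib_left)
  also have "\<dots> = (\<Sum>a<q. if a = n mod q then f a else 0)"
    using assms(1) by (intro sum.cong refl) (auto simp: sum_zeta_orthogonal)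
  also have "\<dots> = f n" using assms by simp
  finally show ?thesis by simp
qed

lemma dft_parseval:
  assumes "q > 0"
  shows "(\<Sum>b<q. (norm (dft q f b))\<^sup>2) = (\<Sum>a<q. (norm (f a))\<^sup>2) / real q"
proof -
  have "complex_of_real (\<Sum>b<q. (norm (dft q f b))\<^sup>2) = (\<Sum>b<q. dft q f b * cnj (dft q f b))"
    by (simp only: of_real_sum complex_norm_square)
  also have "\<dots> = (\<Sum>b<q. \<Sum>a<q. \<Sum>a'<q. f a * cnj (f a') / (of_nat q)\<^sup>2 *
      (cnj (zeta q (a * b)) * zeta q (a' * b)))"
    unfolding dft_def complex_cnj_divide cnj_sum complex_cnj_mult complex_cnj_cnj complex_cnj_of_nat
      times_divide_times_eq sum_product sum_divide_distrib
    by (intro sum.cong refl) (simp add: power2_eq_square mult_ac)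
  also have "\<dots> = (\<Sum>a<q. \<Sum>b<q. \<Sum>a'<q. f a * cnj (f a') / (of_nat q)\<^sup>2 *
      (cnj (zeta q (a * b)) * zeta q (a' * b)))"
    by (rule sum.swap)
  also have "\<dots> = (\<Sum>a<q. \<Sum>a'<q. f a * cnj (f a') / (of_nat q)\<^sup>2 *
      (\<Sum>b<q. cnj (zeta q (a * b)) * zeta q (a' * b)))"
    by (subst sum.swap) (simp add: sum_distrib_left)
  also have "\<dots> = (\<Sum>a<q. \<Sum>a'<q. if a' = a then f a * cnj (f a) / of_nat q else 0)"
    using assms
    by (intro sum.cong refl) (auto simp: sum_zeta_orthogonal power2_eq_square)
  also have "\<dots> = (\<Sum>a<q. f a * cnj (f a)) / of_nat q"
    by (simp add: sum_divide_distrib)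
  also have "\<dots> = complex_of_real ((\<Sum>a<q. (norm (f a))\<^sup>2) / real q)"
    by (simp only: of_real_sum complex_norm_square of_real_divide of_real_of_nat_eq)
  finally show ?thesis by (simp only: of_real_eq_iff)
qed

text \<open>Substituting \<open>q - a\<close> for \<open>a\<close>. The summand \<open>a = 0\<close>
  would be sent to \<open>q\<close>, outside the range, which is where \<open>f 0 = 0\<close>
  enters.\<close>

lemma dft_reflect:
  assumes "b \<le> q" and "\<And>a. a \<le> q \<Longrightarrow> f (q - a) = f a" and "f 0 = 0"
  shows "dft q f (q - b) = dft q f b"
proof (cases "q = 0")
  case False
  have cnj: "zeta q (a * (q - b)) = zeta q ((q - a) * b)" if "a \<le> q" for a
  proof -
    have "zeta q (a * (q - b)) * zeta q (a * b) = 1"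
    proof -
      have "a * (q - b) + a * b = q * a" using assms(1)
        by (metis distrib_left le_add_diff_inverse2 mult.commute)
      then show ?thesis using False
        by (metis zeta_add zeta_power zeta_self power_one mult.commute neq0_conv)
    qed
    moreover have "zeta q ((q - a) * b) * zeta q (a * b) = 1"
    proof -
      have "(q - a) * b + a * b = b * q" using that
        by (metis distrib_right le_add_diff_inverse2 mult.commute)
      then show ?thesis using False
        by (metis zeta_add zeta_power zeta_self power_one neq0_conv)
    qed
    ultimately show ?thesis by (metis mult_right_cancel zeta_nonzero)
  qed
  have split: "(\<Sum>a<q. f a * g a) = (\<Sum>a\<in>{1..<q}. f a * g a)" for g
    using False assms(3) by (intro sum.mono_neutral_right) (auto simp: Suc_le_eq)
  have "(\<Sum>a\<in>{1..<q}. f a * cnj (zeta q (a * (q - b)))) = (\<Sum>a\<in>{1..<q}. f a * cnj (zeta q (a * b)))"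
    by (rule sum.reindex_bij_witness[of _ "\<lambda>a. q - a" "\<lambda>a. q - a"]) (auto simp: assms(2) cnj)
  then show ?thesis by (simp add: dft_def split)
qed (use assms(1) in simp)

text \<open>Inversion at 0: the coefficients add up to \<open>f 0\<close>. This permits passing from
  1 / (1 - u) to u / (1 - u) in partial fractions.\<close>

lemma sum_dft:
  assumes "q > 0" and "f 0 = 0"
  shows "(\<Sum>b<q. dft q f b) = 0"
proof -
  have "(\<Sum>b<q. dft q f b) = (\<Sum>b<q. \<Sum>a<q. f a / of_nat q * (cnj (zeta q (a * b)) * zeta q (0 * b)))"
    by (simp add: dft_def sum_divide_distrib)
  also have "\<dots> = (\<Sum>a<q. f a / of_nat q * (\<Sum>b<q. cnj (zeta q (a * b)) * zeta q (0 * b)))"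
    by (subst sum.swap) (simp add: sum_distrib_left)
  also have "\<dots> = (\<Sum>a<q. 0)"
    using assms unfolding sum_zeta_orthogonal[OF assms(1)] by (intro sum.cong refl) auto
  finally show ?thesis by simp
qed

lemma zeta_separation:
  assumes "q > 0"
  obtains c where "0 < c" "c \<le> 1"
    "\<And>b b'. b < q \<Longrightarrow> b' < q \<Longrightarrow> b \<noteq> b' \<Longrightarrow> 2 * c \<le> norm (zeta q b - zeta q b')"
proof -
  \<comment> \<open>The extra element 2 keeps the set nonempty and, after halving, forces
    \<open>c \<le> 1\<close>.\<close>
  define S where "S = insert 2 ((\<lambda>(b, b'). norm (zeta q b - zeta q b')) ` {(b, b'). b < q \<and> b' < q \<and> b \<noteq> b'})"
  have "{(b, b'). b < q \<and> b' < q \<and> b \<noteq> b'} \<subseteq> {..<q} \<times> {..<q}" by auto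
  then have fin: "finite S" unfolding S_def
    by (intro finite.insertI finite_imageI) (auto intro: finite_subset)
  have pos: "x > 0" if "x \<in> S" for x
    using that assms by (auto simp: S_def zeta_eq_iff)
  have "Min S \<in> S" using fin by (intro Min_in) (auto simp: S_def)
  show thesis
  proof (rule that[of "Min S / 2"])
    show "0 < Min S / 2" using pos[OF \<open>Min S \<in> S\<close>] by simp
    show "Min S / 2 \<le> 1" using Min_le[OF fin, of 2] by (simp add: S_def)
    fix b b' assume "b < q" "b' < q" "b \<noteq> b'"
    then have "norm (zeta q b - zeta q b') \<in> S" by (auto simp: S_def)
    then show "2 * (Min S / 2) \<le> norm (zeta q b - zeta q b')" using Min_le[OF fin] by simp
  qed
qed

text \<open>\<open>norm (1 - zeta q b * w)\<close> is the distance from \<open>w\<close> to the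
  conjugate of \<open>zeta q b\<close>, so the triangle inequality allows at most one pole near
  \<open>w\<close>.\<close>

lemma zeta_separation_point:
  assumes sep: "\<And>b b'. b < q \<Longrightarrow> b' < q \<Longrightarrow> b \<noteq> b' \<Longrightarrow> 2 * c \<le> norm (zeta q b - zeta q b')"
    and "b < q" "b' < q" "b \<noteq> b'" and "norm (1 - zeta q b * w) < c"
  shows "c \<le> norm (1 - zeta q b' * w)"
proof (rule ccontr)
  assume neg: "\<not> ?thesis"
  have *: "norm (cnj (zeta q b) - w) = norm (1 - zeta q b * w)" for b
  proof -
    have "norm (1 - zeta q b * w) = norm (zeta q b * (cnj (zeta q b) - w))"
      by (simp add: algebra_simps)
    then show ?thesis by (simp add: norm_mult)
  qed
  have "norm (zeta q b - zeta q b') = norm (cnj (zeta q b - zeta q b'))" by (simp only: complex_mod_cnj)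
  also have "\<dots> = norm ((cnj (zeta q b) - w) - (cnj (zeta q b') - w))" by simp
  also have "\<dots> \<le> norm (1 - zeta q b * w) + norm (1 - zeta q b' * w)"
    unfolding *[symmetric] by (rule norm_triangle_ineq4)
  also have "\<dots> < 2 * c" using assms(5) neg by simp
  finally show False using sep[OF assms(2-4)] by simp
qed

subsection \<open>Power series with even periodic coefficients\<close>

lemma norm_exp_minus_1_le:
  fixes z :: complex
  assumes "norm z \<le> 1"
  shows "norm (exp z - 1) \<le> 3 * norm z"
proof -
  have "norm (exp z - (\<Sum>k\<le>0. z ^ k / fact k)) \<le> exp \<bar>Re z\<bar> * (norm z) ^ Suc 0 / fact 0"
    by (rule Taylor_exp)
  then have "norm (exp z - 1) \<le> exp \<bar>Re z\<bar> * norm z" by simp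
  also have "\<bar>Re z\<bar> \<le> 1" using assms abs_Re_le_cmod order_trans by blast
  then have "exp \<bar>Re z\<bar> \<le> 3" using exp_le by (meson exp_le_cancel_iff order_trans)
  then have "exp \<bar>Re z\<bar> * norm z \<le> 3 * norm z" by (intro mult_right_mono) auto
  finally show ?thesis .
qed

text \<open>The Laurent expansion 1 / (exp x - 1) = 1 / x - 1 / 2 + O(x), with explicit constants.
  The constant term -1 / 2 is the one that evenness has to compensate.\<close>

lemma inverse_one_minus_exp_bound:
  fixes x :: complex
  assumes "x \<noteq> 0" "norm x \<le> 1 / 4"
  shows "norm (exp (- x) / (1 - exp (- x)) - 1 / x + 1 / 2) \<le> 5 * norm x"
proof -
  define w where "w = 1 - exp (- x)"
  define R where "R = w - (x - x\<^sup>2 / 2)"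
  have e: "exp \<bar>Re (- x)\<bar> \<le> 3"
  proof -
    have "\<bar>Re (- x)\<bar> \<le> 1" using assms abs_Re_le_cmod[of "-x"] by simp
    then show ?thesis using exp_le by (meson exp_le_cancel_iff order_trans)
  qed
  have "norm (exp (- x) - (\<Sum>k\<le>2. (- x) ^ k / fact k)) \<le> exp \<bar>Re (- x)\<bar> * (norm (- x)) ^ Suc 2 / fact 2"
    by (rule Taylor_exp)
  moreover have "exp (- x) - (\<Sum>k\<le>2. (- x) ^ k / fact k) = - R"
    by (simp add: R_def w_def eval_nat_numeral)
  ultimately have "norm R \<le> exp \<bar>Re (- x)\<bar> * norm x ^ 3 / 2"
    by (simp add: eval_nat_numeral)
  also have "\<dots> \<le> 3 * norm x ^ 3 / 2" using e by (intro divide_right_mono mult_right_mono) auto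
  finally have R: "norm R \<le> 3 / 2 * norm x ^ 3" by simp
  have x2: "norm x ^ 2 \<le> norm x / 4"
    using mult_left_mono[OF assms(2), of "norm x"] by (simp add: power2_eq_square)
  have x3: "norm x ^ 3 \<le> norm x / 16"
    using mult_mono[OF x2 assms(2)] by (simp add: power2_eq_square power3_eq_cube)
  have wR: "w = x - x\<^sup>2 / 2 + R" by (simp add: R_def)
  have "norm x = norm (w + x\<^sup>2 / 2 - R)" by (simp add: wR)
  also have "\<dots> \<le> norm w + norm (x\<^sup>2 / 2) + norm R"
    by (meson add_right_mono norm_triangle_ineq norm_triangle_ineq4 order_trans)
  also have "norm (x\<^sup>2 / 2) = norm x ^ 2 / 2" by (simp add: norm_divide norm_power)
  finally have wlow: "norm x / 2 \<le> norm w" using R x2 x3 norm_ge_zero[of x] by linarith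
  then have w0: "w \<noteq> 0" using assms by auto
  have "exp (- x) / (1 - exp (- x)) - 1 / x + 1 / 2 = (1 - w) / w - 1 / x + 1 / 2"
    by (simp add: w_def)
  also have "\<dots> = (2 * x - 2 * w - x * w) / (2 * x * w)"
    using w0 assms(1) by (simp add: field_simps)
  \<comment> \<open>The terms of order 1 and 2 in \<open>x\<close> cancel: a numerator of order 3
    stands over a denominator of order 2.\<close>
  also have "2 * x - 2 * w - x * w = - 2 * R + x ^ 3 / 2 - x * R"
    by (simp add: wR field_simps power2_eq_square power3_eq_cube)
  finally have eq: "norm (exp (- x) / (1 - exp (- x)) - 1 / x + 1 / 2)
      = norm (- 2 * R + x ^ 3 / 2 - x * R) / (2 * norm x * norm w)"
    by (simp add: norm_divide norm_mult)
  have "norm (- 2 * R + x ^ 3 / 2 - x * R) \<le> norm (- 2 * R) + norm (x ^ 3 / 2) + norm (x * R)"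
    by (meson add_right_mono norm_triangle_ineq norm_triangle_ineq4 order_trans)
  also have "\<dots> = 2 * norm R + norm x ^ 3 / 2 + norm x * norm R"
    by (simp add: norm_mult norm_divide norm_power)
  also have "norm x * norm R \<le> 1 / 4 * norm R" using assms(2) by (intro mult_right_mono) auto
  also have "2 * norm R + norm x ^ 3 / 2 + 1 / 4 * norm R \<le> 5 * norm x ^ 3"
    using R zero_le_power[OF norm_ge_zero, of x 3] by linarith
  finally have num: "norm (- 2 * R + x ^ 3 / 2 - x * R) \<le> 5 * norm x ^ 3" by simp
  have "norm (- 2 * R + x ^ 3 / 2 - x * R) / (2 * norm x * norm w) \<le> (5 * norm x ^ 3) / (2 * norm x * (norm x / 2))"
    using num wlow assms(1) w0 by (intro frac_le mult_left_mono) auto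
  also have "\<dots> = 5 * norm x" using assms(1) by (simp add: field_simps power3_eq_cube)
  finally show ?thesis unfolding eq .
qed

lemma exp_minus_le_inverse: "0 < (r::real) \<Longrightarrow> exp (- r) \<le> 1 / r"
proof -
  assume "0 < r"
  moreover have "r \<le> exp r" using exp_ge_add_one_self[of r] by linarith
  ultimately show ?thesis by (simp add: exp_minus field_simps)
qed

lemma exp_minus_over_one_minus_le:
  assumes "0 < (r::real)"
  shows "exp (- r) / (1 - exp (- r)) \<le> 1 / r"
proof -
  have "exp (- r) / (1 - exp (- r)) = 1 / (exp r - 1)"
    using assms by (simp add: exp_minus field_simps)
  also have "\<dots> \<le> 1 / r"
  proof -
    have "r \<le> exp r - 1" using exp_ge_add_one_self[of r] by linarith
    then show ?thesis using assms by (intro divide_left_mono mult_pos_pos) auto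
  qed
  finally show ?thesis .
qed

text \<open>The sector is closed and contains 0: the telescoping sums below start at the value at
  0.\<close>

definition sector :: "real \<Rightarrow> complex set" where
  "sector C = {x. 0 \<le> Re x \<and> \<bar>Im x\<bar> \<le> C * Re x}"

lemma sector_norm_le: "x \<in> sector C \<Longrightarrow> norm x \<le> (1 + C) * Re x"
  using cmod_le[of x] by (auto simp: sector_def algebra_simps)

lemma sector_scale: "x \<in> sector C \<Longrightarrow> 0 \<le> r \<Longrightarrow> of_real r * x \<in> sector C"
  using mult_left_mono[of "\<bar>Im x\<bar>" "C * Re x" r] by (auto simp: sector_def abs_mult mult.left_commute)

lemma sector_scale_nat: "x \<in> sector C \<Longrightarrow> of_nat n * x \<in> sector C"
  using sector_scale[of x C "real n"] by simp

lemma convex_sector: "convex (sector C)"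
proof -
  have "sector C = {x. Re x \<ge> 0} \<inter> {x. Im x - C * Re x \<le> 0} \<inter> {x. - Im x - C * Re x \<le> 0}"
    by (auto simp: sector_def)
  moreover have "convex {x. Im x - C * Re x \<le> 0}"
    using convex_halfspace_le[of "Complex (- C) 1" 0] by (simp add: inner_complex_def algebra_simps)
  moreover have "convex {x. - Im x - C * Re x \<le> 0}"
    using convex_halfspace_le[of "Complex (- C) (-1)" 0] by (simp add: inner_complex_def algebra_simps)
  moreover have "convex {x. Re x \<ge> 0}"
    using convex_halfspace_Re_ge[of 0] by simp
  ultimately show ?thesis by (simp add: convex_Int)
qed

section \<open>Partial fractions of a series with even periodic coefficients\<close>

locale even_periodic =
  fixes q :: nat and f :: "nat \<Rightarrow> complex"
  assumes q_pos: "q > 0" and periodic: "\<And>a. f (a mod q) = f a"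
    and reflect: "\<And>a. a \<le> q \<Longrightarrow> f (q - a) = f a" and f_0: "f 0 = 0"
begin

abbreviation "hat \<equiv> dft q f"

text \<open>The summands u / (1 - u), rather than 1 / (1 - u), vanish at \<open>w = 0\<close>, so
  that \<open>Phi (exp (- x))\<close> decays like \<open>exp (- Re x)\<close>.\<close>

definition Phi :: "complex \<Rightarrow> complex" where
  "Phi w = (\<Sum>b<q. hat b * (zeta q b * w / (1 - zeta q b * w)))"

lemma Phi_sums:
  assumes "norm w < 1"
  shows "(\<lambda>n. f n * w ^ n) sums Phi w"
proof -
  have "(\<lambda>n. \<Sum>b<q. hat b * (zeta q b * w) ^ n) sums (\<Sum>b<q. hat b * (1 / (1 - zeta q b * w)))"
    using assms by (intro sums_sum sums_mult geometric_sums) (simp add: norm_mult)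
  moreover have "(\<Sum>b<q. hat b * (zeta q b * w) ^ n) = f n * w ^ n" for n
    using dft_inversion[OF q_pos, of f n] periodic
    by (simp add: power_mult_distrib sum_distrib_left mult_ac)
  moreover have "(\<Sum>b<q. hat b * (1 / (1 - zeta q b * w))) = Phi w"
  proof -
    have "hat b * (1 / (1 - zeta q b * w)) = hat b + hat b * (zeta q b * w / (1 - zeta q b * w))" for b
    proof -
      have "zeta q b * w \<noteq> 1" using assms by (metis norm_mult norm_one norm_zeta mult_1 less_irrefl)
      then show ?thesis by (simp add: field_simps)
    qed
    then show ?thesis by (simp add: Phi_def sum.distrib sum_dft q_pos f_0)
  qed
  ultimately show ?thesis by simp
qed

text \<open>At most one pole is close to \<open>w\<close>. Its term is controlled by
  \<open>B\<close>, while all others have denominators bounded below and contribute only the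
  constant \<open>K\<close>.\<close>

lemma Phi_le_of_coeff_bound:
  obtains K where "0 \<le> K"
    "\<And>w B. norm w < 1 \<Longrightarrow> 0 \<le> B \<Longrightarrow> \<forall>b<q. norm (hat b) / norm (1 - zeta q b * w) \<le> B \<Longrightarrow>
       norm (Phi w) \<le> (B + K) * norm w"
proof -
  obtain c where c: "0 < c" "c \<le> 1"
    and sep: "\<And>b b'. b < q \<Longrightarrow> b' < q \<Longrightarrow> b \<noteq> b' \<Longrightarrow> 2 * c \<le> norm (zeta q b - zeta q b')"
    using zeta_separation[OF q_pos] by metis
  show thesis
  proof (rule that[of "(\<Sum>b<q. norm (hat b)) / c"])
    show "0 \<le> (\<Sum>b<q. norm (hat b)) / c" using c by (auto intro!: divide_nonneg_pos sum_nonneg)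
    fix w B assume w: "norm w < 1" "0 \<le> B"
      and B: "\<forall>b<q. norm (hat b) / norm (1 - zeta q b * w) \<le> B"
    \<comment> \<open>If no pole is within distance \<open>c\<close>, any \<open>b\<close>
      serves.\<close>
    obtain b where far: "\<And>b'. b' < q \<Longrightarrow> b' \<noteq> b \<Longrightarrow> c \<le> norm (1 - zeta q b' * w)"
      using zeta_separation_point[OF sep, of _ _ w] by (metis not_le)
    have "norm (hat b' * (zeta q b' * w / (1 - zeta q b' * w)))
        \<le> (if b' = b then B else 0) * norm w + norm (hat b') / c * norm w" if "b' < q" for b'
    proof -
      define N where "N = norm (hat b') / norm (1 - zeta q b' * w)"
      have "N \<le> (if b' = b then B else 0) + norm (hat b') / c"
      proof (cases "b' = b")
        case True
        then show ?thesis using B that c by (simp add: N_def add_increasing2)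
      next
        case False
        have "N \<le> norm (hat b') / c"
          unfolding N_def using far[OF that False] c by (intro divide_left_mono mult_pos_pos) auto
        then show ?thesis using False by simp
      qed
      then have "N * norm w \<le> ((if b' = b then B else 0) + norm (hat b') / c) * norm w"
        by (rule mult_right_mono) simp
      then show ?thesis by (simp add: N_def norm_mult norm_divide distrib_right)
    qed
    then have "norm (Phi w) \<le> (\<Sum>b'<q. (if b' = b then B else 0) * norm w + norm (hat b') / c * norm w)"
      unfolding Phi_def by (intro sum_norm_le) auto
    also have "\<dots> = (\<Sum>b'<q. if b' = b then B else 0) * norm w + (\<Sum>b'<q. norm (hat b')) / c * norm w"
      by (simp only: sum.distrib sum_distrib_right sum_divide_distrib)
    also have "\<dots> \<le> B * norm w + (\<Sum>b'<q. norm (hat b')) / c * norm w"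
      using w by (intro add_right_mono mult_right_mono) auto
    finally show "norm (Phi w) \<le> (B + (\<Sum>b<q. norm (hat b)) / c) * norm w"
      by (simp add: distrib_right)
  qed
qed

text \<open>Near 0 the point \<open>exp (- x)\<close> is close to 1 and hence separated from the
  other roots of unity. Elsewhere in the sector \<open>Re x\<close> is bounded below, so the modulus
  of \<open>exp (- x)\<close> stays below 1.\<close>

lemma sector_away:
  assumes C: "0 \<le> C"
  obtains c where "0 < c" "c \<le> 1"
    "\<And>x b. x \<in> sector C \<Longrightarrow> 0 < b \<Longrightarrow> b < q \<Longrightarrow> c \<le> norm (1 - zeta q b * exp (- x))"
proof -
  obtain c where c: "0 < c" "c \<le> 1"
    and sep: "\<And>b b'. b < q \<Longrightarrow> b' < q \<Longrightarrow> b \<noteq> b' \<Longrightarrow> 2 * c \<le> norm (zeta q b - zeta q b')"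
    using zeta_separation[OF q_pos] by metis
  \<comment> \<open>Chosen so that \<open>Re x \<le> \<eta>\<close> forces
    \<open>norm x \<le> c / 3\<close>, hence \<open>norm (exp (- x) - 1) \<le> c\<close>.\<close>
  define \<eta> where "\<eta> = c / 3 / (1 + C)"
  have C1: "0 < 1 + C" using C by simp
  have \<eta>: "0 < \<eta>" "\<eta> * (1 + C) = c / 3"
    using c C1 by (simp_all only: \<eta>_def nonzero_eq_divide_eq[symmetric] zero_less_divide_iff) auto
  show thesis
  proof (rule that[of "min c (1 - exp (- \<eta>))"])
    show "0 < min c (1 - exp (- \<eta>))" "min c (1 - exp (- \<eta>)) \<le> 1" using c \<eta> by auto
    fix x b assume x: "x \<in> sector C" and b: "0 < b" "b < q"
    show "min c (1 - exp (- \<eta>)) \<le> norm (1 - zeta q b * exp (- x))"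
    proof (cases "Re x \<le> \<eta>")
      case True
      have "norm x \<le> (1 + C) * Re x" by (rule sector_norm_le[OF x])
      also have "\<dots> \<le> (1 + C) * \<eta>" using True C by (intro mult_left_mono) auto
      finally have nx: "norm x \<le> c / 3" using \<eta> by (simp add: mult.commute)
      then have "norm (exp (- x) - 1) \<le> 3 * norm (- x)" using c by (intro norm_exp_minus_1_le) auto
      then have w: "norm (exp (- x) - 1) \<le> c" using nx by simp
      have "2 * c \<le> norm (zeta q 0 - zeta q b)" using sep[of 0 b] b by simp
      also have "zeta q 0 - zeta q b = (1 - zeta q b * exp (- x)) + zeta q b * (exp (- x) - 1)"
        by (simp add: algebra_simps)
      also have "norm \<dots> \<le> norm (1 - zeta q b * exp (- x)) + norm (exp (- x) - 1)"
        by (rule order_trans[OF norm_triangle_ineq]) (simp add: norm_mult)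
      finally show ?thesis using w by simp
    next
      case False
      have "1 - exp (- \<eta>) \<le> 1 - norm (zeta q b * exp (- x))"
        using False by (simp add: norm_mult)
      also have "\<dots> \<le> norm (1 - zeta q b * exp (- x))"
        using norm_triangle_ineq2[of 1 "zeta q b * exp (- x)"] by simp
      finally show ?thesis by simp
    qed
  qed
qed

lemma zeta_reflect: "b < q \<Longrightarrow> zeta q b * zeta q (q - b) = 1"
  by (simp add: zeta_add[symmetric] q_pos)

text \<open>Evenness pairs \<open>b\<close> with \<open>q - b\<close>, whose roots of unity are
  inverse to each other, and u / (1 - u) + (1/u) / (1 - 1/u) = -1. Twice the sum is therefore minus
  the sum of the nonzero-index coefficients, that is \<open>hat 0\<close>.\<close>

lemma sum_hat_at_0: "(\<Sum>b\<in>{1..<q}. hat b * (zeta q b / (1 - zeta q b))) = hat 0 / 2"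
proof -
  define S where "S = (\<Sum>b\<in>{1..<q}. hat b * (zeta q b / (1 - zeta q b)))"
  have "S = (\<Sum>b\<in>{1..<q}. hat b * (zeta q (q - b) / (1 - zeta q (q - b))))"
    unfolding S_def
    by (rule sum.reindex_bij_witness[of _ "\<lambda>b. q - b" "\<lambda>b. q - b"])
      (auto simp: dft_reflect reflect f_0)
  then have "S + S = (\<Sum>b\<in>{1..<q}. hat b * (zeta q b / (1 - zeta q b)))
      + (\<Sum>b\<in>{1..<q}. hat b * (zeta q (q - b) / (1 - zeta q (q - b))))"
    by (simp only: S_def)
  then have "S + S = (\<Sum>b\<in>{1..<q}. hat b * (zeta q b / (1 - zeta q b) + zeta q (q - b) / (1 - zeta q (q - b))))"
    by (simp only: sum.distrib[symmetric] distrib_left)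
  also have "\<dots> = (\<Sum>b\<in>{1..<q}. - hat b)"
  proof (rule sum.cong, rule refl)
    fix b assume "b \<in> {1..<q}"
    then have b: "zeta q b \<noteq> 1" "zeta q (q - b) = 1 / zeta q b"
      using zeta_eq_iff[OF q_pos, of b 0] zeta_reflect[of b] by (auto simp: field_simps)
    have "zeta q b / (1 - zeta q b) + zeta q (q - b) / (1 - zeta q (q - b)) = - 1"
    proof -
      have "zeta q b / (1 - zeta q b) = - (zeta q b / (zeta q b - 1))"
        by (metis minus_diff_eq minus_divide_right)
      moreover have "1 / zeta q b / (1 - 1 / zeta q b) = 1 / (zeta q b - 1)"
        using b(1) by (simp add: divide_simps)
      moreover have "- (zeta q b / (zeta q b - 1)) + 1 / (zeta q b - 1) = (1 - zeta q b) / (zeta q b - 1)"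
        by (simp add: diff_divide_distrib)
      moreover have "(1 - zeta q b) / (zeta q b - 1) = - 1"
        using b(1) by (metis divide_minus_left divide_self minus_diff_eq right_minus_eq)
      ultimately show ?thesis unfolding b(2) by simp
    qed
    then show "hat b * (zeta q b / (1 - zeta q b) + zeta q (q - b) / (1 - zeta q (q - b))) = - hat b"
      by simp
  qed
  also have "\<dots> = hat 0"
  proof -
    have "(\<Sum>b<q. hat b) = hat 0 + (\<Sum>b\<in>{1..<q}. hat b)"
      using q_pos by (simp add: sum.atLeast_Suc_lessThan atLeast0LessThan[symmetric])
    then show ?thesis using sum_dft[OF q_pos, of f] f_0 by (simp add: sum_negf eq_neg_iff_add_eq_0 neg_eq_iff_add_eq_0 add.commute)
  qed
  finally have "2 * S = hat 0" by simp
  then show ?thesis unfolding S_def[symmetric] by (metis nonzero_mult_div_cancel_left zero_neq_numeral)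
qed

lemma Phi_split:
  "Phi w = hat 0 * (w / (1 - w)) + (\<Sum>b\<in>{1..<q}. hat b * (zeta q b * w / (1 - zeta q b * w)))"
  unfolding Phi_def using q_pos
  by (simp add: sum.atLeast_Suc_lessThan atLeast0LessThan[symmetric])

text \<open>\<open>Phi (exp (- x))\<close> behaves like \<open>hat 0 / x\<close> near \<open>x = 0\<close>; by evenness there is no constant term.\<close>

definition Phi_reg :: "complex \<Rightarrow> complex" where
  "Phi_reg x = Phi (exp (- x)) - hat 0 / x"

text \<open>Near 0 the constant terms \<open>- hat 0 / 2\<close> and \<open>hat 0 / 2\<close> cancel
  and O(|x|) remains; far out every part is O(1 / |x|). The single majorant covers both ranges and
  makes the later sum over multiples of \<open>s\<close> bounded uniformly in
  \<open>s\<close>.\<close>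

lemma Phi_reg_bound:
  assumes C: "0 \<le> C"
  obtains K where "0 \<le> K"
    "\<And>x. x \<in> sector C \<Longrightarrow> x \<noteq> 0 \<Longrightarrow> norm (Phi_reg x) \<le> K * (norm x / (1 + (norm x)\<^sup>2))"
proof -
  obtain c where c: "0 < c" "c \<le> 1"
    and away: "\<And>x b. x \<in> sector C \<Longrightarrow> 0 < b \<Longrightarrow> b < q \<Longrightarrow> c \<le> norm (1 - zeta q b * exp (- x))"
    using sector_away[OF C] by metis
  define T where "T = (\<Sum>b\<in>{1..<q}. norm (hat b))"
  have T: "0 \<le> T" by (auto simp: T_def sum_nonneg)
  define K1 where "K1 = norm (hat 0) * 5 + T * 3 / c\<^sup>2"
  define K2 where "K2 = norm (hat 0) * (1 + C) + T * (1 + C) / c + norm (hat 0)"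
  have K1: "0 \<le> K1" and K2: "0 \<le> K2" using T C c by (auto simp: K1_def K2_def)
  show thesis
  proof (rule that[of "2 * K1 + 17 * K2"])
    show "0 \<le> 2 * K1 + 17 * K2" using K1 K2 by simp
    fix x assume x: "x \<in> sector C" "x \<noteq> 0"
    have nx: "norm x > 0" using x by simp
    define B where "B = norm x / (1 + (norm x)\<^sup>2)"
    have B0: "0 \<le> B" by (simp add: B_def)
    have Rx: "norm x \<le> (1 + C) * Re x" by (rule sector_norm_le[OF x(1)])
    then have "0 < (1 + C) * Re x" using nx by linarith
    then have Re: "0 < Re x" using C by (simp add: zero_less_mult_iff)
    have invRe: "1 / Re x \<le> (1 + C) / norm x" using Rx Re nx by (simp add: field_simps)
    define u where "u b = zeta q b * exp (- x)" for b
    have nu: "norm (u b) = exp (- Re x)" for b by (simp add: u_def norm_mult)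
    have far: "c \<le> norm (1 - u b)" if "b \<in> {1..<q}" for b
      using away[of x b] x that by (auto simp: u_def)
    have far0: "c \<le> norm (1 - zeta q b)" if "b \<in> {1..<q}" for b
      using away[of 0 b] that by (auto simp: sector_def)
    show "norm (Phi_reg x) \<le> (2 * K1 + 17 * K2) * (norm x / (1 + (norm x)\<^sup>2))"
    proof (cases "norm x \<le> 1 / 4")
      case True
      \<comment> \<open>\<open>hat 0 / 2\<close> is added in the first part and subtracted in the
        second, where it is written as the sum of the terms at \<open>x = 0\<close>.\<close>
      have "Phi_reg x = hat 0 * (exp (- x) / (1 - exp (- x)) - 1 / x + 1 / 2)
          + (\<Sum>b\<in>{1..<q}. hat b * (u b / (1 - u b) - zeta q b / (1 - zeta q b)))"
        unfolding Phi_reg_def Phi_split u_def[symmetric]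
        by (simp only: right_diff_distrib sum_subtractf sum_hat_at_0) (simp add: algebra_simps)
      also have "norm \<dots> \<le> norm (hat 0) * (5 * norm x) + (\<Sum>b\<in>{1..<q}. norm (hat b) * (3 * norm x / c\<^sup>2))"
      proof (intro order_trans[OF norm_triangle_ineq] add_mono sum_norm_le)
        show "norm (hat 0 * (exp (- x) / (1 - exp (- x)) - 1 / x + 1 / 2)) \<le> norm (hat 0) * (5 * norm x)"
          unfolding norm_mult using inverse_one_minus_exp_bound[OF x(2) True] by (intro mult_left_mono) auto
        fix b assume b: "b \<in> {1..<q}"
        have ne: "1 - u b \<noteq> 0" "1 - zeta q b \<noteq> 0" using far[OF b] far0[OF b] c by auto
        have "u b / (1 - u b) - zeta q b / (1 - zeta q b) = (u b - zeta q b) / ((1 - u b) * (1 - zeta q b))"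
          using ne by (simp add: field_simps)
        moreover have "norm (u b - zeta q b) \<le> 3 * norm x"
        proof -
          have "u b - zeta q b = zeta q b * (exp (- x) - 1)" by (simp add: u_def algebra_simps)
          then show ?thesis using norm_exp_minus_1_le[of "- x"] True by (simp add: norm_mult)
        qed
        ultimately have "norm (u b / (1 - u b) - zeta q b / (1 - zeta q b)) \<le> 3 * norm x / (c * c)"
          using far[OF b] far0[OF b] c
          by (simp only: norm_divide norm_mult) (intro frac_le mult_mono; auto)
        then show "norm (hat b * (u b / (1 - u b) - zeta q b / (1 - zeta q b))) \<le> norm (hat b) * (3 * norm x / c\<^sup>2)"
          unfolding norm_mult by (intro mult_left_mono) (auto simp: power2_eq_square)
      qed
      also have "\<dots> = K1 * norm x" unfolding K1_def T_def sum_distrib_right[symmetric] by (simp add: algebra_simps)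
      also have "\<dots> \<le> (2 * K1 + 17 * K2) * (norm x / (1 + (norm x)\<^sup>2))"
      proof -
        have "(norm x)\<^sup>2 \<le> 1" using True by (simp add: power_le_one)
        then have "norm x \<le> 2 * (norm x / (1 + (norm x)\<^sup>2))" using nx
          by (simp add: field_simps add_pos_nonneg)
        from mult_left_mono[OF this[folded B_def] K1] mult_nonneg_nonneg[OF K2 B0] show ?thesis
          unfolding B_def[symmetric] by (simp add: algebra_simps)
      qed
      finally show ?thesis .
    next
      case False
      have "norm (Phi_reg x) \<le> norm (hat 0) * (1 / Re x) + (\<Sum>b\<in>{1..<q}. norm (hat b) * (1 / Re x / c)) + norm (hat 0) / norm x"
        unfolding Phi_reg_def Phi_split u_def[symmetric]
      proof (intro order_trans[OF norm_triangle_ineq4] order_trans[OF norm_triangle_ineq] add_mono sum_norm_le)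
        have "1 - exp (- Re x) \<le> norm (1 - exp (- x))"
          using norm_triangle_ineq2[of 1 "exp (- x)"] by simp
        then have "exp (- Re x) / norm (1 - exp (- x)) \<le> exp (- Re x) / (1 - exp (- Re x))"
          using Re by (intro divide_left_mono mult_pos_pos) auto
        also have "\<dots> \<le> 1 / Re x" by (rule exp_minus_over_one_minus_le[OF Re])
        finally show "norm (hat 0 * (exp (- x) / (1 - exp (- x)))) \<le> norm (hat 0) * (1 / Re x)"
          unfolding norm_mult norm_divide by (intro mult_left_mono) auto
        show "norm (hat 0 / x) \<le> norm (hat 0) / norm x" by (simp add: norm_divide)
        fix b assume b: "b \<in> {1..<q}"
        have "norm (u b / (1 - u b)) \<le> (1 / Re x) / c"
          unfolding norm_divide nu using exp_minus_le_inverse[OF Re] far[OF b] c Re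
          by (intro frac_le) auto
        then show "norm (hat b * (u b / (1 - u b))) \<le> norm (hat b) * (1 / Re x / c)"
          unfolding norm_mult by (intro mult_left_mono) auto
      qed
      also have "\<dots> = (norm (hat 0) + T / c) * (1 / Re x) + norm (hat 0) / norm x"
        unfolding T_def sum_distrib_right[symmetric] by (simp add: algebra_simps)
      also have "\<dots> \<le> (norm (hat 0) + T / c) * ((1 + C) / norm x) + norm (hat 0) / norm x"
        using invRe T c by (intro add_right_mono mult_left_mono) auto
      also have "\<dots> = K2 * (1 / norm x)" by (simp add: K2_def field_simps add_divide_distrib)
      also have "\<dots> \<le> (2 * K1 + 17 * K2) * (norm x / (1 + (norm x)\<^sup>2))"
      proof -
        \<comment> \<open>From \<open>1 \<le> 16 * (norm x)^2\<close> follows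
          \<open>1 + (norm x)^2 \<le> 17 * (norm x)^2\<close>, the source of the factor 17.\<close>
        have "(1/4) * (1/4) \<le> norm x * norm x" using False by (intro mult_mono) auto
        then have "1 \<le> 16 * (norm x)\<^sup>2" by (simp add: power2_eq_square)
        then have "1 / norm x \<le> 17 * (norm x / (1 + (norm x)\<^sup>2))" using nx
          by (simp add: field_simps add_pos_nonneg power2_eq_square)
        from mult_left_mono[OF this[folded B_def] K2] mult_nonneg_nonneg[OF K1 B0] show ?thesis
          unfolding B_def[symmetric] by (simp add: algebra_simps)
      qed
      finally show ?thesis .
    qed
  qed
qed

lemma Phi_reg_holomorphic: "Phi_reg holomorphic_on {x. 0 < Re x}"
proof -
  have "zeta q b * exp (- x) \<noteq> 1" if "0 < Re x" for b x
  proof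
    assume "zeta q b * exp (- x) = 1"
    then have "norm (zeta q b * exp (- x)) = 1" by simp
    then show False using that by (simp add: norm_mult)
  qed
  then show ?thesis unfolding Phi_reg_def[abs_def] Phi_def by (intro holomorphic_intros) auto
qed

end

section \<open>A Riemann sum bounded uniformly in its mesh\<close>

lemma div_one_plus_square_le_arctan:
  assumes "0 < (t::real)" "0 < k"
  shows "t / (1 + (real k * t)\<^sup>2) \<le> arctan (real k * t) - arctan (real (k - 1) * t)"
proof -
  have kt: "real (k - 1) * t = real k * t - t" using assms by (simp add: of_nat_diff algebra_simps)
  have nn: "0 \<le> real (k - 1) * t" using assms by simp
  obtain z where z: "real (k - 1) * t < z" "z < real k * t"
    "arctan (real k * t) - arctan (real (k - 1) * t) = (real k * t - real (k - 1) * t) * inverse (1 + z\<^sup>2)"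
    using MVT2[of "real (k - 1) * t" "real k * t" arctan "\<lambda>x. inverse (1 + x\<^sup>2)"] assms kt DERIV_arctan
    by auto
  have "z\<^sup>2 \<le> (real k * t)\<^sup>2" using z nn by (intro power_mono) auto
  then have "t / (1 + (real k * t)\<^sup>2) \<le> t / (1 + z\<^sup>2)"
    using assms by (intro divide_left_mono mult_pos_pos add_pos_nonneg) auto
  also have "\<dots> = (real k * t - real (k - 1) * t) * inverse (1 + z\<^sup>2)"
    unfolding kt by (simp add: divide_inverse)
  also have "\<dots> = arctan (real k * t) - arctan (real (k - 1) * t)"
    by (rule z(3)[symmetric])
  finally show ?thesis .
qed

text \<open>A right-endpoint sum of the decreasing function 1 / (1 + u^2) with mesh \<open>t\<close>
  lies below its integral, an arctangent. That the bound does not depend on \<open>t\<close> is what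
  keeps \<open>D\<close> bounded as its argument tends to 0.\<close>

lemma sum_div_one_plus_square_le:
  assumes "0 < (t::real)"
  shows "(\<Sum>k=1..n. t / (1 + (real k * t)\<^sup>2)) \<le> 2"
proof -
  have "(\<Sum>k=1..n. t / (1 + (real k * t)\<^sup>2)) \<le> (\<Sum>k=1..n. arctan (real k * t) - arctan (real (k - 1) * t))"
    using assms by (intro sum_mono div_one_plus_square_le_arctan) auto
  also have "\<dots> = arctan (real n * t)" by (induction n) auto
  also have "\<dots> \<le> 2" using arctan_ubound[of "real n * t"] pi_less_4 by linarith
  finally show ?thesis .
qed

section \<open>Cancellation in the sum over odd multiples\<close>

context even_periodic
begin

abbreviation rot :: "nat \<Rightarrow> complex \<Rightarrow> complex" where
  "rot b x \<equiv> zeta q b * exp (- x)"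

text \<open>\<open>Phi (exp (- x))\<close> without its only term singular at 0. \<open>Lam1\<close>
  and \<open>Lam2\<close> below are its first two derivatives in closed form.\<close>

definition Lam :: "complex \<Rightarrow> complex" where
  "Lam x = (\<Sum>b\<in>{1..<q}. hat b * (rot b x / (1 - rot b x)))"

definition Lam1 :: "complex \<Rightarrow> complex" where
  "Lam1 x = (\<Sum>b\<in>{1..<q}. hat b * (- (rot b x) / (1 - rot b x)\<^sup>2))"

definition Lam2 :: "complex \<Rightarrow> complex" where
  "Lam2 x = (\<Sum>b\<in>{1..<q}. hat b * (rot b x * (1 + rot b x) / (1 - rot b x) ^ 3))"

lemma Lam_0: "Lam 0 = hat 0 / 2"
  using sum_hat_at_0 by (simp add: Lam_def)

lemma Phi_eq_Lam: "hat 0 = 0 \<Longrightarrow> Phi (exp (- x)) = Lam x"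
  by (simp add: Phi_split Lam_def)

text \<open>In the sector all denominators are at least \<open>c\<close>, and each numerator carries
  the factor \<open>exp (- Re x)\<close>. The constant 2 / c^3 comes from \<open>Lam2\<close> and
  also covers \<open>Lam\<close> because \<open>c \<le> 1\<close>.\<close>

lemma Lam_bounds:
  assumes C: "0 \<le> C"
  obtains K where "0 \<le> K"
    "\<And>x. x \<in> sector C \<Longrightarrow> (Lam has_field_derivative Lam1 x) (at x)"
    "\<And>x. x \<in> sector C \<Longrightarrow> (Lam1 has_field_derivative Lam2 x) (at x)"
    "\<And>x. x \<in> sector C \<Longrightarrow> norm (Lam x) \<le> K * exp (- Re x)"
    "\<And>x. x \<in> sector C \<Longrightarrow> norm (Lam2 x) \<le> K * exp (- Re x)"
proof -
  obtain c where c: "0 < c" "c \<le> 1"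
    and away: "\<And>x b. x \<in> sector C \<Longrightarrow> 0 < b \<Longrightarrow> b < q \<Longrightarrow> c \<le> norm (1 - rot b x)"
    using sector_away[OF C] by metis
  define K where "K = (\<Sum>b\<in>{1..<q}. norm (hat b)) * (2 / c ^ 3)"
  have c3: "c ^ 3 \<le> c" using c power_decreasing[of 1 3 c] by simp
  show thesis
  proof (rule that[of K])
    show "0 \<le> K" using c by (auto simp: K_def intro!: divide_nonneg_nonneg mult_nonneg_nonneg sum_nonneg)
    fix x assume x: "x \<in> sector C"
    define u where "u b = rot b x" for b
    have nu: "norm (u b) = exp (- Re x)" for b by (simp add: u_def norm_mult)
    have far: "c \<le> norm (1 - u b)" if "b \<in> {1..<q}" for b
      using away[of x b] x that by (auto simp: u_def)
    have ne: "rot b x \<noteq> 1" if "b \<in> {1..<q}" for b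
      using far[OF that] c by (auto simp: u_def)
    have exp1: "exp (- Re x) \<le> 1" using x by (simp add: sector_def)
    show "(Lam has_field_derivative Lam1 x) (at x)"
      unfolding Lam_def[abs_def] Lam1_def
    proof (rule DERIV_sum)
      fix b assume "b \<in> {1..<q}"
      then have "1 - rot b x \<noteq> 0" using ne[of b] by simp
      then show "((\<lambda>x. hat b * (rot b x / (1 - rot b x))) has_field_derivative
          hat b * (- (rot b x) / (1 - rot b x)\<^sup>2)) (at x)"
        by (auto intro!: derivative_eq_intros simp: field_simps power2_eq_square)
    qed
    show "(Lam1 has_field_derivative Lam2 x) (at x)"
      unfolding Lam1_def[abs_def] Lam2_def
    proof (rule DERIV_sum)
      fix b assume "b \<in> {1..<q}"
      then have n: "1 - rot b x \<noteq> 0" using ne[of b] by simp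
      have *: "(u * d\<^sup>2 + u * (2 * d * u)) / (d\<^sup>2)\<^sup>2 = u * (1 + u) / d ^ 3" if "d = 1 - u" "d \<noteq> 0" for u d :: complex
      proof -
        have "u * d\<^sup>2 + u * (2 * d * u) = u * (1 + u) * d"
          by (simp add: that(1) power2_eq_square algebra_simps)
        then have "(u * d\<^sup>2 + u * (2 * d * u)) / (d\<^sup>2)\<^sup>2 = (u * (1 + u) * d) / (d ^ 3 * d)"
          by (simp add: eval_nat_numeral)
        then show ?thesis using that(2) by simp
      qed
      have "((\<lambda>x. - (rot b x) / (1 - rot b x)\<^sup>2) has_field_derivative
          (rot b x * (1 - rot b x)\<^sup>2 + rot b x * (2 * (1 - rot b x) * (rot b x)))
             / ((1 - rot b x)\<^sup>2)\<^sup>2) (at x)"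
      proof -
        have e: "((\<lambda>x. rot b x) has_field_derivative - (rot b x)) (at x)"
          by (auto intro!: derivative_eq_intros)
        have "(1 - rot b x)\<^sup>2 \<noteq> 0" using n by simp
        from DERIV_divide[OF DERIV_minus[OF e] DERIV_power[OF DERIV_diff[OF DERIV_const e]] this]
        show ?thesis by (rule DERIV_cong) (simp add: power2_eq_square mult_ac)
      qed
      then show "((\<lambda>x. hat b * (- (rot b x) / (1 - rot b x)\<^sup>2)) has_field_derivative
          hat b * (rot b x * (1 + rot b x) / (1 - rot b x) ^ 3)) (at x)"
        unfolding *[OF refl n] by (rule DERIV_cmult)
    qed
    have "norm (Lam x) \<le> (\<Sum>b\<in>{1..<q}. norm (hat b) * (2 / c ^ 3 * exp (- Re x)))"
      unfolding Lam_def u_def[symmetric]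
    proof (rule sum_norm_le)
      fix b assume b: "b \<in> {1..<q}"
      have "norm (u b / (1 - u b)) \<le> exp (- Re x) / c"
        unfolding norm_divide nu using far[OF b] c by (intro divide_left_mono mult_pos_pos) auto
      also have "\<dots> \<le> exp (- Re x) / c ^ 3" using c c3 by (intro divide_left_mono mult_pos_pos) auto
      also have "\<dots> \<le> 2 * (exp (- Re x) / c ^ 3)"
      proof -
        have "0 \<le> exp (- Re x) / c ^ 3" using c by (intro divide_nonneg_nonneg) auto
        then show ?thesis by linarith
      qed
      also have "\<dots> = 2 / c ^ 3 * exp (- Re x)" by simp
      finally show "norm (hat b * (u b / (1 - u b))) \<le> norm (hat b) * (2 / c ^ 3 * exp (- Re x))"
        unfolding norm_mult by (intro mult_left_mono) auto
    qed
    then show "norm (Lam x) \<le> K * exp (- Re x)"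
      unfolding K_def sum_distrib_right by (simp only: mult.assoc)
    have "norm (Lam2 x) \<le> (\<Sum>b\<in>{1..<q}. norm (hat b) * (2 / c ^ 3 * exp (- Re x)))"
      unfolding Lam2_def u_def[symmetric]
    proof (rule sum_norm_le)
      fix b assume b: "b \<in> {1..<q}"
      have "norm (1 + u b) \<le> 2" using norm_triangle_ineq[of 1 "u b"] exp1 unfolding nu norm_one by linarith
      moreover have "c ^ 3 \<le> norm (1 - u b) ^ 3" using far[OF b] c by (intro power_mono) auto
      ultimately have "norm (u b * (1 + u b) / (1 - u b) ^ 3) \<le> exp (- Re x) * 2 / c ^ 3"
        unfolding norm_divide norm_mult norm_power nu using c by (intro frac_le mult_left_mono) auto
      also have "\<dots> = 2 / c ^ 3 * exp (- Re x)" by simp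
      finally show "norm (hat b * (u b * (1 + u b) / (1 - u b) ^ 3)) \<le> norm (hat b) * (2 / c ^ 3 * exp (- Re x))"
        unfolding norm_mult by (intro mult_left_mono) auto
    qed
    then show "norm (Lam2 x) \<le> K * exp (- Re x)"
      unfolding K_def sum_distrib_right by (simp only: mult.assoc)
  qed
qed

text \<open>The midpoint rule compares the sum of \<open>Lam1\<close> with a telescoping sum, whose value is negligible
  because \<open>Lam\<close> vanishes at \<open>0\<close> and at infinity.\<close>

lemma Lam1_sum_bound:
  assumes C: "0 \<le> C" and hat0: "hat 0 = 0"
  obtains K where "0 \<le> K"
    "\<And>s J. s \<in> sector C \<Longrightarrow> 0 < Re s \<Longrightarrow> Re s \<le> 2 \<Longrightarrow>
       norm (\<Sum>j<J. Lam1 (of_nat (2 * j + 1) * s)) \<le> K * (1 + exp (- (2 * real J * Re s)) / Re s)"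
proof -
  obtain K where K: "0 \<le> K"
    and D: "\<And>x. x \<in> sector C \<Longrightarrow> (Lam has_field_derivative Lam1 x) (at x)"
    and D1: "\<And>x. x \<in> sector C \<Longrightarrow> (Lam1 has_field_derivative Lam2 x) (at x)"
    and B: "\<And>x. x \<in> sector C \<Longrightarrow> norm (Lam x) \<le> K * exp (- Re x)"
    and B2: "\<And>x. x \<in> sector C \<Longrightarrow> norm (Lam2 x) \<le> K * exp (- Re x)"
    using Lam_bounds[OF C] by metis
  show thesis
  proof (rule that[of "5 * K * (1 + C)"])
    show "0 \<le> 5 * K * (1 + C)" using K C by simp
    fix s J assume s: "s \<in> sector C" "0 < Re s" "Re s \<le> 2"
    define r where "r = Re s"
    have ns: "0 < norm s" using s by auto
    have rs: "r \<le> norm s" using complex_Re_le_cmod by (simp add: r_def)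
    have sr: "norm s \<le> (1 + C) * r" using sector_norm_le[OF s(1)] by (simp add: r_def)
    \<comment> \<open>Midpoint error on one step of length \<open>2 * s\<close>. A bound on
      \<open>Lam2\<close> suffices: the error is quadratic in \<open>s\<close> and decays
      geometrically in \<open>j\<close>, so the total is of order |s|^2 / Re s, hence O(|s|) in the
      sector.\<close>
    have step: "norm ((Lam (of_nat (2 * j + 2) * s) - Lam (of_nat (2 * j) * s)) - 2 * s * Lam1 (of_nat (2 * j + 1) * s))
        \<le> 2 * K * (norm s)\<^sup>2 * exp (- 2 * r) ^ j" for j
    proof -
      define a where "a = of_nat (2 * j) * s"
      define b where "b = of_nat (2 * j + 2) * s"
      define m where "m = of_nat (2 * j + 1) * s"
      have ab: "a \<in> sector C" "b \<in> sector C" "m \<in> sector C"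
        unfolding a_def b_def m_def by (rule sector_scale_nat[OF s(1)])+
      have seg: "closed_segment a b \<subseteq> sector C"
        by (rule closed_segment_subset[OF ab(1,2) convex_sector])
      have Re_seg: "2 * real j * r \<le> Re x" if "x \<in> closed_segment a b" for x
      proof -
        from that obtain t where t: "0 \<le> t" "t \<le> 1" "x = (1 - t) *\<^sub>R a + t *\<^sub>R b"
          by (auto simp: in_segment)
        have "Re x = 2 * real j * r + 2 * t * r"
          by (simp add: t(3) a_def b_def r_def algebra_simps)
        then show ?thesis using t s by (simp add: r_def)
      qed
      have mseg: "m \<in> closed_segment a b"
        unfolding in_segment by (rule exI[of _ "1/2"]) (auto simp: a_def b_def m_def scaleR_conv_of_real field_simps)
      have "norm (x - m) \<le> norm s" if x: "x \<in> closed_segment a b" for x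
      proof -
        from x obtain t where t: "0 \<le> t" "t \<le> 1" "x = (1 - t) *\<^sub>R a + t *\<^sub>R b"
          by (auto simp: in_segment)
        have "x - m = of_real (2 * t - 1) * s"
          by (simp add: t(3) a_def b_def m_def scaleR_conv_of_real algebra_simps)
        then have "norm (x - m) = \<bar>2 * t - 1\<bar> * norm s" by (simp only: norm_mult norm_of_real)
        also have "\<dots> \<le> 1 * norm s" using t by (intro mult_right_mono) auto
        finally show ?thesis by simp
      qed
      note xm = this
      have L2: "norm (Lam2 x) \<le> K * exp (- (2 * real j * r))" if "x \<in> closed_segment a b" for x
      proof -
        have "norm (Lam2 x) \<le> K * exp (- Re x)" using that seg by (intro B2) auto
        also have "\<dots> \<le> K * exp (- (2 * real j * r))" using Re_seg[OF that] K by (intro mult_left_mono) auto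
        finally show ?thesis .
      qed
      have L1: "norm (Lam1 x - Lam1 m) \<le> K * exp (- (2 * real j * r)) * norm s" if x: "x \<in> closed_segment a b" for x
      proof -
        have "norm (Lam1 x - Lam1 m) \<le> K * exp (- (2 * real j * r)) * norm (x - m)"
          by (rule field_differentiable_bound[OF convex_closed_segment[of a b], of _ Lam2])
            (use x mseg L2 D1 seg in \<open>auto intro: has_field_derivative_at_within\<close>)
        also have "\<dots> \<le> K * exp (- (2 * real j * r)) * norm s" using xm[OF x] K by (intro mult_left_mono) auto
        finally show ?thesis .
      qed
      \<comment> \<open>Subtracting the linear function with the slope at the midpoint leaves a
        function with small derivative on the segment.\<close>
      have "norm ((Lam b - Lam1 m * b) - (Lam a - Lam1 m * a)) \<le> K * exp (- (2 * real j * r)) * norm s * norm (b - a)"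
      proof (rule field_differentiable_bound[OF convex_closed_segment[of a b], of _ "\<lambda>x. Lam1 x - Lam1 m"])
        fix x assume "x \<in> closed_segment a b"
        then have "x \<in> sector C" using seg by auto
        from D[OF this] DERIV_cmult[OF DERIV_ident, of "Lam1 m" x UNIV]
        have "((\<lambda>x. Lam x - Lam1 m * x) has_field_derivative (Lam1 x - Lam1 m * 1)) (at x)"
          by (rule DERIV_diff)
        then show "((\<lambda>x. Lam x - Lam1 m * x) has_field_derivative (Lam1 x - Lam1 m)) (at x within closed_segment a b)"
          by (simp add: has_field_derivative_at_within)
      qed (use L1 in auto)
      moreover have ba: "b - a = 2 * s" by (simp add: a_def b_def algebra_simps)
      moreover have "(Lam b - Lam1 m * b) - (Lam a - Lam1 m * a) = (Lam b - Lam a) - 2 * s * Lam1 m"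
        unfolding ba[symmetric] by (simp add: algebra_simps)
      moreover have "exp (- (2 * real j * r)) = exp (- 2 * r) ^ j"
        by (simp add: exp_of_nat_mult[symmetric] mult_ac)
      ultimately have "norm ((Lam b - Lam a) - 2 * s * Lam1 m) \<le> K * exp (- 2 * r) ^ j * norm s * norm (2 * s)"
        by simp
      also have "\<dots> = 2 * K * (norm s)\<^sup>2 * exp (- 2 * r) ^ j"
        by (simp add: norm_mult power2_eq_square mult_ac)
      finally show ?thesis unfolding a_def b_def m_def .
    qed
    \<comment> \<open>The lower end contributes \<open>Lam 0 = hat 0 / 2\<close>, which vanishes by
      \<open>hat0\<close>.\<close>
    have tel: "(\<Sum>j<J. Lam (of_nat (2 * j + 2) * s) - Lam (of_nat (2 * j) * s)) = Lam (of_nat (2 * J) * s)"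
      using sum_lessThan_telescope[of "\<lambda>j. Lam (of_nat (2 * j) * s)" J] Lam_0 hat0 by simp
    have "exp (- 2 * r) < 1" using s by (simp add: r_def)
    then have geo: "(\<Sum>j<J. exp (- 2 * r) ^ j) \<le> 1 / (1 - exp (- 2 * r))"
      by (subst sum_gp_strict) (auto simp: divide_simps)
    have "1 / (1 - exp (- 2 * r)) = 1 + exp (- (2 * r)) / (1 - exp (- (2 * r)))"
      using \<open>exp (- 2 * r) < 1\<close> by (simp add: field_simps)
    also have "\<dots> \<le> 1 + 1 / (2 * r)"
      using exp_minus_over_one_minus_le[of "2 * r"] s by (simp add: r_def)
    \<comment> \<open>Uses \<open>Re s \<le> 2\<close>. That range accommodates the segment from
      \<open>s\<close> to \<open>2 * s\<close> with \<open>Re s \<le> 1\<close> in the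
      application.\<close>
    also have "\<dots> \<le> 5 / (2 * r)" using s by (simp add: r_def field_simps)
    finally have geo': "(\<Sum>j<J. exp (- 2 * r) ^ j) \<le> 5 / (2 * r)" using geo by simp
    have "norm (2 * s * (\<Sum>j<J. Lam1 (of_nat (2 * j + 1) * s)))
        = norm (Lam (of_nat (2 * J) * s) - (\<Sum>j<J. (Lam (of_nat (2 * j + 2) * s) - Lam (of_nat (2 * j) * s)) - 2 * s * Lam1 (of_nat (2 * j + 1) * s)))"
      unfolding sum_subtractf[of _ "\<lambda>j. 2 * s * Lam1 (of_nat (2 * j + 1) * s)"] tel by (simp add: sum_distrib_left)
    also have "\<dots> \<le> norm (Lam (of_nat (2 * J) * s)) + (\<Sum>j<J. 2 * K * (norm s)\<^sup>2 * exp (- 2 * r) ^ j)"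
      by (intro order_trans[OF norm_triangle_ineq4] add_mono order_refl sum_norm_le step)
    also have "norm (Lam (of_nat (2 * J) * s)) \<le> K * exp (- (2 * real J * r))"
      using B[OF sector_scale_nat[OF s(1)], of "2 * J"] by (simp add: r_def)
    also have "(\<Sum>j<J. 2 * K * (norm s)\<^sup>2 * exp (- 2 * r) ^ j) \<le> 2 * K * (norm s)\<^sup>2 * (5 / (2 * r))"
      unfolding sum_distrib_left[symmetric] using geo' K by (intro mult_left_mono) auto
    also have "\<dots> \<le> 2 * K * (norm s * ((1 + C) * r)) * (5 / (2 * r))"
      unfolding power2_eq_square using sr K s by (intro mult_right_mono mult_left_mono) (auto simp: r_def)
    also have "\<dots> = 2 * norm s * (5 / 2 * K * (1 + C))" using s by (simp add: r_def)
    finally have "2 * norm s * norm (\<Sum>j<J. Lam1 (of_nat (2 * j + 1) * s))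
        \<le> K * exp (- (2 * real J * r)) + 2 * norm s * (5 / 2 * K * (1 + C))"
      by (simp add: norm_mult)
    also have "K * exp (- (2 * real J * r)) \<le> 2 * norm s * (K * (exp (- (2 * real J * r)) / r))"
    proof -
      have "1 \<le> 2 * norm s / r" using rs s by (simp add: r_def field_simps)
      then have "K * exp (- (2 * real J * r)) * 1 \<le> K * exp (- (2 * real J * r)) * (2 * norm s / r)"
        using K by (intro mult_left_mono) auto
      then show ?thesis by (simp add: mult_ac)
    qed
    finally have "2 * norm s * norm (\<Sum>j<J. Lam1 (of_nat (2 * j + 1) * s))
        \<le> 2 * norm s * (K * (exp (- (2 * real J * r)) / r) + 5 / 2 * K * (1 + C))"
      by (simp add: distrib_left)
    then have "norm (\<Sum>j<J. Lam1 (of_nat (2 * j + 1) * s)) \<le> K * (exp (- (2 * real J * r)) / r) + 5 / 2 * K * (1 + C)"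
      using ns by simp
    also have "\<dots> \<le> 5 * K * (1 + C) * (exp (- (2 * real J * r)) / r) + 5 * K * (1 + C)"
    proof -
      have "0 \<le> K * C" using K C by simp
      then have "K \<le> 5 * K * (1 + C)" "5 / 2 * K * (1 + C) \<le> 5 * K * (1 + C)"
        using K by (simp_all add: algebra_simps)
      then show ?thesis using s K C by (intro add_mono mult_right_mono) (auto simp: r_def)
    qed
    finally show "norm (\<Sum>j<J. Lam1 (of_nat (2 * j + 1) * s)) \<le> 5 * K * (1 + C) * (1 + exp (- (2 * real J * Re s)) / Re s)"
      by (simp add: r_def algebra_simps)
  qed
qed

text \<open>The term of exponent \<open>2 * j + 1\<close> in the difference
  \<open>G(2 s) - G(s)\<close>.\<close>

definition dilation :: "complex \<Rightarrow> nat \<Rightarrow> complex" where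
  "dilation s j = (Phi (exp (- (of_nat (2 * j + 1) * (2 * s)))) - Phi (exp (- (of_nat (2 * j + 1) * s)))) / of_nat (2 * j + 1)"

text \<open>The mean value inequality on the segment from \<open>s\<close> to \<open>2 * s\<close>
  is applied to partial sums. The chain rule factor \<open>2 * j + 1\<close> cancels the division,
  leaving exactly the sum of \<open>Lam1\<close>, and the part of its bound that depends on
  \<open>J\<close> disappears in the limit.\<close>

lemma odd_sum_dilation_bound:
  assumes C: "0 \<le> C" and hat0: "hat 0 = 0"
  obtains K where "0 \<le> K"
    "\<And>s d. s \<in> sector C \<Longrightarrow> 0 < Re s \<Longrightarrow> Re s \<le> 1 \<Longrightarrow>
       dilation s sums d \<Longrightarrow> norm d \<le> K * norm s"
proof -
  obtain K0 where D: "\<And>x. x \<in> sector C \<Longrightarrow> (Lam has_field_derivative Lam1 x) (at x)"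
    using Lam_bounds[OF C] by metis
  obtain K where K: "0 \<le> K"
    and bd: "\<And>s J. s \<in> sector C \<Longrightarrow> 0 < Re s \<Longrightarrow> Re s \<le> 2 \<Longrightarrow>
       norm (\<Sum>j<J. Lam1 (of_nat (2 * j + 1) * s)) \<le> K * (1 + exp (- (2 * real J * Re s)) / Re s)"
    using Lam1_sum_bound[OF C hat0] by metis
  show thesis
  proof (rule that[OF K])
    fix s d
    assume s: "s \<in> sector C" "0 < Re s" "Re s \<le> 1"
      and d: "dilation s sums d"
    define G where "G J x = (\<Sum>j<J. Lam (of_nat (2 * j + 1) * x) / of_nat (2 * j + 1))" for J x
    have s2: "2 * s \<in> sector C" using sector_scale[OF s(1), of 2] by simp
    have seg: "closed_segment s (2 * s) \<subseteq> sector C"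
      by (rule closed_segment_subset[OF s(1) s2 convex_sector])
    have Re_seg: "Re s \<le> Re x" "Re x \<le> 2" if "x \<in> closed_segment s (2 * s)" for x
    proof -
      from that obtain t where t: "0 \<le> t" "t \<le> 1" "x = (1 - t) *\<^sub>R s + t *\<^sub>R (2 * s)"
        by (auto simp: in_segment)
      have "Re x = Re s + t * Re s" by (simp add: t(3) algebra_simps)
      moreover have "0 \<le> t * Re s" "t * Re s \<le> 1" using t s by (auto intro!: mult_le_one)
      ultimately show "Re s \<le> Re x" "Re x \<le> 2" using s by auto
    qed
    have main: "norm (G J (2 * s) - G J s) \<le> K * (1 + exp (- (2 * real J * Re s)) / Re s) * norm s" for J
    proof -
      have "norm (G J (2 * s) - G J s) \<le> K * (1 + exp (- (2 * real J * Re s)) / Re s) * norm (2 * s - s)"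
      proof (rule field_differentiable_bound[OF convex_closed_segment[of s "2 * s"], of _ "\<lambda>x. \<Sum>j<J. Lam1 (of_nat (2 * j + 1) * x)"])
        fix x assume x: "x \<in> closed_segment s (2 * s)"
        have "(G J has_field_derivative (\<Sum>j<J. Lam1 (of_nat (2 * j + 1) * x))) (at x)"
          unfolding G_def[abs_def]
        proof (rule DERIV_sum)
          fix j
          have "of_nat (2 * j + 1) * x \<in> sector C" using x seg by (intro sector_scale_nat) auto
          from DERIV_chain2[where g = "\<lambda>x. of_nat (2 * j + 1) * x" and Db = "of_nat (2 * j + 1)" and x = x and s = UNIV, OF D[OF this]]
          have "((\<lambda>x. Lam (of_nat (2 * j + 1) * x)) has_field_derivative
              Lam1 (of_nat (2 * j + 1) * x) * of_nat (2 * j + 1)) (at x)"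
            using DERIV_cmult[OF DERIV_ident, of "of_nat (2 * j + 1)" x UNIV] by simp
          from DERIV_cdivide[OF this, of "of_nat (2 * j + 1)"]
          show "((\<lambda>x. Lam (of_nat (2 * j + 1) * x) / of_nat (2 * j + 1)) has_field_derivative
              Lam1 (of_nat (2 * j + 1) * x)) (at x)"
            by (simp del: of_nat_add of_nat_mult of_nat_Suc)
        qed
        then show "(G J has_field_derivative (\<Sum>j<J. Lam1 (of_nat (2 * j + 1) * x))) (at x within closed_segment s (2 * s))"
          by (rule has_field_derivative_at_within)
        have "norm (\<Sum>j<J. Lam1 (of_nat (2 * j + 1) * x)) \<le> K * (1 + exp (- (2 * real J * Re x)) / Re x)"
          using x seg Re_seg[OF x] s by (intro bd) auto
        also have "\<dots> \<le> K * (1 + exp (- (2 * real J * Re s)) / Re s)"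
          using Re_seg[OF x] s K by (intro mult_left_mono add_left_mono frac_le) (auto intro: mult_left_mono)
        finally show "norm (\<Sum>j<J. Lam1 (of_nat (2 * j + 1) * x)) \<le> K * (1 + exp (- (2 * real J * Re s)) / Re s)" .
      qed auto
      then show ?thesis by simp
    qed
    have "(\<lambda>J. G J (2 * s) - G J s) \<longlonglongrightarrow> d"
      using d unfolding sums_def G_def dilation_def Phi_eq_Lam[OF hat0] by (simp add: diff_divide_distrib sum_subtractf)
    moreover have "(\<lambda>J. K * (1 + exp (- (2 * real J * Re s)) / Re s) * norm s) \<longlonglongrightarrow> K * (1 + 0 / Re s) * norm s"
    proof (intro tendsto_intros)
      show "(\<lambda>J. exp (- (2 * real J * Re s))) \<longlonglongrightarrow> 0"
        using s(2) by real_asymp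
    qed (use s in auto)
    ultimately have "norm d \<le> K * (1 + 0 / Re s) * norm s"
      using main by (intro tendsto_le[OF trivial_limit_sequentially, OF _ tendsto_norm]) (auto intro: always_eventually)
    then show "norm d \<le> K * norm s" by simp
  qed
qed

end

subsection \<open>The generating function\<close>

definition parts_up_to :: "nat \<Rightarrow> nat \<Rightarrow> nat multiset set" where
  "parts_up_to N n = {P \<in> partitions n. set_mset P \<subseteq> {..N}}"

definition part_sum :: "(nat \<Rightarrow> int) \<Rightarrow> nat \<Rightarrow> nat \<Rightarrow> int" where
  "part_sum f N n = (\<Sum>P\<in>parts_up_to N n. partition_weight f P)"

lemma finite_parts_up_to: "finite (parts_up_to N n)"
  by (simp add: parts_up_to_def finite_partitions)

lemma part_sum_0: "part_sum f 0 n = (if n = 0 then 1 else 0)"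
proof -
  have "parts_up_to 0 n = (if n = 0 then {{#}} else {})"
  proof -
    have 1: "{#} \<in> parts_up_to 0 n \<longleftrightarrow> n = 0"
      by (auto simp: parts_up_to_def partitions_def)
    have 2: "P = {#}" if "P \<in> parts_up_to 0 n" for P
    proof (rule ccontr)
      assume "P \<noteq> {#}"
      then obtain x where "x \<in># P" by blast
      with that show False by (auto simp: parts_up_to_def partitions_def)
    qed
    have "P \<in> parts_up_to 0 n \<longleftrightarrow> P \<in> (if n = 0 then {{#}} else {})" for P
      using 1 2[of P] by auto
    then show ?thesis by blast
  qed
  then show ?thesis by (simp add: part_sum_def partition_weight_def)
qed

text \<open>Either \<open>Suc N\<close> does not occur, or one copy of it is removed; further copies
  may remain, so the index on the right is still \<open>Suc N\<close>.\<close>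

lemma parts_up_to_Suc:
  "parts_up_to (Suc N) n = parts_up_to N n \<union>
    (if Suc N \<le> n then add_mset (Suc N) ` parts_up_to (Suc N) (n - Suc N) else {})"
  (is "?L = ?R")
proof (intro equalityI subsetI)
  fix P assume P: "P \<in> ?L"
  show "P \<in> ?R"
  proof (cases "Suc N \<in># P")
    case True
    then obtain Q where Q: "P = add_mset (Suc N) Q" by (meson multi_member_split)
    then have "Suc N \<le> n" "Q \<in> parts_up_to (Suc N) (n - Suc N)"
      using P by (auto simp: parts_up_to_def partitions_def)
    then show ?thesis using Q by auto
  next
    case False
    then have "set_mset P \<subseteq> {..N}"
      using P by (fastforce simp: parts_up_to_def le_Suc_eq)
    then show ?thesis using P by (auto simp: parts_up_to_def)
  qed
next
  fix P assume "P \<in> ?R"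
  then show "P \<in> ?L"
    by (auto simp: parts_up_to_def partitions_def split: if_splits)
qed

lemma part_sum_Suc:
  "part_sum f (Suc N) n = part_sum f N n +
    (if Suc N \<le> n then f (Suc N) * part_sum f (Suc N) (n - Suc N) else 0)"
proof (cases "Suc N \<le> n")
  case True
  have "parts_up_to N n \<inter> add_mset (Suc N) ` parts_up_to (Suc N) (n - Suc N) = {}"
    by (auto simp: parts_up_to_def)
  moreover have "(\<Sum>P\<in>add_mset (Suc N) ` parts_up_to (Suc N) (n - Suc N). partition_weight f P)
      = f (Suc N) * part_sum f (Suc N) (n - Suc N)"
    by (subst sum.reindex) (auto simp: part_sum_def partition_weight_def sum_distrib_left intro: inj_onI)
  ultimately show ?thesis using True
    by (subst part_sum_def, subst parts_up_to_Suc)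
      (simp add: sum.union_disjoint finite_parts_up_to part_sum_def)
qed (simp add: part_sum_def parts_up_to_Suc)

lemma part_sum_eq:
  assumes "n \<le> N"
  shows "part_sum f N n = signed_partition_number n f"
proof -
  have "parts_up_to N n = partitions n"
    using partitions_sizes(1)[of _ n] assms by (force simp: parts_up_to_def)
  then show ?thesis by (simp add: part_sum_def signed_partition_number_def)
qed

text \<open>Multiplying by the factor for \<open>Suc N\<close> undoes one step of the recurrence
  \<open>part_sum_Suc\<close>, so induction reduces the product to the series 1.\<close>

lemma fps_part_sum:
  "Abs_fps (\<lambda>n. of_int (part_sum f N n)) *
     (\<Prod>k=1..N. 1 - fps_const (of_int (f k)) * fps_X ^ k) = (1 :: complex fps)"
proof (induction N)
  case 0
  show ?case by (rule fps_ext) (simp add: part_sum_0)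
next
  case (Suc N)
  have "Abs_fps (\<lambda>n. of_int (part_sum f (Suc N) n)) * (1 - fps_const (of_int (f (Suc N))) * fps_X ^ Suc N)
      = Abs_fps (\<lambda>n. of_int (part_sum f N n) :: complex)"
  proof (rule fps_ext)
    fix n
    define A :: "complex fps" where "A = Abs_fps (\<lambda>n. of_int (part_sum f (Suc N) n))"
    have "A * (1 - fps_const (of_int (f (Suc N))) * fps_X ^ Suc N)
        = A - fps_const (of_int (f (Suc N))) * (A * fps_X ^ Suc N)"
      by (simp add: algebra_simps)
    then show "fps_nth (A * (1 - fps_const (of_int (f (Suc N))) * fps_X ^ Suc N)) n
        = fps_nth (Abs_fps (\<lambda>n. of_int (part_sum f N n) :: complex)) n"
      by (simp add: fps_X_power_mult_right_nth A_def part_sum_Suc del: power_Suc)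
  qed
  then show ?case using Suc.IH
    by (simp only: prod.nat_ivl_Suc' Suc_leI zero_less_Suc le_SucI One_nat_def mult.assoc[symmetric])
qed

text \<open>For \<open>n \<le> N\<close> parts larger than \<open>N\<close> cannot occur, so the
  finite product already has the right coefficient, which Cauchy's formula extracts.\<close>

lemma finite_product_has_contour_integral:
  fixes f :: "nat \<Rightarrow> int"
  assumes f: "\<And>k. \<bar>f k\<bar> \<le> 1" and r: "0 < r" "r < 1" and "n \<le> N"
  shows "((\<lambda>u. inverse (\<Prod>k=1..N. 1 - of_int (f k) * u ^ k) / u ^ Suc n) has_contour_integral
      (2 * pi * \<i> * of_int (signed_partition_number n f))) (circlepath 0 r)"
proof -
  define F where "F u = inverse (\<Prod>k=1..N. 1 - of_int (f k) * u ^ k)" for u :: complex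
  have nz: "(\<Prod>k=1..N. 1 - of_int (f k) * u ^ k) \<noteq> 0" if "norm u < 1" for u :: complex
  proof -
    have "of_int (f k) * u ^ k \<noteq> 1" if k: "k \<in> {1..N}" for k
    proof
      assume "of_int (f k) * u ^ k = 1"
      then have "norm (of_int (f k) * u ^ k) = 1" by simp
      moreover have "norm (of_int (f k) * u ^ k) \<le> 1 * norm u ^ k"
        unfolding norm_mult norm_power using f[of k] by (intro mult_right_mono) (auto simp: of_int_abs[symmetric] simp del: of_int_abs)
      moreover have "norm u ^ k < 1" using k \<open>norm u < 1\<close> by (simp add: power_less_one_iff)
      ultimately show False by simp
    qed
    then show ?thesis by (auto simp: eq_commute[of 1])
  qed
  have hol: "F holomorphic_on ball 0 1"
    unfolding F_def using nz by (intro holomorphic_intros) auto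
  define P :: "complex fps" where "P = (\<Prod>k=1..N. 1 - fps_const (of_int (f k)) * fps_X ^ k)"
  have "fps_nth P 0 * fps_nth (Abs_fps (\<lambda>n. of_int (part_sum f N n))) 0 = 1"
    using arg_cong[OF fps_part_sum[of f N], of "\<lambda>F. fps_nth F 0"] by (simp add: P_def mult.commute)
  then have P0: "fps_nth P 0 \<noteq> 0" by auto
  have "(\<lambda>u. \<Prod>k=1..N. 1 - of_int (f k) * u ^ k) has_fps_expansion P"
    unfolding P_def by (intro fps_expansion_intros)
  then have "F has_fps_expansion inverse P"
    unfolding F_def using P0 by (intro has_fps_expansion_inverse)
  moreover have "inverse P = Abs_fps (\<lambda>n. of_int (part_sum f N n))"
    using fps_part_sum[of f N] unfolding P_def[symmetric]
    by (metis fps_inverse_unique mult.commute)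
  ultimately have "(deriv ^^ n) F 0 / fact n = of_int (part_sum f N n)"
    using fps_nth_fps_expansion[of F "inverse P" n] by simp
  then have "of_int (signed_partition_number n f) = (deriv ^^ n) F 0 / fact n"
    using part_sum_eq[OF \<open>n \<le> N\<close>] by simp
  moreover have "((\<lambda>u. F u / (u - 0) ^ Suc n) has_contour_integral ((2 * pi * \<i>) / fact n * (deriv ^^ n) F 0)) (circlepath 0 r)"
    using hol r
    by (intro Cauchy_has_contour_integral_higher_derivative_circlepath holomorphic_on_imp_continuous_on)
      (auto intro: holomorphic_on_subset)
  ultimately show ?thesis unfolding F_def by simp
qed

section \<open>The logarithm of the infinite product and Cauchy's formula\<close>

lemma log_series:
  fixes u :: complex
  assumes "norm u < 1"
  shows "(\<lambda>k. u ^ Suc k / of_nat (Suc k)) sums (- Ln (1 - u))"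
proof -
  have "(\<lambda>n. - (u ^ n) / of_nat n) sums Ln (1 - u)"
    using Ln_series'[of "- u"] assms by simp
  then have "(\<lambda>n. u ^ n / of_nat n) sums - Ln (1 - u)"
    using sums_minus by fastforce
  then show ?thesis by (subst sums_Suc_iff) simp
qed

lemma norm_log_le:
  fixes u :: complex
  assumes "norm u \<le> t" "t < 1"
  shows "norm (Ln (1 - u)) \<le> t / (1 - t)"
proof -
  have t: "0 \<le> t" using assms norm_ge_zero order_trans by blast
  have "(\<lambda>k. t * t ^ k) sums (t * (1 / (1 - t)))"
    using assms t by (intro sums_mult geometric_sums) auto
  then have *: "(\<lambda>k. t ^ Suc k) sums (t / (1 - t))" by simp
  have "norm (u ^ Suc k / of_nat (Suc k)) \<le> t ^ Suc k" for k
  proof -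
    have "norm (u ^ Suc k / of_nat (Suc k)) = norm u ^ Suc k / real (Suc k)"
      by (simp only: norm_divide norm_power norm_of_nat)
    also have "\<dots> \<le> t ^ Suc k / 1" using assms(1) t by (intro frac_le power_mono) auto
    finally show ?thesis by simp
  qed
  from norm_sums_le[OF log_series * this] assms have "norm (- Ln (1 - u)) \<le> t / (1 - t)" by simp
  then show ?thesis by simp
qed

lemma summable_geometric_tail: "0 \<le> r \<Longrightarrow> r < 1 \<Longrightarrow> summable (\<lambda>k. r ^ Suc k / (1 - r :: real))"
  by (intro summable_divide) (auto simp: summable_geometric summable_Suc_iff)

context
  fixes f :: "nat \<Rightarrow> int"
begin

text \<open>Summing principal logarithms of the single factors gives a logarithm of the product
  without any choice of branch; each factor differs from 1 by less than 1 inside the disc.\<close>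

definition log_gen :: "complex \<Rightarrow> complex" where
  "log_gen z = (\<Sum>k. - Ln (1 - of_int (f (Suc k)) * z ^ Suc k))"

context
  assumes f_le_1: "\<And>k. \<bar>f k\<bar> \<le> 1"
begin

lemma norm_f_power_le: "norm (of_int (f k) * z ^ k :: complex) \<le> norm z ^ k"
proof -
  have "norm (of_int (f k) * z ^ k) \<le> 1 * norm z ^ k"
    unfolding norm_mult norm_power using f_le_1[of k]
    by (intro mult_right_mono) (auto simp: of_int_abs[symmetric] simp del: of_int_abs)
  then show ?thesis by simp
qed

lemma norm_log_term_le:
  assumes "norm z \<le> r" "r < 1"
  shows "norm (- Ln (1 - of_int (f (Suc k)) * z ^ Suc k)) \<le> r ^ Suc k / (1 - r)"
proof -
  have r0: "0 \<le> r" using assms norm_ge_zero order_trans by blast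
  have rk: "r ^ Suc k \<le> r" using r0 assms power_decreasing[of 1 "Suc k" r] by simp
  have "norm (of_int (f (Suc k)) * z ^ Suc k) \<le> r ^ Suc k"
    using norm_f_power_le[of "Suc k" z] power_mono[OF assms(1), of "Suc k"] by simp
  then have "norm (Ln (1 - of_int (f (Suc k)) * z ^ Suc k)) \<le> r ^ Suc k / (1 - r ^ Suc k)"
    using rk assms by (intro norm_log_le) auto
  also have "\<dots> \<le> r ^ Suc k / (1 - r)"
    using rk r0 assms by (intro divide_left_mono mult_pos_pos) (auto simp: power_less_one_iff)
  finally show ?thesis by simp
qed

text \<open>The partial sums converge uniformly on the circle and stay in a fixed ball, where
  \<open>exp\<close> is uniformly continuous, so the integrals converge. They do not change once
  \<open>n \<le> N\<close>, which identifies the limit.\<close>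

lemma log_gen_integral:
  assumes r: "0 < r" "r < 1"
  shows "((\<lambda>u. exp (log_gen u) / u ^ Suc n) has_contour_integral
      (2 * pi * \<i> * of_int (signed_partition_number n f))) (circlepath 0 r)"
proof -
  define S where "S N z = (\<Sum>k<N. - Ln (1 - of_int (f (Suc k)) * z ^ Suc k))" for N and z :: complex
  define M where "M k = r ^ Suc k / (1 - r)" for k
  have sumM: "summable M" unfolding M_def using r by (intro summable_geometric_tail) auto
  have M: "norm (- Ln (1 - of_int (f (Suc k)) * z ^ Suc k)) \<le> M k" if "z \<in> sphere 0 r" for z k
    unfolding M_def using that r by (intro norm_log_term_le) auto
  have UL: "uniform_limit (sphere 0 r) S log_gen sequentially"
    unfolding S_def[abs_def] log_gen_def[abs_def] using M sumM by (intro Weierstrass_m_test) auto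
  have M0: "0 \<le> M k" for k using r by (simp add: M_def)
  have bd: "norm (S N z) \<le> suminf M" if "z \<in> sphere 0 r" for N z
  proof -
    have "norm (S N z) \<le> (\<Sum>k<N. M k)" unfolding S_def using M[OF that] by (intro sum_norm_le)
    also have "\<dots> \<le> suminf M" using sumM M0 by (intro sum_le_suminf) auto
    finally show ?thesis .
  qed
  have uc: "uniformly_continuous_on (cball (0::complex) (suminf M)) exp"
    by (rule compact_uniformly_continuous) (auto intro: continuous_intros)
  have "\<forall>\<^sub>F N in sequentially. \<forall>z\<in>sphere 0 r. S N z \<in> cball 0 (suminf M)"
    using bd by simp
  from uniform_limit_compose_uniformly_continuous_on[OF UL uc this closed_cball]
  have UE: "uniform_limit (sphere 0 r) (\<lambda>N z. exp (S N z)) (\<lambda>z. exp (log_gen z)) sequentially" .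
  have bE: "bounded ((\<lambda>z. exp (log_gen z)) ` sphere 0 r)"
  proof -
    have nl: "norm (log_gen z) \<le> suminf M" if z: "z \<in> sphere 0 r" for z
    proof (rule Lim_norm_ubound)
      show "(\<lambda>N. S N z) \<longlonglongrightarrow> log_gen z" by (rule tendsto_uniform_limitI[OF UL z])
      show "\<forall>\<^sub>F N in sequentially. norm (S N z) \<le> suminf M" using bd[OF z] by simp
    qed simp
    have "norm (exp (log_gen z)) \<le> exp (suminf M)" if z: "z \<in> sphere 0 r" for z
    proof -
      have "norm (exp (log_gen z)) \<le> exp (norm (log_gen z))" by (rule norm_exp)
      also have "\<dots> \<le> exp (suminf M)" using nl[OF z] by simp
      finally show ?thesis .
    qed
    then show ?thesis unfolding bounded_iff by blast
  qed
  have "uniform_limit (sphere 0 r) (\<lambda>N z. exp (S N z) * (1 / z ^ Suc n)) (\<lambda>z. exp (log_gen z) * (1 / z ^ Suc n)) sequentially"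
  proof (rule uniform_lim_mult[OF UE uniform_limit_const bE])
    have "continuous_on (sphere 0 r) (\<lambda>z::complex. 1 / z ^ Suc n)"
      using r by (intro continuous_intros) auto
    then show "bounded ((\<lambda>z::complex. 1 / z ^ Suc n) ` sphere 0 r)"
      by (intro compact_imp_bounded compact_continuous_image) auto
  qed
  then have U: "uniform_limit (sphere 0 r) (\<lambda>N z. exp (S N z) / z ^ Suc n) (\<lambda>z. exp (log_gen z) / z ^ Suc n) sequentially"
    by simp
  have int: "((\<lambda>z. exp (S N z) / z ^ Suc n) has_contour_integral
      (2 * pi * \<i> * of_int (signed_partition_number n f))) (circlepath 0 r)" if "n \<le> N" for N
  proof (rule has_contour_integral_eq[OF finite_product_has_contour_integral[OF f_le_1 r that]])
    fix z :: complex assume "z \<in> path_image (circlepath 0 r)"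
    then have z: "norm z = r" using r by (auto simp: dist_norm)
    have "exp (S N z) = (\<Prod>k<N. inverse (1 - of_int (f (Suc k)) * z ^ Suc k))"
      unfolding S_def exp_sum[OF finite_lessThan]
    proof (intro prod.cong refl)
      fix k
      have "norm (of_int (f (Suc k)) * z ^ Suc k) < 1"
        using norm_f_power_le[of "Suc k" z] r z power_Suc_less_one[of r k] by simp
      then have "1 - of_int (f (Suc k)) * z ^ Suc k \<noteq> 0" by auto
      then show "exp (- Ln (1 - of_int (f (Suc k)) * z ^ Suc k)) = inverse (1 - of_int (f (Suc k)) * z ^ Suc k)"
        by (simp add: exp_minus)
    qed
    also have "\<dots> = inverse (\<Prod>k<N. 1 - of_int (f (Suc k)) * z ^ Suc k)"
      using prod_inversef[of "\<lambda>k. 1 - of_int (f (Suc k)) * z ^ Suc k" "{..<N}"] by (simp only: o_def)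
    also have "(\<Prod>k<N. 1 - of_int (f (Suc k)) * z ^ Suc k) = (\<Prod>k=1..N. 1 - of_int (f k) * z ^ k)"
      by (rule prod.reindex_bij_witness[of _ "\<lambda>k. k - 1" Suc]) auto
    finally show "inverse (\<Prod>k=1..N. 1 - of_int (f k) * z ^ k) / z ^ Suc n = exp (S N z) / z ^ Suc n" by simp
  qed
  have ev: "\<forall>\<^sub>F N in sequentially. (\<lambda>z. exp (S N z) / z ^ Suc n) contour_integrable_on circlepath 0 r"
    using int by (auto simp: eventually_sequentially contour_integrable_on_def)
  note lim = contour_integral_uniform_limit_circlepath[OF ev U sequentially_bot r(1)]
  have "\<forall>\<^sub>F N in sequentially. contour_integral (circlepath 0 r) (\<lambda>z. exp (S N z) / z ^ Suc n) = 2 * pi * \<i> * of_int (signed_partition_number n f)"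
    using int by (auto simp: eventually_sequentially intro!: contour_integral_unique)
  then have "(\<lambda>N. contour_integral (circlepath 0 r) (\<lambda>z. exp (S N z) / z ^ Suc n)) \<longlonglongrightarrow> 2 * pi * \<i> * of_int (signed_partition_number n f)"
    by (rule tendsto_eventually)
  then have "contour_integral (circlepath 0 r) (\<lambda>z. exp (log_gen z) / z ^ Suc n) = 2 * pi * \<i> * of_int (signed_partition_number n f)"
    using lim(2) LIMSEQ_unique by blast
  then show ?thesis using has_contour_integral_integral[OF lim(1)] by simp
qed

text \<open>Each logarithm is expanded and the double series, absolutely convergent by comparison
  with powers of \<open>norm z\<close>, is summed in the other order. \<open>\<Phi> k\<close>
  belongs to the exponent \<open>Suc k\<close>.\<close>

lemma log_gen_double_sum:
  assumes z: "norm z < 1"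
    and \<Phi>: "\<And>k. (\<lambda>n. of_int (f n) ^ Suc k * (z ^ Suc k) ^ n) sums \<Phi> k" and f0: "f 0 = 0"
  shows "(\<lambda>k. \<Phi> k / of_nat (Suc k)) sums log_gen z"
proof -
  define g where "g = (\<lambda>(n, k). (of_int (f (Suc n)) * z ^ Suc n) ^ Suc k / of_nat (Suc k))"
  define r where "r = norm z"
  have r: "0 \<le> r" "r < 1" using z by (auto simp: r_def)
  have rn: "r ^ Suc n < 1" "0 \<le> r ^ Suc n" for n using r by (auto simp: power_less_one_iff simp del: power_Suc)
  have row: "(\<lambda>k. (r ^ Suc n) ^ Suc k) sums (r ^ Suc n / (1 - r ^ Suc n))" for n
    using sums_mult[OF geometric_sums[of "r ^ Suc n"], of "r ^ Suc n"] rn[of n] by simp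
  have "(\<lambda>(n, k). (r ^ Suc n) ^ Suc k) summable_on UNIV \<times> UNIV"
  proof (rule summable_on_SigmaI)
    show "((\<lambda>k. case (n, k) of (n, k) \<Rightarrow> (r ^ Suc n) ^ Suc k) has_sum (r ^ Suc n / (1 - r ^ Suc n))) UNIV" for n
      using sums_nonneg_imp_has_sum[OF row[of n]] r by simp
    show "(\<lambda>n. r ^ Suc n / (1 - r ^ Suc n)) summable_on UNIV"
    proof (subst summable_on_UNIV_nonneg_real_iff)
      show "0 \<le> r ^ Suc n / (1 - r ^ Suc n)" for n using rn[of n] by simp
      show "summable (\<lambda>n. r ^ Suc n / (1 - r ^ Suc n))"
      proof (rule summable_comparison_test'[OF summable_geometric_tail[OF r]])
        fix n
        have "r ^ Suc n \<le> r" using r power_decreasing[of 1 "Suc n" r] by simp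
        then show "norm (r ^ Suc n / (1 - r ^ Suc n)) \<le> r ^ Suc n / (1 - r)"
          using rn[of n] r by (simp del: power_Suc) (intro divide_left_mono mult_pos_pos, auto)
      qed
    qed
  qed (use r in auto)
  then have "(\<lambda>x. norm (g x)) summable_on UNIV \<times> UNIV"
  proof (rule summable_on_comparison_test)
    fix x :: "nat \<times> nat"
    obtain n k where x: "x = (n, k)" by (cases x)
    have "norm (g x) = norm (of_int (f (Suc n)) * z ^ Suc n) ^ Suc k / real (Suc k)"
      by (simp only: g_def x prod.case norm_divide norm_power norm_of_nat)
    also have "\<dots> \<le> (r ^ Suc n) ^ Suc k / 1"
      using norm_f_power_le[of "Suc n" z] rn unfolding r_def[symmetric] by (intro frac_le power_mono) auto
    finally show "norm (g x) \<le> (case x of (n, k) \<Rightarrow> (r ^ Suc n) ^ Suc k)" by (simp add: x)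
  qed auto
  then have sg: "g summable_on UNIV \<times> UNIV" by (rule abs_summable_summable)
  have sg': "(\<lambda>(k, n). g (n, k)) summable_on UNIV \<times> UNIV"
    using sg by (subst (asm) summable_on_swap)
  obtain L where L: "(g has_sum L) (UNIV \<times> UNIV)" using sg by (auto simp: summable_on_def)
  have L': "((\<lambda>(k, n). g (n, k)) has_sum L) (UNIV \<times> UNIV)" using L by (subst (asm) has_sum_swap)
  have "((\<lambda>n. - Ln (1 - of_int (f (Suc n)) * z ^ Suc n)) has_sum L) UNIV"
  proof (rule has_sum_SigmaD[OF L])
    fix n :: nat
    have "(\<lambda>k. g (n, k)) summable_on UNIV"
      using summable_on_SigmaD1[of "\<lambda>n k. g (n, k)" UNIV "\<lambda>_. UNIV" n] sg by (simp add: case_prod_unfold)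
    moreover have "(\<lambda>k. g (n, k)) sums (- Ln (1 - of_int (f (Suc n)) * z ^ Suc n))"
      unfolding g_def prod.case using norm_f_power_le[of "Suc n" z] rn[of n]
      by (intro log_series) (auto simp: r_def simp del: power_Suc)
    ultimately show "((\<lambda>k. g (n, k)) has_sum (- Ln (1 - of_int (f (Suc n)) * z ^ Suc n))) UNIV"
      using has_sum_imp_sums sums_unique2 has_sum_infsum by metis
  qed
  then have Lg: "log_gen z = L" using has_sum_imp_sums sums_unique unfolding log_gen_def by metis
  have "((\<lambda>k. \<Phi> k / of_nat (Suc k)) has_sum L) UNIV"
  proof (rule has_sum_SigmaD[OF L'])
    fix k :: nat
    have "(\<lambda>n. g (n, k)) summable_on UNIV"
      using summable_on_SigmaD1[of "\<lambda>k n. g (n, k)" UNIV "\<lambda>_. UNIV" k] sg' by simp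
    moreover have "(\<lambda>n. g (n, k)) sums (\<Phi> k / of_nat (Suc k))"
    proof -
      have "(\<lambda>n. of_int (f (Suc n)) ^ Suc k * (z ^ Suc k) ^ Suc n) sums \<Phi> k"
        using \<Phi>[of k] f0 by (subst sums_Suc_iff) simp
      from sums_divide[OF this, of "of_nat (Suc k)"]
      have "(\<lambda>n. of_int (f (Suc n)) ^ Suc k * (z ^ Suc k) ^ Suc n / of_nat (Suc k)) sums (\<Phi> k / of_nat (Suc k))" .
      moreover have "(z ^ Suc k) ^ Suc n = (z ^ Suc n) ^ Suc k" for n
        by (metis power_mult mult.commute)
      ultimately show ?thesis by (simp only: g_def prod.case power_mult_distrib)
    qed
    ultimately show "((\<lambda>n. case (k, n) of (k, n) \<Rightarrow> g (n, k)) has_sum (\<Phi> k / of_nat (Suc k))) UNIV"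
      unfolding prod.case using has_sum_imp_sums sums_unique2 has_sum_infsum by metis
  qed
  then show ?thesis using Lg has_sum_imp_sums by blast
qed

text \<open>The integral over the circle is folded onto a half circle, pairing \<open>z\<close> with \<open>- z\<close>.\<close>

lemma signed_partition_number_integral:
  assumes \<sigma>: "0 < \<sigma>"
  defines "s \<equiv> \<lambda>x. Complex \<sigma> (- (2 * pi * x))"
  shows "((\<lambda>x. (exp (log_gen (exp (- s x))) + (- 1) ^ n * exp (log_gen (- exp (- s x)))) * exp (of_nat n * s x))
      has_integral of_int (signed_partition_number n f)) {-1/4..1/4}"
proof -
  define r where "r = exp (- \<sigma>)"
  have r: "0 < r" "r < 1" using \<sigma> by (auto simp: r_def)
  define c where "c x = exp (- s x)" for x
  have c0: "c x \<noteq> 0" for x by (simp add: c_def)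
  have cx: "circlepath 0 r x = c x" for x
  proof -
    have "- s x = of_real (- \<sigma>) + 2 * of_real pi * \<i> * of_real x" by (simp add: s_def complex_eq_iff)
    then show ?thesis by (simp only: c_def circlepath r_def exp_add exp_of_real add_0)
  qed
  define h where "h x = exp (log_gen (c x)) / c x ^ n" for x
  have "((\<lambda>x. exp (log_gen (circlepath 0 r x)) / circlepath 0 r x ^ Suc n * (2 * pi * \<i> * r * exp (2 * of_real pi * \<i> * x)))
      has_integral (2 * pi * \<i> * of_int (signed_partition_number n f))) {0..1}"
    using log_gen_integral[OF r, of n] unfolding has_contour_integral_def
    by (rule has_integral_eq[rotated]) (simp add: vector_derivative_circlepath01)
  then have "((\<lambda>x. (1 / (2 * pi * \<i>)) * (exp (log_gen (circlepath 0 r x)) / circlepath 0 r x ^ Suc n * (2 * pi * \<i> * r * exp (2 * of_real pi * \<i> * x))))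
      has_integral (1 / (2 * pi * \<i>)) * (2 * pi * \<i> * of_int (signed_partition_number n f))) {0..1}"
    by (rule has_integral_mult_right)
  moreover have "(1 / (2 * pi * \<i>)) * (exp (log_gen (circlepath 0 r x)) / circlepath 0 r x ^ Suc n * (2 * pi * \<i> * r * exp (2 * of_real pi * \<i> * x))) = h x" for x
  proof -
    have e: "r * exp (2 * of_real pi * \<i> * x) = c x" by (simp add: cx[symmetric] circlepath)
    have "(1 / (2 * pi * \<i>)) * (exp (log_gen (c x)) / c x ^ Suc n * (2 * pi * \<i> * r * exp (2 * of_real pi * \<i> * x)))
        = (1 / (2 * pi * \<i>)) * (exp (log_gen (c x)) / c x ^ Suc n * (2 * pi * \<i> * c x))"
      unfolding e[symmetric] by (simp only: mult.assoc)
    also have "\<dots> = h x" using c0 by (simp add: h_def)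
    finally show ?thesis unfolding cx .
  qed
  moreover have "(1 / (2 * pi * \<i>)) * (2 * pi * \<i> * of_int (signed_partition_number n f)) = of_int (signed_partition_number n f)"
    by simp
  ultimately have hI: "(h has_integral of_int (signed_partition_number n f)) {0..1}"
    by (simp only:)
  have c_half: "c (1/2 + x) = - c x" for x
  proof -
    have *: "- s (1/2 + x) = - s x + \<i> * of_real pi" by (simp add: s_def complex_eq_iff algebra_simps)
    show ?thesis unfolding c_def * exp_add exp_pi_i' by simp
  qed
  have h_half: "h (1/2 + x) = (- 1) ^ n * exp (log_gen (- c x)) / c x ^ n" for x
    unfolding h_def c_half by (cases "even n") simp_all
  have h_per: "h (- 1 + x) = h x" for x
  proof -
    have "c (1/2 + (1/2 + (- 1 + x))) = c (- 1 + x)" by (simp only: c_half minus_minus)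
    then show ?thesis by (simp add: h_def)
  qed
  have int: "h integrable_on {a..b}" if "0 \<le> a" "b \<le> 1" for a b
  proof (rule integrable_on_subinterval)
    show "h integrable_on {0..1}" using hI by (rule has_integral_integrable)
  qed (use that in auto)
  have i1: "h integrable_on {-1/4..1/4}"
  proof -
    have "h integrable_on {-1/4..0}"
      using integrable_on_shift_Icc_real[of h "-1" "3/4" 1] h_per int[of "3/4" 1] by (simp add: o_def)
    then show ?thesis
      using int[of 0 "1/4"] by (intro Henstock_Kurzweil_Integration.integrable_combine[of "-1/4" 0 "1/4"]) auto
  qed
  \<comment> \<open>By periodicity the last quarter moves to the left of 0, and the middle half is
    shifted by half a period, where \<open>c\<close> changes sign. What remains is the half circle
    on which the imaginary part of \<open>s\<close> has modulus at most pi / 2.\<close>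
  have "integral {0..1} h = integral {0..1/4} h + integral {1/4..3/4} h + integral {3/4..1} h"
    using Henstock_Kurzweil_Integration.integral_combine[of 0 "1/4" "3/4" h]
      Henstock_Kurzweil_Integration.integral_combine[of 0 "3/4" 1 h] int by simp
  also have "integral {3/4..1} h = integral {-1/4..0} h"
    using integral_shift_Icc_real[of "3/4" 1 h "-1"] h_per by (simp add: o_def)
  also have "integral {1/4..3/4} h = integral {-1/4..1/4} (\<lambda>x. h (1/2 + x))"
    using integral_shift_Icc_real[of "-1/4" "1/4" h "1/2"] by (simp add: o_def)
  also have "integral {0..1/4} h + integral {-1/4..1/4} (\<lambda>x. h (1/2 + x)) + integral {-1/4..0} h
      = integral {-1/4..1/4} h + integral {-1/4..1/4} (\<lambda>x. h (1/2 + x))"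
    using Henstock_Kurzweil_Integration.integral_combine[of "-1/4" 0 "1/4" h] i1 by (simp add: add.commute)
  finally have sum: "integral {0..1} h = integral {-1/4..1/4} h + integral {-1/4..1/4} (\<lambda>x. h (1/2 + x))" .
  have i2: "(\<lambda>x. h (1/2 + x)) integrable_on {-1/4..1/4}"
    using integrable_on_shift_Icc_real[of h "1/2" "-1/4" "1/4"] int[of "1/4" "3/4"] by (simp add: o_def)
  have "((\<lambda>x. h x + h (1/2 + x)) has_integral of_int (signed_partition_number n f)) {-1/4..1/4}"
    using has_integral_add[OF integrable_integral[OF i1] integrable_integral[OF i2]] sum hI
    by (simp add: integral_unique)
  moreover have "h x + h (1/2 + x)
      = (exp (log_gen (exp (- s x))) + (- 1) ^ n * exp (log_gen (- exp (- s x)))) * exp (of_nat n * s x)" for x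
  proof -
    have "1 / c x ^ n = exp (of_nat n * s x)"
      by (simp add: c_def exp_minus exp_of_nat_mult field_simps)
    then show ?thesis unfolding h_half unfolding h_def
      by (simp add: c_def[symmetric] add_divide_distrib[symmetric] divide_inverse distrib_right)
  qed
  ultimately show ?thesis by simp
qed

end

end

subsection \<open>The generating function near the singularities 1 and -1\<close>

context prime_1_mod_8
begin

section \<open>The quadratic and the principal character, and their Fourier coefficients\<close>

definition chi :: "nat \<Rightarrow> complex" where
  "chi n = of_int (leg n)"

definition prin :: "nat \<Rightarrow> complex" where
  "prin n = (if p dvd n then 0 else 1)"

lemma p_pos: "0 < p"
  using p_gt_2 by simp

lemma dvd_diff_iff: "a \<le> p \<Longrightarrow> p dvd p - a \<longleftrightarrow> p dvd a"
  by (metis dvd_diffD1 dvd_diff_nat dvd_refl)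

sublocale chi: even_periodic p chi
proof
  show "0 < p" by (rule p_pos)
  show "chi (a mod p) = chi a" for a
    by (simp add: chi_def legendre_char_cong[of "a mod p" a])
  show "chi (p - a) = chi a" if "a \<le> p" for a
    using legendre_char_reflect[OF that] by (simp add: chi_def)
  show "chi 0 = 0" using legendre_char_eq_0_iff[of 0] by (simp add: chi_def)
qed

sublocale prin: even_periodic p prin
proof
  show "0 < p" by (rule p_pos)
  show "prin (a mod p) = prin a" for a
    by (simp add: prin_def dvd_mod_iff)
  show "prin (p - a) = prin a" if "a \<le> p" for a
    using dvd_diff_iff[OF that] by (simp add: prin_def)
  show "prin 0 = 0" by (simp add: prin_def)
qed

lemma chi_power: "chi n ^ Suc k = (if even k then chi n else prin n)"
proof -
  have sq: "chi n * chi n = prin n"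
    using legendre_char_square[of n] by (simp add: chi_def prin_def power2_eq_square flip: of_int_mult)
  have "chi n * prin n = chi n" using legendre_char_eq_0_iff[of n] by (simp add: chi_def prin_def)
  then show ?thesis by (induction k) (auto simp: sq mult.commute)
qed

lemma chi_hat_0: "chi.hat 0 = 0"
  using sum_legendre_char by (simp add: dft_def chi_def flip: of_int_sum)

lemma norm_chi: "norm (chi n) = norm (prin n)"
  using abs_legendre_char[of n] legendre_char_eq_0_iff[of n]
  by (simp add: chi_def prin_def flip: of_int_abs)

text \<open>Substituting \<open>a * b\<close> for \<open>a\<close> gives
  \<open>chi b * chi.hat b = chi.hat 1\<close>, and \<open>chi b\<close> has modulus 1.\<close>

lemma norm_chi_hat_eq:
  assumes "0 < b" "b < p"
  shows "norm (chi.hat b) = norm (chi.hat 1)"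
proof -
  have nd: "\<not> p dvd b" using assms by (auto dest: dvd_imp_le)
  have "chi b * chi.hat b = (\<Sum>a<p. chi (a * b mod p) * cnj (zeta p ((a * b mod p) * 1))) / of_nat p"
    using p_pos
    by (simp add: dft_def sum_distrib_left chi.periodic zeta_mod) (simp add: chi_def legendre_char_mult mult_ac)
  also have "(\<Sum>a<p. chi (a * b mod p) * cnj (zeta p ((a * b mod p) * 1))) = (\<Sum>a<p. chi a * cnj (zeta p (a * 1)))"
    by (rule sum.reindex_bij_betw[OF bij_betw_mult_mod[OF nd]])
  also have "\<dots> / of_nat p = chi.hat 1" by (simp add: dft_def)
  finally have "norm (chi b) * norm (chi.hat b) = norm (chi.hat 1)" by (simp add: norm_mult flip: norm_mult)
  then show ?thesis using nd by (simp add: norm_chi prin_def)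
qed

lemma sum_norm_prin: "(\<Sum>a<p. (norm (prin a))\<^sup>2) = real p - 1"
proof -
  have "(\<Sum>a<p. (norm (prin a))\<^sup>2) = (\<Sum>a<p. if a = 0 then 0 else 1)"
    by (intro sum.cong refl) (auto simp: prin_def dest: dvd_imp_le)
  also have "\<dots> = real (card ({..<p} - {0}))" by (subst sum.If_cases) (auto simp: Diff_eq)
  also have "\<dots> = real p - 1" using p_pos by (simp add: of_nat_diff)
  finally show ?thesis .
qed

text \<open>Parseval distributes the total (p - 1) / p equally over the p - 1 nonzero indices, which
  yields the modulus of the Gauss sum without evaluating it.\<close>

lemma norm_chi_hat:
  assumes "0 < b" "b < p"
  shows "norm (chi.hat b) = 1 / sqrt (real p)"
proof -
  have "(real p - 1) / real p = (\<Sum>b<p. (norm (chi.hat b))\<^sup>2)"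
    using dft_parseval[OF p_pos, of chi] sum_norm_prin by (simp add: norm_chi)
  also have "\<dots> = (\<Sum>b\<in>{..<p} - {0}. (norm (chi.hat b))\<^sup>2)"
    using p_pos by (subst sum.remove[of _ 0]) (auto simp: chi_hat_0)
  also have "\<dots> = (\<Sum>b\<in>{..<p} - {0}. (norm (chi.hat 1))\<^sup>2)"
  proof (intro sum.cong refl)
    fix b assume "b \<in> {..<p} - {0}"
    then have "norm (chi.hat b) = norm (chi.hat 1)" by (intro norm_chi_hat_eq) auto
    then show "(norm (chi.hat b))\<^sup>2 = (norm (chi.hat 1))\<^sup>2" by (rule arg_cong)
  qed
  also have "\<dots> = (real p - 1) * (norm (chi.hat 1))\<^sup>2" using p_pos by (simp add: of_nat_diff)
  finally have "(real p - 1) * (norm (chi.hat 1))\<^sup>2 = (real p - 1) * (1 / real p)" by simp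
  moreover have "real p - 1 \<noteq> 0" using p_gt_2 by simp
  ultimately have "(norm (chi.hat 1))\<^sup>2 = 1 / real p" by (simp only: mult_cancel_left) simp
  then have "norm (chi.hat 1) = sqrt (1 / real p)" by (metis norm_ge_zero real_sqrt_unique)
  then show ?thesis by (simp only: norm_chi_hat_eq[OF assms] real_sqrt_divide real_sqrt_one)
qed

text \<open>\<open>prin\<close> is the constant 1 minus the indicator of the multiples of
  \<open>p\<close>; the transforms are an indicator and the constant 1 / \<open>p\<close>.\<close>

lemma prin_hat: "prin.hat b = (if p dvd b then 1 else 0) - 1 / of_nat p"
proof -
  have "(\<Sum>a<p. prin a * cnj (zeta p (a * b))) = (\<Sum>a<p. cnj (zeta p (b * a)) * zeta p (0 * a) - (if a = 0 then 1 else 0))"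
    by (intro sum.cong refl) (auto simp: prin_def mult.commute dest: dvd_imp_le)
  also have "\<dots> = (if p dvd b then of_nat p else 0) - 1"
    using p_pos unfolding sum_subtractf sum_zeta_orthogonal[OF p_pos] by (auto simp: dvd_eq_mod_eq_0)
  finally show ?thesis using p_pos by (simp add: dft_def diff_divide_distrib)
qed

section \<open>Separating the pole of log F at the origin\<close>

abbreviation log_F :: "complex \<Rightarrow> complex" where
  "log_F \<equiv> log_gen leg"

lemma legendre_char_le_1: "\<bar>leg k\<bar> \<le> 1"
  using legendre_char_cases[of k] by auto

definition T :: "nat \<Rightarrow> complex \<Rightarrow> complex" where
  "T k w = (if odd k then chi.Phi w else prin.Phi w)"

lemma log_F_sums:
  assumes "norm z < 1"
  shows "(\<lambda>k. T (Suc k) (z ^ Suc k) / of_nat (Suc k)) sums log_F z"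
proof (rule log_gen_double_sum[OF legendre_char_le_1 assms])
  fix k
  have "norm (z ^ Suc k) < 1" using assms power_Suc_less_one[of "norm z" k] by (cases "z = 0") (simp_all add: norm_power norm_mult)
  then have "(\<lambda>n. chi n ^ Suc k * (z ^ Suc k) ^ n) sums T (Suc k) (z ^ Suc k)"
    unfolding chi_power T_def using chi.Phi_sums prin.Phi_sums by auto
  then show "(\<lambda>n. of_int (leg n) ^ Suc k * (z ^ Suc k) ^ n) sums T (Suc k) (z ^ Suc k)"
    by (simp only: chi_def)
qed (use chi.f_0 in \<open>simp add: chi_def\<close>)

text \<open>The residue at \<open>s = 0\<close> of the polar part of
  \<open>log_F (exp (- s))\<close>: only even k contribute, each with (1 - 1 / p) / k^2, and the
  squares of even numbers contribute a quarter of pi^2 / 6.\<close>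

definition A :: real where
  "A = (1 - 1 / real p) * pi\<^sup>2 / 24"

lemma A_pos: "0 < A"
  using p_gt_2 by (simp add: A_def)

definition h0 :: "nat \<Rightarrow> real" where
  "h0 k = (if odd k then 0 else 1 - 1 / real p)"

lemma sums_even_squares: "(\<lambda>k. if odd (Suc k) then 0 else 1 / (real (Suc k))\<^sup>2) sums (pi\<^sup>2 / 24)"
proof -
  have "(\<lambda>n. 1 / 4 * (1 / (real n + 1)\<^sup>2)) sums (1 / 4 * (pi\<^sup>2 / 6))"
    using inverse_squares_sums by (intro sums_mult) (simp add: add.commute)
  also have "(\<lambda>n. 1 / 4 * (1 / (real n + 1)\<^sup>2)) = (\<lambda>n. (\<lambda>k. if odd (Suc k) then 0 else 1 / (real (Suc k))\<^sup>2) (2 * n + 1))"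
    by (intro ext) (simp add: power2_eq_square field_simps)
  finally have half: "(\<lambda>n. (\<lambda>k. if odd (Suc k) then 0 else 1 / (real (Suc k))\<^sup>2) (2 * n + 1)) sums (1 / 4 * (pi\<^sup>2 / 6))" .
  have "(\<lambda>k. if odd (Suc k) then 0 else 1 / (real (Suc k))\<^sup>2) sums (1 / 4 * (pi\<^sup>2 / 6))"
  proof (rule iffD1[OF sums_mono_reindex[where g = "\<lambda>n. 2 * n + 1"
          and f = "\<lambda>k. if odd (Suc k) then 0 else 1 / (real (Suc k))\<^sup>2"] half])
    show "strict_mono (\<lambda>n::nat. 2 * n + 1)" by (auto simp: strict_mono_def)
    fix k :: nat assume k: "k \<notin> range (\<lambda>n. 2 * n + 1)"
    have "even k"
    proof (rule ccontr)
      assume "odd k"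
      then obtain m where "k = 2 * m + 1" by (elim oddE)
      then show False using k by auto
    qed
    then show "(if odd (Suc k) then 0 else 1 / (real (Suc k))\<^sup>2) = 0" by simp
  qed
  then show ?thesis by simp
qed

lemma h0_sums: "(\<lambda>k. h0 (Suc k) / (real (Suc k))\<^sup>2) sums A"
  using sums_mult[OF sums_even_squares, of "1 - 1 / real p"]
  by (simp add: h0_def A_def if_distrib[of "\<lambda>x. (1 - 1 / real p) * x"] if_distrib[of "\<lambda>x. x / _"] cong: if_cong)

definition R :: "nat \<Rightarrow> complex \<Rightarrow> complex" where
  "R k x = (if odd k then chi.Phi_reg x else prin.Phi_reg x)"

lemma T_exp: "T k (exp (- x)) = of_real (h0 k) / x + R k x"
  by (simp add: T_def R_def h0_def chi.Phi_reg_def prin.Phi_reg_def chi_hat_0 prin_hat)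

definition D :: "complex \<Rightarrow> complex" where
  "D s = log_F (exp (- s)) - of_real A / s"

lemma D_sums:
  assumes "0 < Re s"
  shows "(\<lambda>k. R (Suc k) (of_nat (Suc k) * s) / of_nat (Suc k)) sums D s"
proof -
  have "(\<lambda>k. T (Suc k) (exp (- s) ^ Suc k) / of_nat (Suc k)) sums log_F (exp (- s))"
    using assms by (intro log_F_sums) simp
  moreover have "exp (- s) ^ k = exp (- (of_nat k * s))" for k
    by (simp add: exp_of_nat_mult[symmetric])
  ultimately have "(\<lambda>k. of_real (h0 (Suc k)) / (of_nat (Suc k) * s) / of_nat (Suc k)
      + R (Suc k) (of_nat (Suc k) * s) / of_nat (Suc k)) sums log_F (exp (- s))"
    by (simp only: T_exp add_divide_distrib)
  moreover have "(\<lambda>k. complex_of_real (h0 (Suc k) / (real (Suc k))\<^sup>2) * (1 / s)) sums (of_real A * (1 / s))"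
    using h0_sums by (intro sums_mult2) (rule sums_of_real)
  moreover have "complex_of_real (h0 (Suc k) / (real (Suc k))\<^sup>2) * (1 / s) = of_real (h0 (Suc k)) / (of_nat (Suc k) * s) / of_nat (Suc k)" for k
    by (simp add: power2_eq_square mult_ac)
  ultimately have "(\<lambda>k. (of_real (h0 (Suc k)) / (of_nat (Suc k) * s) / of_nat (Suc k)
      + R (Suc k) (of_nat (Suc k) * s) / of_nat (Suc k)) - of_real (h0 (Suc k)) / (of_nat (Suc k) * s) / of_nat (Suc k)) sums (log_F (exp (- s)) - of_real A * (1 / s))"
    by (simp only: ) (rule sums_diff)
  then show ?thesis by (simp add: D_def)
qed

text \<open>Bounds and derivative estimates are proved for these holomorphic partial sums, uniformly
  in \<open>n\<close>, and then passed to the limit \<open>D\<close>.\<close>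

definition D_part :: "nat \<Rightarrow> complex \<Rightarrow> complex" where
  "D_part n s = (\<Sum>k<n. R (Suc k) (of_nat (Suc k) * s) / of_nat (Suc k))"

lemma D_part_tendsto: "0 < Re s \<Longrightarrow> (\<lambda>n. D_part n s) \<longlonglongrightarrow> D s"
  using D_sums unfolding sums_def D_part_def .

text \<open>The majorant of \<open>Phi_reg\<close> at k s, divided by k, is |s| / (1 + (k |s|)^2),
  whose sum over k is at most 2 for every s.\<close>

lemma D_part_bound:
  assumes C: "0 \<le> C"
  obtains M where "0 \<le> M" "\<And>n s. s \<in> sector C \<Longrightarrow> s \<noteq> 0 \<Longrightarrow> norm (D_part n s) \<le> M"
proof -
  obtain K1 where K1: "0 \<le> K1"
    "\<And>x. x \<in> sector C \<Longrightarrow> x \<noteq> 0 \<Longrightarrow> norm (chi.Phi_reg x) \<le> K1 * (norm x / (1 + (norm x)\<^sup>2))"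
    using chi.Phi_reg_bound[OF C] by metis
  obtain K2 where K2: "0 \<le> K2"
    "\<And>x. x \<in> sector C \<Longrightarrow> x \<noteq> 0 \<Longrightarrow> norm (prin.Phi_reg x) \<le> K2 * (norm x / (1 + (norm x)\<^sup>2))"
    using prin.Phi_reg_bound[OF C] by metis
  define K where "K = K1 + K2"
  have K: "norm (R k x) \<le> K * (norm x / (1 + (norm x)\<^sup>2))" if "x \<in> sector C" "x \<noteq> 0" for k x
  proof -
    have "0 \<le> norm x / (1 + (norm x)\<^sup>2)" by simp
    then have "K1 * (norm x / (1 + (norm x)\<^sup>2)) \<le> K * (norm x / (1 + (norm x)\<^sup>2))"
      "K2 * (norm x / (1 + (norm x)\<^sup>2)) \<le> K * (norm x / (1 + (norm x)\<^sup>2))"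
      using K1(1) K2(1) unfolding K_def by (intro mult_right_mono; simp)+
    then show ?thesis using K1(2)[OF that] K2(2)[OF that] by (auto simp: R_def)
  qed
  show thesis
  proof (rule that[of "K * 2"])
    show "0 \<le> K * 2" using K1 K2 by (simp add: K_def)
    fix n s assume s: "s \<in> sector C" "s \<noteq> 0"
    have "norm (D_part n s) \<le> (\<Sum>k<n. K * (norm s / (1 + (real (Suc k) * norm s)\<^sup>2)))"
      unfolding D_part_def
    proof (rule sum_norm_le)
      fix k
      have "norm (R (Suc k) (of_nat (Suc k) * s)) \<le> K * (norm (of_nat (Suc k) * s) / (1 + (norm (of_nat (Suc k) * s))\<^sup>2))"
        using s by (intro K sector_scale_nat) (auto simp del: of_nat_Suc)
      also have "norm (of_nat (Suc k) * s) = real (Suc k) * norm s" by (simp only: norm_mult norm_of_nat)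
      finally have "norm (R (Suc k) (of_nat (Suc k) * s)) / real (Suc k) \<le> K * (real (Suc k) * norm s / (1 + (real (Suc k) * norm s)\<^sup>2)) / real (Suc k)"
        by (intro divide_right_mono) auto
      also have "\<dots> = K * (norm s / (1 + (real (Suc k) * norm s)\<^sup>2))"
        by (simp del: of_nat_Suc)
      finally show "norm (R (Suc k) (of_nat (Suc k) * s) / of_nat (Suc k)) \<le> K * (norm s / (1 + (real (Suc k) * norm s)\<^sup>2))"
        by (simp only: norm_divide norm_of_nat)
    qed
    also have "\<dots> = K * (\<Sum>k=1..n. norm s / (1 + (real k * norm s)\<^sup>2))"
      unfolding sum_distrib_left[symmetric]
      by (intro arg_cong[where f = "\<lambda>x. K * x"] sum.reindex_bij_witness[of _ "\<lambda>k. k - 1" Suc]) auto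
    also have "\<dots> \<le> K * 2"
      using s K1 K2 by (intro mult_left_mono sum_div_one_plus_square_le) (auto simp: K_def)
    finally show "norm (D_part n s) \<le> K * 2" .
  qed
qed

lemma D_bound:
  assumes C: "0 \<le> C"
  obtains M where "0 \<le> M" "\<And>s. s \<in> sector C \<Longrightarrow> 0 < Re s \<Longrightarrow> norm (D s) \<le> M"
proof -
  obtain M where M: "0 \<le> M" "\<And>n s. s \<in> sector C \<Longrightarrow> s \<noteq> 0 \<Longrightarrow> norm (D_part n s) \<le> M"
    using D_part_bound[OF C] by metis
  have "norm (D s) \<le> M" if "s \<in> sector C" "0 < Re s" for s
    using that by (intro Lim_norm_ubound[OF sequentially_bot D_part_tendsto]) (auto intro!: always_eventually M)
  then show thesis using that M(1) by metis
qed

lemma D_part_holomorphic: "D_part n holomorphic_on {s. 0 < Re s}"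
proof -
  have "(R k \<circ> (\<lambda>s. of_nat (Suc m) * s)) holomorphic_on {s. 0 < Re s}" for k m
  proof (rule holomorphic_on_compose_gen)
    show "R k holomorphic_on {s. 0 < Re s}"
      using chi.Phi_reg_holomorphic prin.Phi_reg_holomorphic by (cases "odd k") (auto simp: R_def[abs_def])
    have "0 < Re (of_nat (Suc m) * s)" if "0 < Re s" for s
    proof -
      have "Re (of_nat (Suc m) * s) = real (Suc m) * Re s" by simp
      then show ?thesis using that by simp
    qed
    then show "(\<lambda>s. of_nat (Suc m) * s) ` {s. 0 < Re s} \<subseteq> {s. 0 < Re s}" by blast
  qed (intro holomorphic_intros)
  then show ?thesis unfolding D_part_def[abs_def] o_def
    by (intro holomorphic_intros) (auto simp del: of_nat_Suc)
qed

text \<open>Bounded holomorphic functions on a larger sector have small derivative, by Cauchy's inequality.\<close>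

lemma D_lipschitz:
  obtains M where "0 \<le> M"
    "\<And>s. 0 < Re s \<Longrightarrow> \<bar>Im s\<bar> \<le> Re s \<Longrightarrow> norm (D s - D (of_real (Re s))) \<le> M * (\<bar>Im s\<bar> / Re s)"
proof -
  \<comment> \<open>A disc of radius r / 2 about a point with real part r and |Im| at most r has
    real parts at least r / 2 and |Im| at most 3 r / 2, so it stays in the sector of slope
    3.\<close>
  obtain M where M: "0 \<le> M" "\<And>n s. s \<in> sector 3 \<Longrightarrow> s \<noteq> 0 \<Longrightarrow> norm (D_part n s) \<le> M"
    using D_part_bound[of 3] by auto
  show thesis
  proof (rule that[of "2 * M"])
    show "0 \<le> 2 * M" using M by simp
    fix s assume s: "0 < Re s" "\<bar>Im s\<bar> \<le> Re s"
    define r where "r = Re s"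
    have Re_seg: "Re x = r" "\<bar>Im x\<bar> \<le> r" if x: "x \<in> closed_segment (of_real r) s" for x
    proof -
      obtain t where t: "0 \<le> t" "t \<le> 1" "x = (1 - t) *\<^sub>R of_real r + t *\<^sub>R s"
        using x by (auto simp: in_segment)
      show "Re x = r" by (simp add: t(3) r_def algebra_simps)
      have "\<bar>Im x\<bar> = t * \<bar>Im s\<bar>" using t by (simp add: abs_mult)
      also have "\<dots> \<le> 1 * r" using t s by (intro mult_mono) (auto simp: r_def)
      finally show "\<bar>Im x\<bar> \<le> r" by simp
    qed
    have cb: "y \<in> sector 3 \<and> 0 < Re y" if "x \<in> closed_segment (of_real r) s" "y \<in> cball x (r / 2)" for x y
    proof -
      have "\<bar>Re (x - y)\<bar> \<le> r / 2" "\<bar>Im (x - y)\<bar> \<le> r / 2"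
        using that(2) abs_Re_le_cmod[of "x - y"] abs_Im_le_cmod[of "x - y"] by (auto simp: dist_norm)
      moreover have "Re (x - y) = Re x - Re y" "Im (x - y) = Im x - Im y" by simp_all
      ultimately show ?thesis using Re_seg[OF that(1)] s(1) unfolding sector_def mem_Collect_eq r_def
        by (intro conjI) linarith+
    qed
    have "norm (D_part n s - D_part n (of_real r)) \<le> M / (r / 2) * norm (s - of_real r)" for n
    proof (rule field_differentiable_bound[OF convex_closed_segment[of "of_real r" s], of _ "deriv (D_part n)"])
      fix x assume x: "x \<in> closed_segment (of_real r) s"
      have hol: "D_part n holomorphic_on cball x (r / 2)"
        using cb[OF x] by (intro holomorphic_on_subset[OF D_part_holomorphic]) auto
      have "open {s. 0 < Re s}" by (rule open_halfspace_Re_gt)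
      moreover have "x \<in> {s. 0 < Re s}" using Re_seg[OF x] s by (simp add: r_def)
      ultimately show "(D_part n has_field_derivative deriv (D_part n) x) (at x within closed_segment (of_real r) s)"
        by (rule holomorphic_derivI[OF D_part_holomorphic])
      have "norm ((deriv ^^ 1) (D_part n) x) \<le> fact 1 * M / (r / 2) ^ 1"
      proof (rule Cauchy_inequality)
        show "D_part n holomorphic_on ball x (r / 2)" using hol by (rule holomorphic_on_subset) auto
        show "continuous_on (cball x (r / 2)) (D_part n)" using hol by (rule holomorphic_on_imp_continuous_on)
        show "0 < r / 2" using s by (simp add: r_def)
        fix y assume "norm (x - y) = r / 2"
        then have "y \<in> sector 3 \<and> 0 < Re y" by (intro cb[OF x]) (simp add: dist_norm)
        then show "norm (D_part n y) \<le> M" by (intro M) auto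
      qed
      then show "norm (deriv (D_part n) x) \<le> M / (r / 2)" by simp
    qed auto
    moreover have "norm (s - of_real r) = \<bar>Im s\<bar>"
    proof -
      have "s - of_real r = \<i> * of_real (Im s)" by (simp add: complex_eq_iff r_def)
      then show ?thesis by (simp only: norm_mult norm_ii norm_of_real mult_1)
    qed
    ultimately have "norm (D_part n s - D_part n (of_real r)) \<le> 2 * M * (\<bar>Im s\<bar> / r)" for n
      by (simp add: field_simps)
    then show "norm (D s - D (of_real (Re s))) \<le> 2 * M * (\<bar>Im s\<bar> / Re s)"
      using s unfolding r_def
      by (intro Lim_norm_ubound[OF sequentially_bot tendsto_diff[OF D_part_tendsto D_part_tendsto]])
        (auto intro!: always_eventually)
  qed
qed

text \<open>All factors are positive real numbers at a positive argument. Hence normalizing by the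
  real part of \<open>D\<close> at the saddle point leaves no phase.\<close>

lemma D_real:
  assumes "0 < r"
  shows "D (of_real r) = of_real (Re (D (of_real r)))"
proof -
  define x where "x = exp (- r)"
  have x: "0 < x" "x < 1" using assms by (auto simp: x_def)
  define y where "y k = - ln (1 - of_int (leg (Suc k)) * x ^ Suc k)" for k
  have eq: "- Ln (1 - of_int (leg (Suc k)) * of_real x ^ Suc k) = of_real (y k)" for k
  proof -
    have "x ^ Suc k < 1" "0 < x ^ Suc k" using x power_Suc_less_one[of x k] by simp_all
    then have "0 < 1 - of_int (leg (Suc k)) * x ^ Suc k"
      using legendre_char_cases[of "Suc k"] by auto
    from Ln_of_real[OF this] show ?thesis by (simp add: y_def)
  qed
  have "summable (\<lambda>k. complex_of_real (y k))"
  proof (rule summable_comparison_test'[OF summable_geometric_tail[of x]])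
    show "norm (complex_of_real (y k)) \<le> x ^ Suc k / (1 - x)" for k
      unfolding eq[symmetric] using x by (intro norm_log_term_le[OF legendre_char_le_1]) auto
  qed (use x in auto)
  then have "summable y" by (simp only: summable_complex_of_real)
  then have "log_F (of_real x) = of_real (suminf y)"
    unfolding log_gen_def eq by (rule suminf_of_real[symmetric])
  then show ?thesis by (simp add: D_def x_def exp_of_real[symmetric] flip: of_real_divide of_real_diff)
qed

text \<open>In the sum of the series at \<open>w\<close> and \<open>- w\<close> the odd indices
  cancel and the even ones double; since 2 is a residue, \<open>chi (2 * n) = chi n\<close>, which
  turns the rest into the series at the square of \<open>w\<close>.\<close>

lemma chi_Phi_minus:
  assumes "norm w < 1"
  shows "chi.Phi (- w) = 2 * chi.Phi (w\<^sup>2) - chi.Phi w"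
proof -
  have "norm (w\<^sup>2) < 1" using assms by (simp add: norm_power power_less_one_iff)
  then have "(\<lambda>n. 2 * (chi n * (w\<^sup>2) ^ n)) sums (2 * chi.Phi (w\<^sup>2))"
    by (intro sums_mult chi.Phi_sums)
  also have "(\<lambda>n. 2 * (chi n * (w\<^sup>2) ^ n)) = (\<lambda>n. (\<lambda>n. chi n * (w ^ n + (- w) ^ n)) (2 * n))"
    by (intro ext) (simp add: chi_def legendre_char_mult legendre_char_2 power_mult)
  finally have half: "(\<lambda>n. (\<lambda>n. chi n * (w ^ n + (- w) ^ n)) (2 * n)) sums (2 * chi.Phi (w\<^sup>2))" .
  have "(\<lambda>n. chi n * (w ^ n + (- w) ^ n)) sums (2 * chi.Phi (w\<^sup>2))"
  proof (rule iffD1[OF sums_mono_reindex[where g = "\<lambda>n. 2 * n" and f = "\<lambda>n. chi n * (w ^ n + (- w) ^ n)"] half])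
    show "strict_mono (\<lambda>n::nat. 2 * n)" by (auto simp: strict_mono_def)
    fix n :: nat assume "n \<notin> range (\<lambda>n. 2 * n)"
    then have "odd n" by (auto elim!: evenE)
    then show "chi n * (w ^ n + (- w) ^ n) = 0" by simp
  qed
  moreover have "(\<lambda>n. chi n * w ^ n + chi n * (- w) ^ n) sums (chi.Phi w + chi.Phi (- w))"
    using assms by (intro sums_add chi.Phi_sums) auto
  ultimately have "chi.Phi w + chi.Phi (- w) = 2 * chi.Phi (w\<^sup>2)"
    by (simp only: distrib_left) (rule sums_unique2)
  then show ?thesis by (simp add: algebra_simps)
qed

lemma log_F_minus_bound:
  assumes C: "0 \<le> C"
  obtains K where "0 \<le> K"
    "\<And>s. s \<in> sector C \<Longrightarrow> 0 < Re s \<Longrightarrow> Re s \<le> 1 \<Longrightarrow>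
      norm (log_F (- exp (- s)) - log_F (exp (- s))) \<le> K * norm s"
proof -
  obtain K where K: "0 \<le> K"
    "\<And>s d. s \<in> sector C \<Longrightarrow> 0 < Re s \<Longrightarrow> Re s \<le> 1 \<Longrightarrow>
       chi.dilation s sums d \<Longrightarrow> norm d \<le> K * norm s"
    by (rule chi.odd_sum_dilation_bound[OF C chi_hat_0]) (rule that)
  show thesis
  proof (rule that[of "2 * K"])
    show "0 \<le> 2 * K" using K by simp
    fix s assume s: "s \<in> sector C" "0 < Re s" "Re s \<le> 1"
    define z where "z = exp (- s)"
    define d where "d = log_F (- z) - log_F z"
    have z: "norm z < 1" "norm (- z) < 1" using s by (auto simp: z_def)
    have pow: "exp (- s) ^ k = exp (- (of_nat k * s))" for k
      by (simp add: exp_of_nat_mult[symmetric])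
    have nz: "norm (z ^ Suc k) < 1" for k
      using z power_Suc_less_one[of "norm z" k] by (simp add: norm_power norm_mult z_def)
    \<comment> \<open>Halved because each odd exponent contributes twice a \<open>dilation\<close>
      term. The index \<open>2 * j\<close> stands for the exponent \<open>2 * j + 1\<close>, and at
      odd indices \<open>X\<close> vanishes.\<close>
    define X where "X k = (1 / 2) * (T (Suc k) ((- z) ^ Suc k) / of_nat (Suc k) - T (Suc k) (z ^ Suc k) / of_nat (Suc k))" for k
    have full: "X sums ((1 / 2) * d)"
      unfolding d_def X_def by (intro sums_mult sums_diff log_F_sums z)
    have "(\<lambda>j. X (2 * j)) sums ((1 / 2) * d)"
    proof (rule iffD2[OF sums_mono_reindex[where g = "\<lambda>n. 2 * n"] full])
      show "strict_mono (\<lambda>n::nat. 2 * n)" by (auto simp: strict_mono_def)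
      fix k :: nat assume "k \<notin> range (\<lambda>n. 2 * n)"
      then have "even (Suc k)" by (auto elim!: evenE)
      then show "X k = 0" unfolding X_def by (simp only: power_minus_even) simp
    qed
    moreover have "X (2 * j) = chi.dilation s j" for j
    proof -
      define w where "w = z ^ Suc (2 * j)"
      have w: "(- z) ^ Suc (2 * j) = - w" unfolding w_def by (rule power_minus_odd) simp
      have w1: "w = exp (- (of_nat (2 * j + 1) * s))" by (simp only: w_def z_def pow Suc_eq_plus1)
      have w2: "w\<^sup>2 = exp (- (of_nat (2 * j + 1) * (2 * s)))"
        unfolding w1 by (simp add: power2_eq_square algebra_simps flip: exp_add)
      have T: "T (Suc (2 * j)) u = chi.Phi u" for u by (simp add: T_def)
      have "X (2 * j)
          = (1 / 2) * ((2 * chi.Phi (w\<^sup>2) - chi.Phi w) - chi.Phi w) / of_nat (Suc (2 * j))"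
        unfolding X_def T w w_def[symmetric] using chi_Phi_minus[of w] nz[of "2 * j"] unfolding w_def[symmetric]
        by (simp add: diff_divide_distrib right_diff_distrib del: of_nat_Suc)
      also have "\<dots> = (chi.Phi (w\<^sup>2) - chi.Phi w) / of_nat (2 * j + 1)"
      proof -
        have "(1 / 2) * ((2 * chi.Phi (w\<^sup>2) - chi.Phi w) - chi.Phi w) = chi.Phi (w\<^sup>2) - chi.Phi w" by simp
        then show ?thesis by (simp only: Suc_eq_plus1)
      qed
      finally show ?thesis by (simp only: w1[symmetric] w2[symmetric] chi.dilation_def)
    qed
    ultimately have "chi.dilation s sums ((1 / 2) * d)" by (simp only:)
    then have "norm ((1 / 2) * d) \<le> K * norm s" by (rule K(2)[OF s])
    then show "norm (log_F (- exp (- s)) - log_F (exp (- s))) \<le> 2 * K * norm s"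
      by (simp add: d_def z_def norm_mult norm_divide)
  qed
qed

end

subsection \<open>The generating function away from 1 and -1\<close>

text \<open>The first three terms of the Basel series are exact and the tail is compared with a
  telescoping series shifted by one half: 6 (1 + 1/4 + 1/9 + 2/7) lies just below 9.9.\<close>

lemma pi_squared_less: "pi\<^sup>2 < 99 / 10"
proof -
  have tel: "(\<lambda>n. 1 / (real n + 7 / 2) - 1 / (real (Suc n) + 7 / 2)) sums (1 / (real 0 + 7 / 2) - 0)"
    by (rule telescope_sums') real_asymp
  have ini: "(\<lambda>n. 1 / (real (n + 3) + 1)\<^sup>2) sums (pi\<^sup>2 / 6 - (\<Sum>n<3. 1 / (real n + 1)\<^sup>2))"
    using sums_split_initial_segment[OF inverse_squares_sums, of 3] by (simp add: add_ac)
  have cmp: "1 / (real (n + 3) + 1)\<^sup>2 \<le> 1 / (real n + 7 / 2) - 1 / (real (Suc n) + 7 / 2)" for n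
  proof -
    have "1 / (real n + 7 / 2) - 1 / (real (Suc n) + 7 / 2) = 1 / ((real n + 7 / 2) * (real n + 9 / 2))"
      by (simp add: field_simps)
    moreover have "(real n + 7 / 2) * (real n + 9 / 2) \<le> (real (n + 3) + 1)\<^sup>2"
      by (simp add: power2_eq_square algebra_simps)
    ultimately show ?thesis by (simp add: frac_le)
  qed
  have "pi\<^sup>2 / 6 - (\<Sum>n<3. 1 / (real n + 1)\<^sup>2) \<le> 1 / (real 0 + 7 / 2) - 0"
    by (rule sums_le[OF cmp ini tel])
  then show ?thesis by (simp add: eval_nat_numeral)
qed

text \<open>Turns bounded error terms into 1 / sqrt (k r): after division by k these are summable,
  with a total of order 1 / sqrt r, negligible against 1 / r.\<close>

lemma exp_minus_le_inverse_sqrt: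
  assumes "0 < (x::real)"
  shows "exp (- x) \<le> 1 / sqrt x"
proof -
  have "(exp (- x))\<^sup>2 = exp (- (2 * x))" by (simp add: power2_eq_square flip: exp_add)
  also have "\<dots> \<le> 1 / (2 * x)" using assms by (intro exp_minus_le_inverse) simp
  also have "\<dots> \<le> 1 / x" using assms by (simp add: field_simps)
  finally have "exp (- x) \<le> sqrt (1 / x)" by (rule real_le_rsqrt)
  then show ?thesis by (simp add: real_sqrt_divide)
qed

context prime_1_mod_8
begin

section \<open>Residue bounds and savings\<close>

definition amp :: "nat \<Rightarrow> real" where
  "amp k = (if odd k then 1 / sqrt (real p) else 1 - 1 / real p)"

text \<open>The total obtained by giving every exponent its largest residue. It exceeds
  \<open>A\<close> by the contribution of odd k, the amount to be outweighed by the savings.\<close>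

lemma amp_sums: "(\<lambda>k. amp (Suc k) / (real (Suc k))\<^sup>2) sums (pi\<^sup>2 / 8 / sqrt (real p) + A)"
proof -
  have "(\<lambda>k. 1 / (real k + 1)\<^sup>2 - (if odd (Suc k) then 0 else 1 / (real (Suc k))\<^sup>2)) sums (pi\<^sup>2 / 6 - pi\<^sup>2 / 24)"
    using inverse_squares_sums by (intro sums_diff sums_even_squares) (simp add: add.commute)
  from sums_mult[OF this, of "1 / sqrt (real p)"]
  have "(\<lambda>k. 1 / sqrt (real p) * (1 / (real k + 1)\<^sup>2 - (if odd (Suc k) then 0 else 1 / (real (Suc k))\<^sup>2))
      + h0 (Suc k) / (real (Suc k))\<^sup>2) sums (1 / sqrt (real p) * (pi\<^sup>2 / 6 - pi\<^sup>2 / 24) + A)"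
    by (intro sums_add h0_sums)
  moreover have "1 / sqrt (real p) * (1 / (real k + 1)\<^sup>2 - (if odd (Suc k) then 0 else 1 / (real (Suc k))\<^sup>2))
      + h0 (Suc k) / (real (Suc k))\<^sup>2 = amp (Suc k) / (real (Suc k))\<^sup>2" for k
    by (simp add: amp_def h0_def add.commute)
  ultimately show ?thesis by (simp add: field_simps)
qed

definition T_hat :: "nat \<Rightarrow> nat \<Rightarrow> complex" where
  "T_hat k b = (if odd k then chi.hat b else prin.hat b)"

lemma amp_bounds: "0 \<le> amp k" "amp k \<le> 1"
  using p_gt_2 by (auto simp: amp_def)

lemma norm_T_hat_le:
  assumes "b < p"
  shows "norm (T_hat k b) \<le> amp k" "even k \<Longrightarrow> b \<noteq> 0 \<Longrightarrow> norm (T_hat k b) \<le> 1 / real p"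
proof -
  have 1: "norm (chi.hat b) \<le> 1 / sqrt (real p)"
    using norm_chi_hat[of b] assms chi_hat_0 by (cases "b = 0") auto
  have 2: "norm (prin.hat b) = (if b = 0 then 1 - 1 / real p else 1 / real p)"
  proof (cases "b = 0")
    case True
    have "norm (complex_of_real (1 - 1 / real p)) = 1 - 1 / real p"
      unfolding norm_of_real using p_gt_2 by simp
    then show ?thesis using True by (simp add: prin_hat)
  next
    case False
    then have "\<not> p dvd b" using assms by (auto dest: dvd_imp_le)
    then show ?thesis using False by (simp add: prin_hat norm_divide)
  qed
  have "1 / real p \<le> 1 - 1 / real p" using p_gt_2 by (simp add: field_simps)
  then show "norm (T_hat k b) \<le> amp k" "even k \<Longrightarrow> b \<noteq> 0 \<Longrightarrow> norm (T_hat k b) \<le> 1 / real p"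
    using 1 2 by (auto simp: amp_def T_hat_def)
qed

lemma one_minus_norm_le: "1 - norm w \<le> norm (1 - zeta p b * w)"
  using norm_triangle_ineq2[of 1 "zeta p b * w"] by (simp add: norm_mult)

text \<open>Only the pole nearest to \<open>w\<close> matters up to a constant. The last bound
  reflects that for even \<open>k\<close> the pole at 1 is the only one with a large residue: away
  from it just 1 / p is left.\<close>

lemma T_bounds:
  obtains K where "0 \<le> K"
    "\<And>w k. norm w < 1 \<Longrightarrow> norm (T k w) \<le> (amp k / (1 - norm w) + K) * norm w"
    "\<And>w e. norm w < 1 \<Longrightarrow> 0 < e \<Longrightarrow> \<forall>b<p. e \<le> norm (1 - zeta p b * w) \<Longrightarrow>
        norm (T 1 w) \<le> (amp 1 / e + K) * norm w"
    "\<And>w e k. norm w < 1 \<Longrightarrow> 0 < e \<Longrightarrow> even k \<Longrightarrow> e \<le> norm (1 - w) \<Longrightarrow>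
        norm (T k w) \<le> (1 / e + 1 / real p / (1 - norm w) + K) * norm w"
proof -
  obtain K1 where K1: "0 \<le> K1"
    "\<And>w B. norm w < 1 \<Longrightarrow> 0 \<le> B \<Longrightarrow> \<forall>b<p. norm (chi.hat b) / norm (1 - zeta p b * w) \<le> B \<Longrightarrow>
       norm (chi.Phi w) \<le> (B + K1) * norm w"
    by (rule chi.Phi_le_of_coeff_bound) (rule that)
  obtain K2 where K2: "0 \<le> K2"
    "\<And>w B. norm w < 1 \<Longrightarrow> 0 \<le> B \<Longrightarrow> \<forall>b<p. norm (prin.hat b) / norm (1 - zeta p b * w) \<le> B \<Longrightarrow>
       norm (prin.Phi w) \<le> (B + K2) * norm w"
    by (rule prin.Phi_le_of_coeff_bound) (rule that)
  define K where "K = max K1 K2"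
  have T: "norm (T k w) \<le> (B + K) * norm w" if "norm w < 1" "0 \<le> B"
    "\<And>b. b < p \<Longrightarrow> norm (T_hat k b) / norm (1 - zeta p b * w) \<le> B" for k w B
  proof -
    have "norm (T k w) \<le> (B + (if odd k then K1 else K2)) * norm w"
      using K1(2)[OF that(1,2)] K2(2)[OF that(1,2)] that(3)
      by (cases "odd k") (simp_all add: T_def T_hat_def)
    also have "\<dots> \<le> (B + K) * norm w" by (intro mult_right_mono) (auto simp: K_def)
    finally show ?thesis .
  qed
  show thesis
  proof (rule that[of K])
    show "0 \<le> K" using K1 by (simp add: K_def)
    fix w :: complex and k :: nat assume w: "norm w < 1"
    show "norm (T k w) \<le> (amp k / (1 - norm w) + K) * norm w"
      using w norm_T_hat_le(1) one_minus_norm_le amp_bounds(1) by (intro T frac_le) auto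
  next
    fix w :: complex and e :: real assume w: "norm w < 1" "0 < e"
      and far: "\<forall>b<p. e \<le> norm (1 - zeta p b * w)"
    show "norm (T 1 w) \<le> (amp 1 / e + K) * norm w"
      using w amp_bounds(1) far norm_T_hat_le(1) by (intro T frac_le) auto
  next
    fix w :: complex and e :: real and k :: nat assume w: "norm w < 1" "0 < e" "even k" and far: "e \<le> norm (1 - w)"
    show "norm (T k w) \<le> (1 / e + 1 / real p / (1 - norm w) + K) * norm w"
    proof (rule T)
      fix b assume b: "b < p"
      show "norm (T_hat k b) / norm (1 - zeta p b * w) \<le> 1 / e + 1 / real p / (1 - norm w)"
      proof (cases "b = 0")
        case True
        have "norm (T_hat k b) / norm (1 - zeta p b * w) \<le> 1 / e"
          using order_trans[OF norm_T_hat_le(1)[OF b] amp_bounds(2)] far True w by (intro frac_le) auto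
        then show ?thesis using w by (simp add: add_increasing2)
      next
        case False
        have "norm (T_hat k b) / norm (1 - zeta p b * w) \<le> 1 / real p / (1 - norm w)"
          using norm_T_hat_le(2)[OF b] False one_minus_norm_le[of w b] w by (intro frac_le) auto
        then show ?thesis using w by (simp add: add_increasing)
      qed
    qed (use w in auto)
  qed
qed

lemma log_F_norm_le:
  assumes r: "0 < Re s" and K: "0 \<le> K"
    and T: "\<And>k. norm (T (Suc k) (exp (- s) ^ Suc k)) \<le>
      a k / (real (Suc k) * Re s) + K / sqrt (real (Suc k) * Re s)"
    and a: "(\<lambda>k. a k / (real (Suc k))\<^sup>2) sums S"
  shows "norm (log_F (exp (- s))) \<le> S / Re s + K * (\<Sum>k. 1 / real (Suc k) powr (3/2)) / sqrt (Re s)"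
proof -
  have summ: "summable (\<lambda>k. 1 / real (Suc k) powr (3/2))"
  proof -
    have "summable (\<lambda>k. real (Suc k) powr - (3/2))"
      by (subst summable_Suc_iff) (simp add: summable_real_powr_iff)
    then show ?thesis by (simp add: powr_minus_divide)
  qed
  have ub: "(\<lambda>k. a k / (real (Suc k))\<^sup>2 * (1 / Re s) + K * (1 / real (Suc k) powr (3/2)) * (1 / sqrt (Re s)))
      sums (S * (1 / Re s) + K * (\<Sum>k. 1 / real (Suc k) powr (3/2)) * (1 / sqrt (Re s)))"
    by (intro sums_add sums_mult2 a sums_mult summable_sums summ)
  have le: "norm (T (Suc k) (exp (- s) ^ Suc k) / of_nat (Suc k))
      \<le> a k / (real (Suc k))\<^sup>2 * (1 / Re s) + K * (1 / real (Suc k) powr (3/2)) * (1 / sqrt (Re s))" for k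
  proof -
    have "norm (T (Suc k) (exp (- s) ^ Suc k) / of_nat (Suc k)) = norm (T (Suc k) (exp (- s) ^ Suc k)) / real (Suc k)"
      by (simp only: norm_divide norm_of_nat)
    also have "\<dots> \<le> (a k / (real (Suc k) * Re s) + K / sqrt (real (Suc k) * Re s)) / real (Suc k)"
      by (intro divide_right_mono T) auto
    also have "\<dots> = a k / (real (Suc k))\<^sup>2 * (1 / Re s) + K * (1 / (real (Suc k) * sqrt (real (Suc k)))) * (1 / sqrt (Re s))"
      by (simp add: add_divide_distrib power2_eq_square real_sqrt_mult mult_ac del: of_nat_Suc)
    also have "real (Suc k) * sqrt (real (Suc k)) = real (Suc k) powr (3/2)"
    proof -
      have "real (Suc k) powr (1 + 1/2) = real (Suc k) powr 1 * real (Suc k) powr (1/2)" by (rule powr_add)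
      then show ?thesis by (simp add: powr_half_sqrt del: of_nat_Suc)
    qed
    finally show ?thesis .
  qed
  have "norm (exp (- s)) < 1" using r by simp
  from norm_sums_le[OF log_F_sums[OF this] ub le]
  have "norm (log_F (exp (- s))) \<le> S * (1 / Re s) + K * (\<Sum>k. 1 / real (Suc k) powr (3/2)) * (1 / sqrt (Re s))" .
  then show ?thesis by simp
qed

lemma sqrt_p_ge: "412 / 100 \<le> sqrt (real p)"
proof (rule real_le_rsqrt)
  have "17 \<le> real p" using p_ge_17 by simp
  then show "(412 / 100)\<^sup>2 \<le> real p" by (simp add: power2_eq_square)
qed

text \<open>Savings of the two cases below: if \<open>z\<close> is far from all \<open>p\<close>-th roots of unity, the terms for \<open>k = 1, 2\<close>
  are small; if \<open>z\<close> is close to a nontrivial one, the terms for \<open>k = 2, 4, 6, 8\<close> are small. For \<open>p = 17\<close> the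
  second case would fail without \<open>k = 8\<close>.\<close>

lemma savings:
  "pi\<^sup>2 / 8 / sqrt (real p) - (9 / 10 * (1 / sqrt (real p)) + (9 / 10 - 2 / real p) / 4) \<le> - 1 / 100"
  "pi\<^sup>2 / 8 / sqrt (real p) - (1 - 2 / real p) * (205 / 576) \<le> - 1 / 100"
proof -
  define y where "y = 1 / sqrt (real p)"
  \<comment> \<open>Together with \<open>y \<le> 100 / 412\<close> and the bound for pi^2, both
    claims become linear. The fraction 205 / 576 is 1/4 + 1/16 + 1/36 + 1/64, from the exponents 2,
    4, 6, 8.\<close>
  have "1 / sqrt (real p) \<le> 1 / (412 / 100)" using sqrt_p_ge p_pos by (intro divide_left_mono) auto
  then have y: "0 \<le> y" "y \<le> 100 / 412" by (auto simp: y_def)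
  have P: "1 / real p \<le> 1 / 17" using p_ge_17 by (intro divide_left_mono) auto
  have "pi\<^sup>2 / 8 * y \<le> (99 / 80) * y" using pi_squared_less y by (intro mult_right_mono) auto
  then have 1: "pi\<^sup>2 / 8 / sqrt (real p) \<le> (99 / 80) * y" by (simp add: y_def)
  show "pi\<^sup>2 / 8 / sqrt (real p) - (9 / 10 * (1 / sqrt (real p)) + (9 / 10 - 2 / real p) / 4) \<le> - 1 / 100"
    using 1 y P unfolding y_def[symmetric] by (simp add: field_simps)
  show "pi\<^sup>2 / 8 / sqrt (real p) - (1 - 2 / real p) * (205 / 576) \<le> - 1 / 100"
    using 1 y P unfolding y_def[symmetric] by (simp add: field_simps)
qed

lemma norm_power_exp:
  assumes "0 < Re s"
  shows "norm (exp (- s) ^ k) = exp (- (real k * Re s))"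
  by (simp add: norm_power exp_of_nat_mult[symmetric])

text \<open>The hypothesis keeps z away from 1 and -1 at once because 1 - z^2 = (1 - z)(1 + z). Half
  of the margin 1 / 100 provided by \<open>savings\<close> is spent on the error of order 1 / sqrt
  (Re s).\<close>

lemma log_F_minor_bound:
  obtains r0 where "0 < r0"
    "\<And>s. 0 < Re s \<Longrightarrow> Re s \<le> r0 \<Longrightarrow> 20 * Re s \<le> norm (1 - exp (- s) ^ 2) \<Longrightarrow>
      norm (log_F (exp (- s))) \<le> (A - 1 / 200) / Re s"
proof -
  obtain c where c: "0 < c" "c \<le> 1"
    and sep: "\<And>b b'. b < p \<Longrightarrow> b' < p \<Longrightarrow> b \<noteq> b' \<Longrightarrow> 2 * c \<le> norm (zeta p b - zeta p b')"
    using zeta_separation[OF p_pos] by metis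
  obtain K0 where K0: "0 \<le> K0"
    and B0: "\<And>w k. norm w < 1 \<Longrightarrow> norm (T k w) \<le> (amp k / (1 - norm w) + K0) * norm w"
    and B1: "\<And>w e. norm w < 1 \<Longrightarrow> 0 < e \<Longrightarrow> \<forall>b<p. e \<le> norm (1 - zeta p b * w) \<Longrightarrow>
        norm (T 1 w) \<le> (amp 1 / e + K0) * norm w"
    and B2: "\<And>w e k. norm w < 1 \<Longrightarrow> 0 < e \<Longrightarrow> even k \<Longrightarrow> e \<le> norm (1 - w) \<Longrightarrow>
        norm (T k w) \<le> (1 / e + 1 / real p / (1 - norm w) + K0) * norm w"
    by (rule T_bounds) (rule that)
  define K where "K = K0 + 1 / c"
  have K: "0 \<le> K" "K0 \<le> K" using K0 c by (auto simp: K_def)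
  define Z where "Z = (\<Sum>k. 1 / real (Suc k) powr (3/2))"
  \<comment> \<open>The first entry guarantees 80 r < c for the powers up to 8, the second makes the
    error \<open>K * Z / sqrt r\<close> at most (1 / 200) / r.\<close>
  define r0 where "r0 = min (c / 100) ((1 / (200 * (\<bar>K * Z\<bar> + 1)))\<^sup>2)"
  show thesis
  proof (rule that[of r0])
    show "0 < r0" using c by (simp add: r0_def)
    fix s assume s: "0 < Re s" "Re s \<le> r0" and far2: "20 * Re s \<le> norm (1 - exp (- s) ^ 2)"
    define r where "r = Re s"
    define z where "z = exp (- s)"
    have r: "0 < r" "100 * r \<le> c" "r \<le> (1 / (200 * (\<bar>K * Z\<bar> + 1)))\<^sup>2" using s by (auto simp: r_def r0_def)
    have nz: "norm (z ^ k) = exp (- (real k * r))" for k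
      unfolding z_def r_def by (rule norm_power_exp[OF s(1)])
    have nz1: "norm (z ^ Suc k) < 1" for k unfolding nz using r by simp
    have w1: "norm (z ^ Suc k) / (1 - norm (z ^ Suc k)) \<le> 1 / (real (Suc k) * r)" for k
      unfolding nz using r by (intro exp_minus_over_one_minus_le) simp
    have w2: "norm (z ^ Suc k) \<le> 1 / sqrt (real (Suc k) * r)" for k
      unfolding nz using r by (intro exp_minus_le_inverse_sqrt) simp
    have conv: "(x + t / (1 - norm (z ^ Suc k)) + K0) * norm (z ^ Suc k) \<le> (x * real (Suc k) * r + t) / (real (Suc k) * r) + K / sqrt (real (Suc k) * r)"
      if "0 \<le> x" "0 \<le> t" for x t k
    proof -
      have "(x + t / (1 - norm (z ^ Suc k)) + K0) * norm (z ^ Suc k)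
          = x * norm (z ^ Suc k) + t * (norm (z ^ Suc k) / (1 - norm (z ^ Suc k))) + K0 * norm (z ^ Suc k)"
        by (simp add: algebra_simps)
      also have "\<dots> \<le> x * 1 + t * (1 / (real (Suc k) * r)) + K * (1 / sqrt (real (Suc k) * r))"
        using that w1[of k] w2[of k] nz1[of k] K K0 by (intro add_mono mult_left_mono mult_mono) (auto intro: less_imp_le simp del: of_nat_Suc power_Suc)
      also have "\<dots> = (x * real (Suc k) * r + t) / (real (Suc k) * r) + K / sqrt (real (Suc k) * r)"
        using r by (simp add: field_simps del: of_nat_Suc)
      finally show ?thesis .
    qed
    have gen: "norm (T (Suc k) (z ^ Suc k)) \<le> amp (Suc k) / (real (Suc k) * r) + K / sqrt (real (Suc k) * r)" for k
      using B0[OF nz1[of k], of "Suc k"] conv[of 0 "amp (Suc k)" k] amp_bounds(1)[of "Suc k"] by simp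
    have concl: "norm (log_F z) \<le> (A - 1 / 200) / r"
      if T: "\<And>k. norm (T (Suc k) (z ^ Suc k)) \<le> (amp (Suc k) - d k) / (real (Suc k) * r) + K / sqrt (real (Suc k) * r)"
        and d: "(\<lambda>k. d k / (real (Suc k))\<^sup>2) sums S" and S: "pi\<^sup>2 / 8 / sqrt (real p) - S \<le> - 1 / 100" for d S
    proof -
      have "(\<lambda>k. (amp (Suc k) - d k) / (real (Suc k))\<^sup>2) sums (pi\<^sup>2 / 8 / sqrt (real p) + A - S)"
        unfolding diff_divide_distrib by (intro sums_diff amp_sums d)
      from log_F_norm_le[OF s(1) K(1) T[unfolded z_def r_def] this]
      have "norm (log_F z) \<le> (pi\<^sup>2 / 8 / sqrt (real p) + A - S) / r + K * Z / sqrt r"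
        by (simp only: z_def r_def Z_def)
      also have "(pi\<^sup>2 / 8 / sqrt (real p) + A - S) / r \<le> (A - 1 / 100) / r"
        using S r by (intro divide_right_mono) auto
      also have "K * Z / sqrt r \<le> (1 / 200) / r"
      proof -
        have "sqrt r \<le> sqrt ((1 / (200 * (\<bar>K * Z\<bar> + 1)))\<^sup>2)" using r(3) by (rule real_sqrt_le_mono)
        also have "\<dots> = 1 / (200 * (\<bar>K * Z\<bar> + 1))" by simp
        finally have q: "sqrt r * (200 * (\<bar>K * Z\<bar> + 1)) \<le> 1" by (simp add: field_simps)
        have "K * Z * sqrt r \<le> (\<bar>K * Z\<bar> + 1) * sqrt r" using r by (intro mult_right_mono) auto
        also have "\<dots> \<le> 1 / 200" using q by (simp add: algebra_simps)
        finally have "K * Z * sqrt r / r \<le> (1 / 200) / r" using r by (intro divide_right_mono) auto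
        moreover have "K * Z * sqrt r / r = K * Z / sqrt r"
          using r by (metis less_imp_le real_div_sqrt times_divide_eq_right divide_divide_eq_right real_divide_square_eq real_sqrt_mult_self abs_of_pos mult.commute mult_divide_mult_cancel_right real_sqrt_gt_zero less_irrefl)
        ultimately show ?thesis by simp
      qed
      finally show ?thesis by (simp add: diff_divide_distrib)
    qed
    have d_sums: "finite I \<Longrightarrow> (\<lambda>k. (if k \<in> I then d k else 0) / (real (Suc k))\<^sup>2) sums (\<Sum>k\<in>I. d k / (real (Suc k))\<^sup>2)" for I and d :: "nat \<Rightarrow> real"
      using sums_If_finite_set[of I "\<lambda>k. d k / (real (Suc k))\<^sup>2"] by (simp add: if_distrib[of "\<lambda>x. x / _"] cong: if_cong)
    have "norm (log_F z) \<le> (A - 1 / 200) / r"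
    proof (cases "\<forall>b<p. 10 * r \<le> norm (1 - zeta p b * z)")
      case True
      \<comment> \<open>Exponent 1: every pole is at distance 10 r instead of r, so nine tenths of
        the residue are saved. Exponent 2: the pole at 1 is at distance 20 r instead of 2 r and
        leaves 1 / 10, the others leave 1 / p; subtracting both from 1 - 1 / p gives 9 / 10 - 2 /
        p.\<close>
      define d where "d k = (if k = 0 then 9 / 10 * (1 / sqrt (real p)) else 9 / 10 - 2 / real p)" for k :: nat
      show ?thesis
      proof (rule concl[OF _ d_sums[of "{0,1}" d]])
        show "pi\<^sup>2 / 8 / sqrt (real p) - (\<Sum>k\<in>{0, 1}. d k / (real (Suc k))\<^sup>2) \<le> - 1 / 100"
          using savings(1) by (simp add: d_def)
        fix k :: nat
        have zk1: "norm z < 1" using nz1[of 0] by simp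
        consider "k = 0" | "k = 1" | "k \<notin> {0, 1}" by auto
        then show "norm (T (Suc k) (z ^ Suc k)) \<le> (amp (Suc k) - (if k \<in> {0, 1} then d k else 0)) / (real (Suc k) * r) + K / sqrt (real (Suc k) * r)"
        proof cases
          case 1
          have "norm (T 1 z) \<le> (amp 1 / (10 * r) + K0) * norm z"
            using True r zk1 by (intro B1) auto
          also have "\<dots> \<le> (amp 1 / (10 * r)) + K / sqrt r"
            using conv[of "amp 1 / (10 * r)" 0 0] amp_bounds(1)[of 1] r by simp
          finally show ?thesis using 1 by (simp add: d_def amp_def)
        next
          case 2
          have "norm (T 2 (z\<^sup>2)) \<le> (1 / (20 * r) + 1 / real p / (1 - norm (z\<^sup>2)) + K0) * norm (z\<^sup>2)"
            using r nz1[of 1] far2 by (intro B2) (auto simp: z_def r_def power2_eq_square)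
          also have "\<dots> \<le> (1 / (20 * r) * 2 * r + 1 / real p) / (2 * r) + K / sqrt (2 * r)"
            using conv[of "1 / (20 * r)" "1 / real p" 1] r by (simp add: power2_eq_square)
          finally show ?thesis using 2 r by (simp add: d_def amp_def power2_eq_square numeral_2_eq_2)
        next
          case 3
          then show ?thesis using gen[of k] by auto
        qed
      qed simp
    next
      case False
      then obtain b where b: "b < p" "norm (1 - zeta p b * z) < 10 * r" by auto
      have zk1: "norm z \<le> 1" using nz1[of 0] by simp
      \<comment> \<open>Closeness to the pole at 1 is ruled out by \<open>far2\<close>, as |1 + z|
        is at most 2.\<close>
      have b0: "b \<noteq> 0"
      proof
        assume "b = 0"
        then have "norm (1 - z) < 10 * r" using b by simp
        have "norm (1 - z ^ 2) = norm (1 - z) * norm (1 + z)"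
          by (simp add: power2_eq_square algebra_simps flip: norm_mult)
        also have "\<dots> \<le> norm (1 - z) * 2"
          using norm_triangle_ineq[of 1 z] zk1 by (intro mult_left_mono) auto
        also have "\<dots> < 20 * r" using \<open>norm (1 - z) < 10 * r\<close> by simp
        finally have "norm (1 - z ^ 2) < 20 * r" .
        then show False using far2 by (simp add: z_def r_def)
      qed
      \<comment> \<open>For these even exponents the contribution falls from 1 - 1 / p to 1 /
        p.\<close>
      define d where "d k = 1 - 2 / real p" for k :: nat
      show ?thesis
      proof (rule concl[OF _ d_sums[of "{1, 3, 5, 7}" d]])
        show "pi\<^sup>2 / 8 / sqrt (real p) - (\<Sum>k\<in>{1, 3, 5, 7}. d k / (real (Suc k))\<^sup>2) \<le> - 1 / 100"
        proof -
          have "(\<Sum>k\<in>{1, 3, 5, 7}. d k / (real (Suc k))\<^sup>2) = (\<Sum>k\<in>{1, 3, 5, 7::nat}. (1 - 2 / real p) * (1 / (real (Suc k))\<^sup>2))"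
            by (simp add: d_def)
          also have "\<dots> = (1 - 2 / real p) * (\<Sum>k\<in>{1, 3, 5, 7::nat}. 1 / (real (Suc k))\<^sup>2)"
            by (rule sum_distrib_left[symmetric])
          also have "(\<Sum>k\<in>{1, 3, 5, 7::nat}. 1 / (real (Suc k))\<^sup>2) = 205 / 576" by simp
          finally have eq: "(\<Sum>k\<in>{1, 3, 5, 7}. d k / (real (Suc k))\<^sup>2) = (1 - 2 / real p) * (205 / 576)" .
          show ?thesis unfolding eq by (rule savings(2))
        qed
        fix k :: nat
        show "norm (T (Suc k) (z ^ Suc k)) \<le> (amp (Suc k) - (if k \<in> {1, 3, 5, 7} then d k else 0)) / (real (Suc k) * r) + K / sqrt (real (Suc k) * r)"
        proof (cases "k \<in> {1, 3, 5, 7}")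
          case True
          have ev: "even (Suc k)" and k7: "Suc k \<le> 8" using True by auto
          \<comment> \<open>If z is near the pole of index \<open>b\<close>, its power is near the
            pole of index \<open>b'\<close>, the distance growing at most by the exponent. As
            \<open>p\<close> is a prime above 8, \<open>b'\<close> is not 0, so the power stays away
            from 1.\<close>
          define b' where "b' = Suc k * b mod p"
          have "\<not> p dvd Suc k * b"
          proof -
            have "\<not> p dvd Suc k" using k7 p_ge_17 by (auto dest!: dvd_imp_le)
            moreover have "\<not> p dvd b" using b b0 by (auto dest!: dvd_imp_le)
            ultimately show ?thesis using prime_p by (simp only: prime_dvd_mult_iff) simp
          qed
          then have b': "b' < p" "b' \<noteq> 0" using p_pos by (auto simp: b'_def dvd_eq_mod_eq_0)
          have "zeta p b' * z ^ Suc k = (zeta p b * z) ^ Suc k"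
            by (simp only: b'_def zeta_mod[OF p_pos] power_mult_distrib zeta_power)
          moreover have "norm ((zeta p b * z) ^ Suc k - 1 ^ Suc k) \<le> real (Suc k) * norm (zeta p b * z - 1)"
            using zk1 by (intro norm_power_diff) (auto simp: norm_mult)
          ultimately have "norm (1 - zeta p b' * z ^ Suc k) \<le> real (Suc k) * norm (1 - zeta p b * z)"
            by (simp add: norm_minus_commute del: power_Suc of_nat_Suc)
          also have "\<dots> \<le> 8 * (10 * r)" using b(2) k7 r by (intro mult_mono) auto
          also have "\<dots> < c" using r by simp
          finally have near: "norm (1 - zeta p b' * z ^ Suc k) < c" .
          have "c \<le> norm (1 - zeta p 0 * z ^ Suc k)"
            using sep b' p_pos near by (intro zeta_separation_point[where b = b' and q = p]) auto
          then have "norm (T (Suc k) (z ^ Suc k)) \<le> (1 / c + 1 / real p / (1 - norm (z ^ Suc k)) + K0) * norm (z ^ Suc k)"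
            using nz1[of k] c ev by (intro B2) auto
          also have "\<dots> = K * norm (z ^ Suc k) + 1 / real p * (norm (z ^ Suc k) / (1 - norm (z ^ Suc k)))"
            by (simp add: K_def algebra_simps del: power_Suc)
          also have "\<dots> \<le> K * (1 / sqrt (real (Suc k) * r)) + 1 / real p * (1 / (real (Suc k) * r))"
            using K w1[of k] w2[of k] by (intro add_mono mult_left_mono) auto
          also have "\<dots> = (amp (Suc k) - d k) / (real (Suc k) * r) + K / sqrt (real (Suc k) * r)"
            using ev by (simp add: amp_def d_def del: of_nat_Suc)
          finally show ?thesis using True by (simp only: if_True)
        next
          case False
          then show ?thesis using gen[of k] by auto
        qed
      qed simp
    qed
    then show "norm (log_F (exp (- s))) \<le> (A - 1 / 200) / Re s" by (simp add: z_def r_def)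
  qed
qed

end

subsection \<open>Estimating the integrand\<close>

lemma sin_ge_half:
  assumes "0 \<le> y" "y \<le> pi / 2"
  shows "y / 2 \<le> sin y"
proof -
  have "y\<^sup>2 \<le> (pi / 2)\<^sup>2" using assms by (intro power_mono) auto
  then have "y\<^sup>2 \<le> 3" using pi_squared_less by (simp add: power_divide)
  then have "y * y\<^sup>2 \<le> y * 3" using assms(1) by (rule mult_left_mono)
  then have "y ^ 3 \<le> y * 3" by (simp add: power2_eq_square power3_eq_cube)
  moreover have "(\<Sum>m<3. sin_coeff m * y ^ m) = y"
    by (simp add: sin_coeff_def eval_nat_numeral)
  then have "\<bar>sin y - y\<bar> \<le> y ^ 3 / 6"
    using Maclaurin_sin_bound[of y 3] assms(1) by (simp add: fact_numeral)
  ultimately show ?thesis by linarith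
qed

text \<open>In this strip \<open>1 + u\<close> has modulus at least 1, and \<open>1 - u\<close> is
  bounded below by its imaginary part. With \<open>80 * Re s \<le> \<bar>Im s\<bar>\<close> it
  yields the distance \<open>20 * Re s\<close> required off the peak.\<close>

lemma norm_one_minus_exp_square_ge:
  assumes "0 < Re s" "Re s \<le> 1 / 2" "\<bar>Im s\<bar> \<le> pi / 2"
  shows "\<bar>Im s\<bar> / 4 \<le> norm (1 - exp (- s) ^ 2)"
proof -
  define u where "u = exp (- s)"
  have "cos (Im s) \<ge> 0" using assms(3) by (intro cos_ge_zero) auto
  then have "0 \<le> Re u" by (simp add: u_def Re_exp)
  then have 1: "1 \<le> norm (1 + u)" using complex_Re_le_cmod[of "1 + u"] by simp
  have "\<bar>Im s\<bar> / 2 \<le> sin \<bar>Im s\<bar>" using assms(3) by (intro sin_ge_half) auto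
  also have "\<dots> \<le> \<bar>sin (Im s)\<bar>" by (auto simp: abs_if)
  finally have sn: "\<bar>Im s\<bar> / 2 \<le> \<bar>sin (Im s)\<bar>" .
  have "1 / 2 \<le> 1 - Re s" using assms by simp
  also have "\<dots> \<le> exp (- Re s)" using exp_ge_add_one_self[of "- Re s"] by simp
  finally have "1 / 2 * (\<bar>Im s\<bar> / 2) \<le> exp (- Re s) * \<bar>sin (Im s)\<bar>" using sn by (intro mult_mono) auto
  also have "\<dots> = \<bar>Im (1 - u)\<bar>" by (simp add: u_def Im_exp abs_mult)
  also have "\<dots> \<le> norm (1 - u)" by (rule abs_Im_le_cmod)
  finally have "\<bar>Im s\<bar> / 4 * 1 \<le> norm (1 - u) * norm (1 + u)" using 1 by (intro mult_mono) auto
  also have "\<dots> = norm (1 - u ^ 2)" by (simp add: power2_eq_square algebra_simps flip: norm_mult)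
  finally show ?thesis by (simp add: u_def)
qed

section \<open>A majorant for the folded integrand\<close>

context prime_1_mod_8
begin

abbreviation pnum :: "nat \<Rightarrow> int" where
  "pnum n \<equiv> signed_partition_number n leg"

definition integrand :: "nat \<Rightarrow> complex \<Rightarrow> complex" where
  "integrand n s = (exp (log_F (exp (- s))) + (- 1) ^ n * exp (log_F (- exp (- s)))) * exp (of_nat n * s)"

text \<open>Re (A / s) falls below A / r by A y^2 / (r (r^2 + y^2)), and r^2 + y^2 is at most 6401
  r^2 in the sector of slope 80. The condition on \<open>n\<close> places \<open>s\<close> on the
  vertical line through the saddle point, where n r = A / r.\<close>

lemma major_norm_bound:
  assumes M: "norm (D s) \<le> M" and s: "s \<in> sector 80" "0 < Re s" and n: "real n * (Re s)\<^sup>2 = A"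
  shows "norm (exp (log_F (exp (- s))) * exp (of_nat n * s))
      \<le> exp (2 * A / Re s) * exp M * exp (- (A / 6401 * (Im s)\<^sup>2 / Re s ^ 3))"
proof -
  define r y where "r = Re s" and "y = Im s"
  have r: "0 < r" using s by (simp add: r_def)
  have y: "\<bar>y\<bar> \<le> 80 * r" using s by (simp add: sector_def y_def r_def)
  have n': "real n * r = A / r" using n r by (simp add: r_def field_simps power2_eq_square)
  have "norm (exp (log_F (exp (- s))) * exp (of_nat n * s)) = exp (Re (of_real A / s) + Re (D s) + real n * r)"
    by (simp add: norm_mult exp_add D_def r_def)
  also have "\<dots> \<le> exp (2 * A / r + M - A / 6401 * y\<^sup>2 / r ^ 3)"
  proof -
    have "Re (D s) \<le> M" using complex_Re_le_cmod[of "D s"] M by linarith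
    moreover have "Re (of_real A / s) = A * r / (r\<^sup>2 + y\<^sup>2)"
      by (simp add: Re_divide r_def y_def)
    moreover have "A * r / (r\<^sup>2 + y\<^sup>2) \<le> A / r - A / 6401 * y\<^sup>2 / r ^ 3"
    proof -
      have "\<bar>y\<bar>\<^sup>2 \<le> (80 * r)\<^sup>2" using y by (intro power_mono) auto
      then have "y\<^sup>2 \<le> 6400 * r\<^sup>2" by (simp add: power_mult_distrib)
      then have le: "r * (r\<^sup>2 + y\<^sup>2) \<le> 6401 * r ^ 3"
        using r mult_left_mono[of "r\<^sup>2 + y\<^sup>2" "6401 * r\<^sup>2" r] by (simp add: power2_eq_square power3_eq_cube)
      have pos: "0 < r\<^sup>2 + y\<^sup>2" using r by (simp add: add_pos_nonneg)
      have "A / r - A * r / (r\<^sup>2 + y\<^sup>2) = A * y\<^sup>2 / (r * (r\<^sup>2 + y\<^sup>2))"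
        using r pos by (simp add: field_simps power2_eq_square)
      moreover have "A * y\<^sup>2 / (6401 * r ^ 3) \<le> A * y\<^sup>2 / (r * (r\<^sup>2 + y\<^sup>2))"
        using le pos r A_pos by (intro divide_left_mono mult_pos_pos) auto
      ultimately show ?thesis by simp
    qed
    ultimately show ?thesis using n' by (simp add: add_divide_distrib)
  qed
  also have "\<dots> = exp (2 * A / r) * exp M * exp (- (A / 6401 * y\<^sup>2 / r ^ 3))"
    by (simp add: exp_add exp_diff exp_minus field_simps)
  finally show ?thesis by (simp add: r_def y_def)
qed

abbreviation err :: "real \<Rightarrow> real" where
  "err r \<equiv> exp (- (1 / (200 * r)))"

text \<open>The point -exp (-s) is exp (-(s + pi i)), and the hypothesis of the minor bound involves
  only the square, so that bound applies to both summands of the folded integrand.\<close>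

lemma minor_norm_bound:
  obtains r0 where "0 < r0"
    "\<And>s n. 0 < Re s \<Longrightarrow> Re s \<le> r0 \<Longrightarrow> 80 * Re s \<le> \<bar>Im s\<bar> \<Longrightarrow> \<bar>Im s\<bar> \<le> pi / 2 \<Longrightarrow> real n * (Re s)\<^sup>2 = A \<Longrightarrow>
      norm (integrand n s) \<le> 2 * exp (2 * A / Re s) * err (Re s)"
proof -
  obtain r1 where r1: "0 < r1"
    "\<And>s. 0 < Re s \<Longrightarrow> Re s \<le> r1 \<Longrightarrow> 20 * Re s \<le> norm (1 - exp (- s) ^ 2) \<Longrightarrow>
      norm (log_F (exp (- s))) \<le> (A - 1 / 200) / Re s"
    by (rule log_F_minor_bound) (rule that)
  show thesis
  proof (rule that[of "min r1 (1/2)"])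
    show "0 < min r1 (1/2)" using r1 by simp
    fix s n assume s: "0 < Re s" "Re s \<le> min r1 (1/2)" "80 * Re s \<le> \<bar>Im s\<bar>" "\<bar>Im s\<bar> \<le> pi / 2"
      and n: "real n * (Re s)\<^sup>2 = A"
    define r where "r = Re s"
    have r: "0 < r" using s by (simp add: r_def)
    have far: "20 * Re s \<le> norm (1 - exp (- s) ^ 2)"
      using norm_one_minus_exp_square_ge[of s] s by simp
    have neg: "exp (- (s + \<i> * pi)) = - exp (- s)"
      by (simp add: exp_diff)
    have 1: "norm (log_F (exp (- s))) \<le> (A - 1 / 200) / r"
      using r1(2)[of s] s far by (simp add: r_def)
    have 2: "norm (log_F (- exp (- s))) \<le> (A - 1 / 200) / r"
      using r1(2)[of "s + \<i> * pi"] s far unfolding neg by (simp add: r_def)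
    have n': "real n * r = A / r" using n r by (simp add: r_def field_simps power2_eq_square)
    have e: "norm (exp w) \<le> exp B" if "norm w \<le> B" for w :: complex and B
      using that complex_Re_le_cmod[of w] by simp
    have "norm (integrand n s) \<le> (exp ((A - 1 / 200) / r) + exp ((A - 1 / 200) / r)) * exp (A / r)"
      unfolding integrand_def norm_mult
    proof (intro mult_mono)
      show "norm (exp (of_nat n * s)) \<le> exp (A / r)" using n' by (simp add: r_def)
      have "norm ((- 1) ^ n * exp (log_F (- exp (- s)))) = norm (exp (log_F (- exp (- s))))"
        by (simp only: norm_mult norm_power norm_minus_cancel norm_one power_one mult_1)
      then show "norm (exp (log_F (exp (- s))) + (- 1) ^ n * exp (log_F (- exp (- s))))
          \<le> exp ((A - 1 / 200) / r) + exp ((A - 1 / 200) / r)"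
        using e[OF 1] e[OF 2] norm_triangle_ineq[of "exp (log_F (exp (- s)))" "(- 1) ^ n * exp (log_F (- exp (- s)))"]
        by linarith
    qed auto
    also have "\<dots> = 2 * exp ((A - 1 / 200) / r + A / r)" by (simp only: exp_add) simp
    also have "(A - 1 / 200) / r + A / r = 2 * A / r + - (1 / (200 * r))"
      using r by (simp add: field_simps)
    also have "2 * exp (2 * A / r + - (1 / (200 * r))) = 2 * exp (2 * A / r) * err r"
      by (simp only: exp_add mult.assoc)
    finally show "norm (integrand n s) \<le> 2 * exp (2 * A / Re s) * err (Re s)"
      by (simp add: r_def)
  qed
qed

text \<open>The Gaussian decay exp (-t) is weakened to 1 / (1 + t), which integrates to an
  arctangent. For odd \<open>n\<close> the extra factor \<open>Re s\<close> records the cancellation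
  between 1 and -1.\<close>

definition majorant :: "real \<Rightarrow> real \<Rightarrow> nat \<Rightarrow> complex \<Rightarrow> real" where
  "majorant K a n s = exp (2 * A / Re s) *
     (K * (if even n then 1 else Re s) / (1 + a * (Im s)\<^sup>2 / Re s ^ 3) + 2 * err (Re s))"

text \<open>In the sector the integrand is its value at 1 times 1 + (-1)^n exp q with q = O(Re s),
  by the comparison of \<open>log_F\<close> at opposite points; this factor is bounded for even n
  and O(Re s) for odd n. Outside the sector the minor bound applies.\<close>

lemma integrand_bound:
  obtains r0 K a where "0 < r0" "0 \<le> K" "0 < a"
    "\<And>s n. 0 < Re s \<Longrightarrow> Re s \<le> r0 \<Longrightarrow> \<bar>Im s\<bar> \<le> pi / 2 \<Longrightarrow> real n * (Re s)\<^sup>2 = A \<Longrightarrow>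
      norm (integrand n s) \<le> majorant K a n s"
proof -
  obtain r1 where r1: "0 < r1"
    "\<And>s n. 0 < Re s \<Longrightarrow> Re s \<le> r1 \<Longrightarrow> 80 * Re s \<le> \<bar>Im s\<bar> \<Longrightarrow> \<bar>Im s\<bar> \<le> pi / 2 \<Longrightarrow> real n * (Re s)\<^sup>2 = A \<Longrightarrow>
      norm (integrand n s) \<le> 2 * exp (2 * A / Re s) * err (Re s)"
    by (rule minor_norm_bound) (rule that)
  obtain M where M: "0 \<le> M" "\<And>s. s \<in> sector 80 \<Longrightarrow> 0 < Re s \<Longrightarrow> norm (D s) \<le> M"
    using D_bound[of 80] by auto
  obtain L where L: "0 \<le> L"
    "\<And>s. s \<in> sector 80 \<Longrightarrow> 0 < Re s \<Longrightarrow> Re s \<le> 1 \<Longrightarrow> norm (log_F (- exp (- s)) - log_F (exp (- s))) \<le> L * norm s"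
    using log_F_minus_bound[of 80] by auto
  \<comment> \<open>The last entry gives \<open>norm q \<le> 1\<close>, so that |exp q - 1| is at
    most 3 |q|. Here 81 = 1 + 80 comes from the slope of the sector, and 243 = 3 * 81.\<close>
  define r0 where "r0 = min (min r1 1) (1 / (81 * L + 1))"
  show thesis
  proof (rule that[of r0 "exp M * (4 + 243 * L)" "A / 6401"])
    show "0 < r0" using r1 L by (simp add: r0_def)
    show "0 \<le> exp M * (4 + 243 * L)" using L by simp
    show "0 < A / 6401" using A_pos by simp
    fix s n assume s: "0 < Re s" "Re s \<le> r0" "\<bar>Im s\<bar> \<le> pi / 2" and n: "real n * (Re s)\<^sup>2 = A"
    have den: "0 < 1 + A / 6401 * (Im s)\<^sup>2 / Re s ^ 3"
      using s A_pos by (intro add_pos_nonneg) auto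
    show "norm (integrand n s) \<le> majorant (exp M * (4 + 243 * L)) (A / 6401) n s"
    proof (cases "80 * Re s \<le> \<bar>Im s\<bar>")
      case True
      then have "norm (integrand n s) \<le> 2 * exp (2 * A / Re s) * err (Re s)"
        using s n by (intro r1) (auto simp: r0_def)
      also have "\<dots> = exp (2 * A / Re s) * (0 + 2 * err (Re s))" by simp
      also have "\<dots> \<le> majorant (exp M * (4 + 243 * L)) (A / 6401) n s"
        unfolding majorant_def using den L s by (intro mult_left_mono add_right_mono divide_nonneg_pos mult_nonneg_nonneg) auto
      finally show ?thesis .
    next
      case False
      then have sec: "s \<in> sector 80" using s by (simp add: sector_def)
      define q where "q = log_F (- exp (- s)) - log_F (exp (- s))"
      have "norm q \<le> L * norm s" unfolding q_def using sec s by (intro L) (auto simp: r0_def)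
      also have "\<dots> \<le> L * (81 * Re s)" using sector_norm_le[OF sec] L by (intro mult_left_mono) auto
      finally have q: "norm q \<le> 81 * L * Re s" by simp
      have "81 * L * Re s \<le> (81 * L + 1) * (1 / (81 * L + 1))"
        using s L by (intro mult_mono) (auto simp: r0_def)
      then have q1: "norm q \<le> 1" using q L by simp
      have eq: "integrand n s = exp (log_F (exp (- s))) * exp (of_nat n * s) * (1 + (- 1) ^ n * exp q)"
        by (simp add: integrand_def q_def exp_diff distrib_left distrib_right mult_ac)
      have e1: "norm (exp q - 1) \<le> 243 * L * Re s"
        using norm_exp_minus_1_le[OF q1] q by simp
      have fac: "norm (1 + (- 1) ^ n * exp q) \<le> (4 + 243 * L) * (if even n then 1 else Re s)"
      proof (cases "even n")
        case True
        have "norm (1 + exp q) = norm (2 + (exp q - 1))" by simp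
        also have "\<dots> \<le> norm (2::complex) + norm (exp q - 1)" by (rule norm_triangle_ineq)
        also have "\<dots> \<le> 2 + 243 * L * 1"
          using e1 s L mult_left_mono[of "Re s" 1 "243 * L"] by (auto simp: r0_def)
        finally show ?thesis using True by simp
      next
        case False
        then have "norm (1 + (- 1) ^ n * exp q) = norm (exp q - 1)" by (simp add: norm_minus_commute)
        also have "\<dots> \<le> (4 + 243 * L) * Re s" using e1 s by (simp add: distrib_right)
        finally show ?thesis using False by simp
      qed
      define t where "t = A / 6401 * (Im s)\<^sup>2 / Re s ^ 3"
      have t: "0 \<le> t" using s A_pos by (simp add: t_def)
      have et: "exp (- t) \<le> 1 / (1 + t)"
        using t exp_ge_add_one_self[of t] by (simp add: exp_minus field_simps del: exp_ge_add_one_self)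
      have "norm (integrand n s) \<le> (exp (2 * A / Re s) * exp M * exp (- t)) * ((4 + 243 * L) * (if even n then 1 else Re s))"
        unfolding eq norm_mult[of _ "1 + (- 1) ^ n * exp q"] t_def
        by (rule mult_mono[OF major_norm_bound[OF M(2)[OF sec s(1)] sec s(1) n] fac]) auto
      also have "\<dots> \<le> (exp (2 * A / Re s) * exp M * (1 / (1 + t))) * ((4 + 243 * L) * (if even n then 1 else Re s))"
        using et L s by (intro mult_right_mono mult_left_mono) auto
      also have "\<dots> = exp (2 * A / Re s) * (exp M * (4 + 243 * L) * (if even n then 1 else Re s) / (1 + t) + 0)"
        by simp
      also have "\<dots> \<le> exp (2 * A / Re s) * (exp M * (4 + 243 * L) * (if even n then 1 else Re s) / (1 + t) + 2 * err (Re s))"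
        by (intro mult_left_mono add_left_mono) auto
      finally show ?thesis unfolding t_def majorant_def .
    qed
  qed
qed

section \<open>The saddle point and the bound for odd arguments\<close>

definition saddle :: "nat \<Rightarrow> real" where
  "saddle n = sqrt (A / real n)"

lemma saddle_pos: "0 < n \<Longrightarrow> 0 < saddle n"
  using A_pos by (simp add: saddle_def)

lemma saddle_square: "0 < n \<Longrightarrow> real n * (saddle n)\<^sup>2 = A"
  using A_pos by (simp add: saddle_def)

lemma saddle_tendsto: "saddle \<longlonglongrightarrow> 0"
  unfolding saddle_def using A_pos by real_asymp

text \<open>The saddle point minimizes A / r + n r, with minimum 2 A / r = 2 sqrt (A n); since A =
  (pi / 4)^2 (2 / 3) (1 - 1 / p), this is the exponent of the theorem.\<close>

lemma exponent_eq: "0 < n \<Longrightarrow> 2 * A / saddle n = 1 / 2 * kappa * sqrt ((1 - 1 / real p) * real n)"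
proof -
  assume n: "0 < n"
  have s: "sqrt A * sqrt A = A" using A_pos by simp
  have "2 * A / saddle n = 2 * (sqrt A * sqrt A) / (sqrt A / sqrt (real n))"
    unfolding s by (simp add: saddle_def real_sqrt_divide)
  also have "\<dots> = 2 * sqrt A * sqrt (real n)" using n A_pos by (simp del: real_sqrt_mult_self)
  finally have "2 * A / saddle n = 2 * sqrt A * sqrt (real n)" .
  moreover have "2 * sqrt A = 1 / 2 * kappa * sqrt (1 - 1 / real p)"
  proof -
    have "A = (pi / 4)\<^sup>2 * (2 / 3) * (1 - 1 / real p)"
      by (simp add: A_def power2_eq_square)
    then have "sqrt A = pi / 4 * sqrt (2 / 3) * sqrt (1 - 1 / real p)"
      by (simp only: real_sqrt_mult) simp
    then show ?thesis by (simp add: kappa_def)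
  qed
  ultimately show ?thesis by (simp only: real_sqrt_mult mult.assoc)
qed

lemma integral_inverse_one_plus_square_le:
  assumes "0 < (b::real)"
  obtains I where "((\<lambda>x. 1 / (1 + (b * x)\<^sup>2)) has_integral I) {-1/4..1/4}" "I \<le> 4 / b"
proof -
  have "((\<lambda>x. 1 / (1 + (b * x)\<^sup>2)) has_integral (arctan (b * (1/4)) / b - arctan (b * (-1/4)) / b)) {-1/4..1/4}"
  proof (rule fundamental_theorem_of_calculus)
    fix x :: real
    have "((\<lambda>x. arctan (b * x) / b) has_real_derivative (inverse (1 + (b * x)\<^sup>2) * b) / b) (at x within {-1/4..1/4})"
      by (auto intro!: derivative_eq_intros)
    moreover have "(inverse (1 + (b * x)\<^sup>2) * b) / b = 1 / (1 + (b * x)\<^sup>2)"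
      using assms by (simp add: inverse_eq_divide)
    ultimately show "((\<lambda>x. arctan (b * x) / b) has_vector_derivative 1 / (1 + (b * x)\<^sup>2)) (at x within {-1/4..1/4})"
      by (simp only: has_real_derivative_iff_has_vector_derivative)
  qed simp
  moreover have "arctan (b * (1/4)) / b - arctan (b * (-1/4)) / b \<le> 4 / b"
  proof -
    have "arctan (b * (1/4)) \<le> 2" "- 2 \<le> arctan (b * (-1/4))"
      using arctan_bounded[of "b * (1/4)"] arctan_bounded[of "b * (-1/4)"] pi_less_4 by linarith+
    then have "arctan (b * (1/4)) - arctan (b * (-1/4)) \<le> 4" by simp
    then show ?thesis using assms by (simp add: divide_right_mono flip: diff_divide_distrib)
  qed
  ultimately show thesis by (rule that)
qed

lemma partition_integral:
  assumes "0 < n"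
  shows "((\<lambda>x. integrand n (Complex (saddle n) (- (2 * pi * x)))) has_integral
      of_int (pnum n)) {-1/4..1/4}"
  unfolding integrand_def
  using signed_partition_number_integral[OF legendre_char_le_1 saddle_pos[OF assms], where n = n] by simp

text \<open>The majorant of the peak has width proportional to r^(3/2), which with the cancellation
  factor r makes r^(5/2). Off the peak the exponentially small \<open>err\<close> is integrated over
  an interval of length 1 / 2, cancelling its factor 2.\<close>

lemma odd_bound:
  obtains N C where
    "\<And>n. N \<le> n \<Longrightarrow> odd n \<Longrightarrow> \<bar>real_of_int (pnum n)\<bar>
      \<le> exp (2 * A / saddle n) * (C * (saddle n)\<^sup>2 * sqrt (saddle n) + err (saddle n))"
proof -
  obtain r0 K a where r0: "0 < r0" and K: "0 \<le> K" and a: "0 < a"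
    and bd: "\<And>s n. 0 < Re s \<Longrightarrow> Re s \<le> r0 \<Longrightarrow> \<bar>Im s\<bar> \<le> pi / 2 \<Longrightarrow> real n * (Re s)\<^sup>2 = A \<Longrightarrow>
      norm (integrand n s) \<le> majorant K a n s"
    by (rule integrand_bound) (rule that)
  have "\<forall>\<^sub>F n in sequentially. saddle n < r0 \<and> 0 < n"
    using saddle_tendsto r0 by (intro eventually_conj eventually_gt_at_top) (auto simp: order_tendsto_iff)
  then obtain N where N: "\<And>n. N \<le> n \<Longrightarrow> saddle n < r0 \<and> 0 < n"
    by (auto simp: eventually_sequentially)
  show thesis
  proof (rule that[of N "K * (4 / (2 * pi * sqrt a))"])
    fix n assume n: "N \<le> n" "odd n"
    define r where "r = saddle n"
    have n0: "0 < n" and r: "0 < r" "r \<le> r0" using N[OF n(1)] saddle_pos[of n] by (auto simp: r_def)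
    define b where "b = 2 * pi * sqrt a / (r * sqrt r)"
    have b: "0 < b" using a r by (simp add: b_def)
    have b2: "(b * x)\<^sup>2 = a * (2 * pi * x)\<^sup>2 / r ^ 3" for x
    proof -
      have "(b * x)\<^sup>2 = (sqrt a)\<^sup>2 * (2 * pi * x)\<^sup>2 / (r\<^sup>2 * (sqrt r)\<^sup>2)"
        by (simp add: b_def power_mult_distrib power_divide mult_ac)
      also have "\<dots> = a * (2 * pi * x)\<^sup>2 / r ^ 3"
        using a r by (simp add: power3_eq_cube power2_eq_square[of r])
      finally show ?thesis .
    qed
    obtain I where I: "((\<lambda>x. 1 / (1 + (b * x)\<^sup>2)) has_integral I) {-1/4..1/4}" "I \<le> 4 / b"
      by (rule integral_inverse_one_plus_square_le[OF b])
    define g where "g x = exp (2 * A / r) * (K * r * (1 / (1 + (b * x)\<^sup>2)) + 2 * err r)" for x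
    have g: "(g has_integral exp (2 * A / r) * (K * r * I + err r)) {-1/4..1/4}"
    proof -
      have "((\<lambda>x::real. 2 * err r) has_integral err r) {-1/4..1/4}"
        using has_integral_const_real[of "2 * err r" "-1/4" "1/4"] by simp
      then show ?thesis unfolding g_def by (intro has_integral_mult_right has_integral_add I)
    qed
    define Y where "Y x = integrand n (Complex r (- (2 * pi * x)))" for x
    have Y: "(Y has_integral of_int (pnum n)) {-1/4..1/4}"
      using partition_integral[OF n0] by (simp only: Y_def[abs_def] r_def)
    have "norm (integral {-1/4..1/4} Y) \<le> integral {-1/4..1/4} g"
    proof (rule integral_norm_bound_integral)
      fix x :: real assume x: "x \<in> {-1/4..1/4}"
      have ax: "\<bar>2 * pi * x\<bar> \<le> pi / 2"
      proof -
        have "\<bar>x\<bar> \<le> 1 / 4" using x by auto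
        then have "2 * pi * \<bar>x\<bar> \<le> 2 * pi * (1 / 4)" by (intro mult_left_mono) auto
        then show ?thesis by (simp add: abs_mult)
      qed
      have "norm (Y x) \<le> exp (2 * A / r) * (K * r / (1 + a * (- (2 * pi * x))\<^sup>2 / r ^ 3) + 2 * err r)"
        using bd[of "Complex r (- (2 * pi * x))" n] r ax n saddle_square[OF n0] by (simp add: Y_def r_def majorant_def)
      also have "\<dots> = g x" unfolding g_def b2 by simp
      finally show "norm (Y x) \<le> g x" .
    qed (use Y g in \<open>auto intro: has_integral_integrable\<close>)
    then have "norm (complex_of_int (pnum n))
        \<le> exp (2 * A / r) * (K * r * I + err r)"
      using integral_unique[OF Y] integral_unique[OF g] by simp
    also have "\<dots> \<le> exp (2 * A / r) * (K * r * (4 / b) + err r)"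
      using I(2) K r by (intro mult_left_mono add_right_mono) auto
    also have "K * r * (4 / b) = K * (4 / (2 * pi * sqrt a)) * r\<^sup>2 * sqrt r"
      using a r by (simp add: b_def power2_eq_square)
    finally show "\<bar>real_of_int (pnum n)\<bar>
      \<le> exp (2 * A / saddle n) * (K * (4 / (2 * pi * sqrt a)) * (saddle n)\<^sup>2 * sqrt (saddle n) + err (saddle n))"
      by (simp add: r_def)
  qed
qed

text \<open>As r is of order m^(-1/2), the power r^(5/2) is of order m^(-5/4), below m^(-19/20), and
  \<open>err\<close> decays faster than any power.\<close>

lemma odd_bigo:
  "(\<lambda>m::nat. real_of_int (pnum (2 * m + 1)))
       \<in> O(\<lambda>m. real m powr (- 19 / 20) * exp (1 / 2 * kappa * sqrt ((1 - 1 / real p) * real (2 * m + 1))))"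
proof -
  obtain N C where NC: "\<And>n. N \<le> n \<Longrightarrow> odd n \<Longrightarrow> \<bar>real_of_int (pnum n)\<bar>
      \<le> exp (2 * A / saddle n) * (C * (saddle n)\<^sup>2 * sqrt (saddle n) + err (saddle n))"
    by (rule odd_bound) (rule that)
  define r where "r m = saddle (2 * m + 1)" for m
  define e where "e m = exp (1 / 2 * kappa * sqrt ((1 - 1 / real p) * real (2 * m + 1)))" for m :: nat
  have e: "e m = exp (2 * A / r m)" for m
    using exponent_eq[of "2 * m + 1"] by (simp add: e_def r_def)
  have "(\<lambda>m. real_of_int (pnum (2 * m + 1)))
      \<in> O(\<lambda>m. e m * (C * (r m)\<^sup>2 * sqrt (r m) + err (r m)))"
  proof (rule bigoI[of _ 1])
    show "\<forall>\<^sub>F m in sequentially. norm (real_of_int (pnum (2 * m + 1)))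
        \<le> 1 * norm (e m * (C * (r m)\<^sup>2 * sqrt (r m) + err (r m)))"
      using eventually_ge_at_top[of N]
    proof eventually_elim
      case (elim m)
      then show ?case using NC[of "2 * m + 1"] unfolding e r_def
        by (simp del: of_nat_add of_nat_mult)
    qed
  qed
  also have "(\<lambda>m. e m * (C * (r m)\<^sup>2 * sqrt (r m) + err (r m))) \<in> O(\<lambda>m. e m * real m powr (- 19 / 20))"
  proof (rule landau_o.big.mult_left)
    have "(\<lambda>m. (r m)\<^sup>2 * sqrt (r m)) \<in> O(\<lambda>m. real m powr (- 19 / 20))"
      unfolding r_def saddle_def using A_pos by real_asymp
    then have "(\<lambda>m. C * ((r m)\<^sup>2 * sqrt (r m))) \<in> O(\<lambda>m. real m powr (- 19 / 20))"
      by simp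
    moreover have "(\<lambda>m. err (r m)) \<in> O(\<lambda>m. real m powr (- 19 / 20))"
      unfolding r_def saddle_def using A_pos by real_asymp
    ultimately show "(\<lambda>m. C * (r m)\<^sup>2 * sqrt (r m) + err (r m)) \<in> O(\<lambda>m. real m powr (- 19 / 20))"
      unfolding mult.assoc by (rule sum_in_bigo)
  qed
  finally show ?thesis by (simp add: e_def mult.commute)
qed

end

subsection \<open>The saddle point at even arguments\<close>

lemma exp_minus_le_inverse_cube:
  assumes "0 < (t::real)"
  shows "exp (- t) \<le> 27 / t ^ 3"
proof -
  have "t / 3 \<le> exp (t / 3)" using exp_ge_add_one_self[of "t / 3"] by linarith
  then have "(t / 3) ^ 3 \<le> exp (t / 3) ^ 3" using assms by (intro power_mono) auto
  also have "\<dots> = exp t" by (simp add: exp_of_nat_mult[symmetric])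
  finally have "t ^ 3 / 27 \<le> exp t" by (simp add: power_divide)
  then show ?thesis using assms by (simp add: exp_minus field_simps)
qed

lemma inverse_one_plus_square_integrable: "(\<lambda>x::real. C / (1 + x\<^sup>2)) integrable_on UNIV"
proof -
  have "set_integrable lborel (einterval (-\<infinity>) \<infinity>) (\<lambda>x. inverse (1 + x\<^sup>2) :: real)"
    by (rule integrable_inverse_1_plus_square)
  then have "integrable lborel (\<lambda>x. inverse (1 + x\<^sup>2) :: real)"
    by (simp add: set_integrable_def einterval_def)
  then have "(\<lambda>x. inverse (1 + x\<^sup>2) :: real) integrable_on UNIV"
    by (rule integrable_on_lborel)
  from integrable_on_cmult_left[OF this, of C] show ?thesis by (simp add: divide_inverse)
qed

context prime_1_mod_8
begin

definition width :: "nat \<Rightarrow> real" where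
  "width n = saddle n * sqrt (saddle n)"

text \<open>The value of \<open>D\<close> at the saddle point is kept in the normalization, so its
  limit need not be determined; \<open>width\<close> is the scale of the peak.\<close>

definition main_term :: "nat \<Rightarrow> real" where
  "main_term n = exp (2 * A / saddle n + Re (D (of_real (saddle n)))) * width n"

definition rescaled :: "nat \<Rightarrow> real \<Rightarrow> complex" where
  "rescaled n v = integrand n (Complex (saddle n) (- (2 * pi * (width n * v))))
     * of_real (exp (- (2 * A / saddle n + Re (D (of_real (saddle n))))))"

lemma width_pos: "0 < n \<Longrightarrow> 0 < width n"
  using saddle_pos by (simp add: width_def)

lemma width_square: "0 < n \<Longrightarrow> (width n)\<^sup>2 = saddle n ^ 3"
  using saddle_pos[of n] by (simp add: width_def power_mult_distrib power2_eq_square power3_eq_cube)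

lemma rescaled_integral:
  assumes "0 < n"
  shows "(rescaled n has_integral of_real (real_of_int (pnum n) / main_term n))
      {- (1 / (4 * width n))..1 / (4 * width n)}"
proof -
  define E where "E = 2 * A / saddle n + Re (D (of_real (saddle n)))"
  have w: "0 < width n" using assms by (rule width_pos)
  define Y where "Y x = integrand n (Complex (saddle n) (- (2 * pi * x)))" for x
  have Y: "(Y has_integral of_int (pnum n)) (cbox (-1/4) (1/4))"
    using partition_integral[OF assms] by (simp add: Y_def[abs_def])
  have "((\<lambda>v. Y (width n * v)) has_integral (of_int (pnum n) /\<^sub>R width n))
      {- (1 / (4 * width n))..1 / (4 * width n)}"
  proof -
    have "(-1/4 - 0) /\<^sub>R width n = - (1 / (4 * width n))" "(1/4 - 0) /\<^sub>R width n = 1 / (4 * width n)"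
      unfolding real_scaleR_def inverse_eq_divide by simp_all
    then show ?thesis using has_integral_affinity'[OF Y w, of 0]
      by (simp only: cbox_interval real_scaleR_def add_0_right power_one_right DIM_real)
  qed
  from has_integral_mult_left[OF this, of "of_real (exp (- E))"]
  have "((\<lambda>v. Y (width n * v) * of_real (exp (- E))) has_integral
      (of_int (pnum n) /\<^sub>R width n * of_real (exp (- E))))
      {- (1 / (4 * width n))..1 / (4 * width n)}" .
  moreover have "of_int (pnum n) /\<^sub>R width n * of_real (exp (- E))
      = complex_of_real (real_of_int (pnum n) / main_term n)"
    unfolding main_term_def E_def[symmetric]
    by (simp add: scaleR_conv_of_real exp_minus divide_inverse exp_of_real mult_ac)
  moreover have "(\<lambda>v. Y (width n * v) * of_real (exp (- E))) = rescaled n"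
    by (intro ext) (simp only: rescaled_def Y_def E_def)
  ultimately show ?thesis by (simp only:)
qed

text \<open>Supplies the dominating function. The part from \<open>err\<close> does not decay in
  \<open>v\<close>, but the interval ends at \<open>v\<close> of order r^(-3/2), so a bound of order
  r^3 for \<open>err\<close> is already of order 1 / (1 + v^2).\<close>

lemma rescaled_bound:
  obtains N C where
    "\<And>n v. N \<le> n \<Longrightarrow> even n \<Longrightarrow> \<bar>v\<bar> \<le> 1 / (4 * width n) \<Longrightarrow> norm (rescaled n v) \<le> C / (1 + v\<^sup>2)"
proof -
  obtain r0 K a where r0: "0 < r0" and K: "0 \<le> K" and a: "0 < a"
    and bd: "\<And>s n. 0 < Re s \<Longrightarrow> Re s \<le> r0 \<Longrightarrow> \<bar>Im s\<bar> \<le> pi / 2 \<Longrightarrow> real n * (Re s)\<^sup>2 = A \<Longrightarrow>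
      norm (integrand n s) \<le> majorant K a n s"
    by (rule integrand_bound) (rule that)
  obtain M where M: "0 \<le> M" "\<And>s. s \<in> sector 0 \<Longrightarrow> 0 < Re s \<Longrightarrow> norm (D s) \<le> M"
    using D_bound[of 0] by auto
  have "\<forall>\<^sub>F n in sequentially. saddle n < r0 \<and> saddle n < 1 \<and> 0 < n"
    using saddle_tendsto r0 by (intro eventually_conj eventually_gt_at_top) (auto simp: order_tendsto_iff)
  then obtain N where N: "\<And>n. N \<le> n \<Longrightarrow> saddle n < r0 \<and> saddle n < 1 \<and> 0 < n"
    by (auto simp: eventually_sequentially)
  define b where "b = a * (2 * pi)\<^sup>2"
  have b: "0 < b" using a by (simp add: b_def)
  define L where "L = (27 * 200 ^ 3 :: real)"
  show thesis
  proof (rule that[of N "exp M * (K * (1 + 1 / b) + 4 * L)"])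
    fix n v assume n: "N \<le> n" "even n" and v: "\<bar>v\<bar> \<le> 1 / (4 * width n)"
    define r where "r = saddle n"
    have n0: "0 < n" and r: "0 < r" "r \<le> r0" "r \<le> 1" using N[OF n(1)] saddle_pos[of n] by (auto simp: r_def)
    have w: "0 < width n" using n0 by (rule width_pos)
    have w2: "(width n)\<^sup>2 = r ^ 3" using width_square[OF n0] by (simp add: r_def)
    have wv: "\<bar>width n * v\<bar> \<le> 1 / 4"
    proof -
      have "width n * \<bar>v\<bar> \<le> width n * (1 / (4 * width n))" using v w by (intro mult_left_mono) auto
      then show ?thesis using w by (simp add: abs_mult)
    qed
    have im: "\<bar>2 * pi * (width n * v)\<bar> \<le> pi / 2"
    proof -
      have "2 * pi * \<bar>width n * v\<bar> \<le> 2 * pi * (1 / 4)" using wv by (intro mult_left_mono) auto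
      then show ?thesis by (simp add: abs_mult)
    qed
    have "a * (2 * pi * (width n * v))\<^sup>2 / r ^ 3 = b * v\<^sup>2"
      using r by (simp add: power_mult_distrib w2 b_def)
    then have 1: "norm (integrand n (Complex r (- (2 * pi * (width n * v)))))
        \<le> exp (2 * A / r) * (K / (1 + b * v\<^sup>2) + 2 * err r)"
      using bd[of "Complex r (- (2 * pi * (width n * v)))" n] r im n saddle_square[OF n0]
      by (simp add: r_def majorant_def)
    have "- Re (D (of_real r)) \<le> M"
      using M(2)[of "of_real r"] r abs_Re_le_cmod[of "D (of_real r)"] by (simp add: sector_def)
    then have 2: "exp (- (2 * A / r + Re (D (of_real r)))) \<le> exp M * exp (- (2 * A / r))"
      by (simp add: exp_add[symmetric])
    have 3: "K / (1 + b * v\<^sup>2) \<le> K * (1 + 1 / b) / (1 + v\<^sup>2)"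
    proof -
      have pos: "0 < 1 + b * v\<^sup>2" "0 < 1 + v\<^sup>2" using b by (auto intro: add_pos_nonneg)
      have "1 + v\<^sup>2 \<le> (1 + 1 / b) * (1 + b * v\<^sup>2)" using b by (simp add: field_simps)
      then have "1 / (1 + b * v\<^sup>2) \<le> (1 + 1 / b) / (1 + v\<^sup>2)"
        using pos by (simp add: pos_divide_le_eq pos_le_divide_eq mult.commute)
      then have "K * (1 / (1 + b * v\<^sup>2)) \<le> K * ((1 + 1 / b) / (1 + v\<^sup>2))" using K by (rule mult_left_mono)
      then show ?thesis by simp
    qed
    have 4: "2 * err r \<le> 4 * L / (1 + v\<^sup>2)"
    proof -
      have "err r \<le> 27 / (1 / (200 * r)) ^ 3"
        using r by (intro exp_minus_le_inverse_cube) simp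
      also have "\<dots> = L * r ^ 3" by (simp add: L_def power_divide power_mult_distrib)
      finally have e: "err r \<le> L * r ^ 3" .
      have "(width n * v)\<^sup>2 \<le> 1" using wv abs_le_square_iff[of "width n * v" 1] by simp
      then have "r ^ 3 * v\<^sup>2 \<le> 1" by (simp add: power_mult_distrib w2)
      moreover have "r ^ 3 \<le> 1" using r by (simp add: power_le_one)
      ultimately have "r ^ 3 * (1 + v\<^sup>2) \<le> 2" by (simp add: algebra_simps)
      then have "r ^ 3 \<le> 2 / (1 + v\<^sup>2)" by (simp add: pos_le_divide_eq add_pos_nonneg)
      then have "L * r ^ 3 \<le> L * (2 / (1 + v\<^sup>2))" by (intro mult_left_mono) (auto simp: L_def)
      then show ?thesis using e by simp
    qed
    have "norm (rescaled n v) = norm (integrand n (Complex r (- (2 * pi * (width n * v))))) * exp (- (2 * A / r + Re (D (of_real r))))"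
      by (simp add: rescaled_def norm_mult r_def)
    also have "\<dots> \<le> (exp (2 * A / r) * (K / (1 + b * v\<^sup>2) + 2 * err r)) * (exp M * exp (- (2 * A / r)))"
      using 1 2 norm_ge_zero order_trans by (intro mult_mono) (auto intro: order_trans[OF norm_ge_zero])
    also have "\<dots> = exp M * (K / (1 + b * v\<^sup>2) + 2 * err r)"
      by (simp add: exp_minus)
    also have "\<dots> \<le> exp M * (K * (1 + 1 / b) / (1 + v\<^sup>2) + 4 * L / (1 + v\<^sup>2))"
      using 3 4 by (intro mult_left_mono add_mono) auto
    finally show "norm (rescaled n v) \<le> exp M * (K * (1 + 1 / b) + 4 * L) / (1 + v\<^sup>2)"
      by (simp add: add_divide_distrib distrib_left)
  qed
qed

text \<open>With s = r u the exponent is A / s + n s - 2 A / r = (A / r) (u - 1)^2 / u, and (u -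
  1)^2 = -4 pi^2 v^2 r makes it Gaussian as u tends to 1. The change of \<open>D\<close> is O(|Im s|
  / Re s) = O(sqrt r), and q tends to 0, so 1 and -1 together give the factor 2.\<close>

lemma rescaled_tendsto:
  assumes n: "filterlim n at_top sequentially" and even: "\<And>k. even (n k)" and pos: "\<And>k. 0 < n k"
  shows "(\<lambda>k. rescaled (n k) v) \<longlonglongrightarrow> of_real (2 * exp (- (4 * pi\<^sup>2 * A * v\<^sup>2)))"
proof -
  define r where "r k = saddle (n k)" for k
  define u where "u k = Complex 1 (- (2 * pi * v * sqrt (r k)))" for k
  define s where "s k = Complex (r k) (- (2 * pi * (width (n k) * v)))" for k
  define q where "q k = log_F (- exp (- s k)) - log_F (exp (- s k))" for k
  have rpos: "0 < r k" for k using pos saddle_pos by (simp add: r_def)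
  have rlim: "r \<longlonglongrightarrow> 0"
    unfolding r_def by (rule filterlim_compose[OF saddle_tendsto n])
  have s_eq: "s k = of_real (r k) * u k" for k
    by (simp add: s_def u_def complex_eq_iff width_def r_def)
  have sq: "(\<lambda>k. 2 * pi * v * sqrt (r k)) \<longlonglongrightarrow> 0"
    using tendsto_mult[OF tendsto_const[of "2 * pi * v"] tendsto_real_sqrt[OF rlim]] by simp
  have u: "u \<longlonglongrightarrow> 1"
    unfolding u_def using tendsto_Complex[OF tendsto_const[of 1] tendsto_minus[OF sq]] by (simp add: one_complex.code)
  have s0: "s \<longlonglongrightarrow> 0"
    unfolding s_eq[abs_def] using tendsto_mult[OF tendsto_of_real[OF rlim] u] by simp
  have Im_s: "\<bar>Im (s k)\<bar> = \<bar>2 * pi * v * sqrt (r k)\<bar> * Re (s k)" for k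
    using rpos[of k] by (simp add: s_eq u_def abs_mult)
  have ev: "\<forall>\<^sub>F k in sequentially. \<bar>Im (s k)\<bar> \<le> Re (s k) \<and> Re (s k) \<le> 1"
  proof -
    have "\<forall>\<^sub>F k in sequentially. dist (2 * pi * v * sqrt (r k)) 0 < 1" by (rule tendstoD[OF sq]) simp
    moreover have "\<forall>\<^sub>F k in sequentially. r k < 1" using rlim by (auto simp: order_tendsto_iff)
    ultimately show ?thesis
    proof eventually_elim
      case (elim k)
      then have "\<bar>2 * pi * v * sqrt (r k)\<bar> * r k \<le> 1 * r k" using rpos[of k] by (intro mult_right_mono) auto
      then show ?case using elim Im_s[of k] by (simp add: s_def)
    qed
  qed
  have Dlim: "(\<lambda>k. D (s k) - D (of_real (r k))) \<longlonglongrightarrow> 0"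
  proof -
    obtain M where M: "0 \<le> M"
      "\<And>s. 0 < Re s \<Longrightarrow> \<bar>Im s\<bar> \<le> Re s \<Longrightarrow> norm (D s - D (of_real (Re s))) \<le> M * (\<bar>Im s\<bar> / Re s)"
      by (rule D_lipschitz) (rule that)
    show ?thesis
    proof (rule Lim_null_comparison)
      show "\<forall>\<^sub>F k in sequentially. norm (D (s k) - D (of_real (r k))) \<le> M * \<bar>2 * pi * v * sqrt (r k)\<bar>"
        using ev
      proof eventually_elim
        case (elim k)
        have "norm (D (s k) - D (of_real (Re (s k)))) \<le> M * (\<bar>Im (s k)\<bar> / Re (s k))"
          using elim rpos[of k] by (intro M) (auto simp: s_def)
        then show ?case using rpos[of k] unfolding Im_s by (simp add: s_def)
      qed
      show "(\<lambda>k. M * \<bar>2 * pi * v * sqrt (r k)\<bar>) \<longlonglongrightarrow> 0"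
        using tendsto_mult[OF tendsto_const[of M] tendsto_rabs[OF sq]] by simp
    qed
  qed
  have qlim: "q \<longlonglongrightarrow> 0"
  proof -
    obtain L where L: "0 \<le> L"
      "\<And>s. s \<in> sector 1 \<Longrightarrow> 0 < Re s \<Longrightarrow> Re s \<le> 1 \<Longrightarrow> norm (log_F (- exp (- s)) - log_F (exp (- s))) \<le> L * norm s"
      using log_F_minus_bound[of 1] by auto
    show ?thesis
    proof (rule Lim_null_comparison)
      show "\<forall>\<^sub>F k in sequentially. norm (q k) \<le> L * norm (s k)"
        using ev
      proof eventually_elim
        case (elim k)
        then show ?case unfolding q_def using rpos[of k] by (intro L) (auto simp: sector_def s_def)
      qed
      show "(\<lambda>k. L * norm (s k)) \<longlonglongrightarrow> 0"
        using tendsto_mult[OF tendsto_const[of L] tendsto_norm[OF s0]] by simp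
    qed
  qed
  have eq: "rescaled (n k) v = exp (- (4 * pi\<^sup>2 * A * v\<^sup>2) / u k + (D (s k) - D (of_real (r k)))) * (1 + exp (q k))" for k
  proof -
    have u0: "u k \<noteq> 0" by (simp add: u_def complex_eq_iff)
    have nk: "complex_of_real (real (n k)) * (of_real (r k))\<^sup>2 = of_real A"
      using saddle_square[OF pos[of k]] unfolding r_def by (metis of_real_mult of_real_power)
    have "of_real A / s k + of_nat (n k) * s k - of_real (2 * A / r k) = - (4 * pi\<^sup>2 * A * v\<^sup>2) / u k"
    proof -
      have r0: "complex_of_real (r k) \<noteq> 0" using rpos[of k] by simp
      have nk': "of_nat (n k) * complex_of_real (r k) = of_real A / of_real (r k)"
        using nk r0 by (simp add: field_simps power2_eq_square)
      have "of_real A / s k + of_nat (n k) * s k - of_real (2 * A / r k)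
          = of_real A / (of_real (r k) * u k) + of_real A / of_real (r k) * u k - 2 * of_real A / of_real (r k)"
        unfolding s_eq mult.assoc[symmetric] nk' by simp
      also have "\<dots> = of_real A / of_real (r k) * (u k - 1)\<^sup>2 / u k"
        using u0 r0 by (simp add: field_simps power2_eq_square)
      also have "(u k - 1)\<^sup>2 = complex_of_real (- (4 * pi\<^sup>2 * v\<^sup>2) * r k)"
        using rpos[of k] by (simp add: u_def complex_eq_iff power2_eq_square)
      also have "of_real A / of_real (r k) * complex_of_real (- (4 * pi\<^sup>2 * v\<^sup>2) * r k) / u k
          = complex_of_real (- (4 * pi\<^sup>2 * A * v\<^sup>2)) / u k"
        using r0 by simp
      finally show ?thesis .
    qed
    moreover have "log_F (exp (- s k)) = of_real A / s k + D (s k)" by (simp add: D_def)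
    moreover have "D (of_real (r k)) = of_real (Re (D (of_real (r k))))" by (rule D_real[OF rpos])
    ultimately have ex: "log_F (exp (- s k)) + of_nat (n k) * s k + of_real (- (2 * A / r k + Re (D (of_real (r k)))))
        = - (4 * pi\<^sup>2 * A * v\<^sup>2) / u k + (D (s k) - D (of_real (r k)))"
      by (simp add: algebra_simps)
    have "rescaled (n k) v = exp (log_F (exp (- s k))) * exp (of_nat (n k) * s k)
        * exp (of_real (- (2 * A / r k + Re (D (of_real (r k)))))) * (1 + exp (q k))"
    proof -
      have unf: "rescaled (n k) v = (exp (log_F (exp (- s k))) + (- 1) ^ n k * exp (log_F (- exp (- s k)))) * exp (of_nat (n k) * s k)
          * of_real (exp (- (2 * A / r k + Re (D (of_real (r k))))))"
        by (simp only: rescaled_def integrand_def s_def r_def)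
      have q: "exp (log_F (- exp (- s k))) = exp (log_F (exp (- s k))) * exp (q k)"
        by (simp add: q_def exp_diff)
      have "(- 1) ^ n k = (1::complex)" using even[of k] by simp
      then show ?thesis unfolding unf q exp_of_real by (simp only: mult_1 distrib_left distrib_right mult_1_right mult_ac)
    qed
    also have "\<dots> = exp (log_F (exp (- s k)) + of_nat (n k) * s k + of_real (- (2 * A / r k + Re (D (of_real (r k)))))) * (1 + exp (q k))"
      by (simp only: exp_add)
    finally show ?thesis unfolding ex .
  qed
  have "(\<lambda>k. exp (- (4 * pi\<^sup>2 * A * v\<^sup>2) / u k + (D (s k) - D (of_real (r k)))) * (1 + exp (q k)))
      \<longlonglongrightarrow> exp (complex_of_real (- (4 * pi\<^sup>2 * A * v\<^sup>2)) / 1 + 0) * (1 + exp 0)"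
    by (intro tendsto_intros u Dlim qlim) auto
  moreover have "exp (complex_of_real (- (4 * pi\<^sup>2 * A * v\<^sup>2)) / 1 + 0) * (1 + exp 0) = complex_of_real (2 * exp (- (4 * pi\<^sup>2 * A * v\<^sup>2)))"
    by (simp add: exp_of_real[symmetric])
  ultimately show ?thesis unfolding eq by (simp only:)
qed

text \<open>Dominated convergence identifies the limit as the integral of the Gaussian. For the
  logarithmic statement only its positivity counts, which follows from its lower bound on
  [0, 1].\<close>

lemma even_main_term:
  obtains c where "0 < c"
    "(\<lambda>m. real_of_int (pnum (2 * m)) / main_term (2 * m)) \<longlonglongrightarrow> c"
proof -
  obtain N C where bound: "\<And>n v. N \<le> n \<Longrightarrow> even n \<Longrightarrow> \<bar>v\<bar> \<le> 1 / (4 * width n) \<Longrightarrow> norm (rescaled n v) \<le> C / (1 + v\<^sup>2)"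
    by (rule rescaled_bound) (rule that)
  have C: "0 \<le> C"
  proof -
    have "norm (rescaled (2 * (N + 1)) 0) \<le> C / (1 + 0\<^sup>2)"
      using width_pos[of "2 * (N + 1)"] by (intro bound) auto
    then have "norm (rescaled (2 * (N + 1)) 0) \<le> C" by simp
    then show ?thesis using norm_ge_zero[of "rescaled (2 * (N + 1)) 0"] by linarith
  qed
  \<comment> \<open>The shift by \<open>N + 1\<close> makes the bound valid and the argument
    positive for every \<open>k\<close>; it is undone at the end.\<close>
  define n where "n k = 2 * (k + (N + 1))" for k
  have n: "N \<le> n k" "even (n k)" "0 < n k" for k by (auto simp: n_def)
  define J where "J k = {- (1 / (4 * width (n k)))..1 / (4 * width (n k))}" for k
  define g where "g k v = (if v \<in> J k then Re (rescaled (n k) v) else 0)" for k v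
  define h where "h v = C / (1 + v\<^sup>2)" for v :: real
  define G where "G v = 2 * exp (- (4 * pi\<^sup>2 * A * v\<^sup>2))" for v
  have gi: "(g k has_integral (real_of_int (pnum (n k)) / main_term (n k))) UNIV" for k
    unfolding g_def J_def has_integral_restrict_UNIV
    using has_integral_linear[OF rescaled_integral[OF n(3)[of k]] bounded_linear_Re] by (simp add: o_def)
  have gle: "norm (g k v) \<le> h v" for k v
  proof (cases "v \<in> J k")
    case True
    then have "\<bar>v\<bar> \<le> 1 / (4 * width (n k))" by (auto simp: J_def)
    then have "norm (rescaled (n k) v) \<le> h v" unfolding h_def by (intro bound n)
    then show ?thesis using True abs_Re_le_cmod[of "rescaled (n k) v"] by (simp add: g_def)
  next
    case False
    then show ?thesis using C unfolding g_def h_def by (simp only: if_False) simp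
  qed
  have n_top: "filterlim n at_top sequentially"
    unfolding n_def by (rule filterlim_subseq) (auto simp: strict_mono_def)
  have w0: "(\<lambda>k. width (n k)) \<longlonglongrightarrow> 0"
  proof -
    have s: "(\<lambda>k. saddle (n k)) \<longlonglongrightarrow> 0" by (rule filterlim_compose[OF saddle_tendsto n_top])
    show ?thesis unfolding width_def using tendsto_mult[OF s tendsto_real_sqrt[OF s]] by simp
  qed
  have glim: "(\<lambda>k. g k v) \<longlonglongrightarrow> G v" for v
  proof -
    have "\<forall>\<^sub>F k in sequentially. width (n k) < 1 / (4 * (\<bar>v\<bar> + 1))"
      using order_tendstoD(2)[OF w0, of "1 / (4 * (\<bar>v\<bar> + 1))"] by simp
    then have "\<forall>\<^sub>F k in sequentially. Re (rescaled (n k) v) = g k v"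
    proof eventually_elim
      case (elim k)
      have "width (n k) * (4 * (\<bar>v\<bar> + 1)) < 1" using elim by (simp add: pos_less_divide_eq)
      then have "\<bar>v\<bar> + 1 < 1 / (4 * width (n k))" using width_pos[OF n(3)[of k]]
        by (simp add: pos_less_divide_eq algebra_simps)
      then have "v \<in> J k" by (auto simp: J_def)
      then show ?case by (simp add: g_def)
    qed
    moreover have "(\<lambda>k. Re (rescaled (n k) v)) \<longlonglongrightarrow> Re (of_real (G v))"
      unfolding G_def by (intro tendsto_Re rescaled_tendsto n_top n)
    ultimately show ?thesis by (simp add: Lim_transform_eventually)
  qed
  have hi: "h integrable_on UNIV" unfolding h_def by (rule inverse_one_plus_square_integrable)
  have DC: "G integrable_on UNIV" "(\<lambda>k. integral UNIV (g k)) \<longlonglongrightarrow> integral UNIV G"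
    by (rule dominated_convergence[where f = g and h = h]; use gi gle glim hi in \<open>auto intro: has_integral_integrable\<close>)+
  have lim: "(\<lambda>k. real_of_int (pnum (n k)) / main_term (n k)) \<longlonglongrightarrow> integral UNIV G"
    using DC(2) by (simp only: integral_unique[OF gi])
  have "0 < integral UNIV G"
  proof -
    have "continuous_on {0..1} G" unfolding G_def by (intro continuous_intros)
    then have i: "G integrable_on {0..1}" by (rule integrable_continuous_interval)
    have "integral {0..1} (\<lambda>v::real. 2 * exp (- (4 * pi\<^sup>2 * A))) \<le> integral {0..1} G"
    proof (rule integral_le[OF _ i])
      fix v :: real assume "v \<in> {0..1}"
      then have "v\<^sup>2 \<le> 1" by (simp add: power_le_one)
      then have "4 * pi\<^sup>2 * A * v\<^sup>2 \<le> 4 * pi\<^sup>2 * A * 1" using A_pos by (intro mult_left_mono) auto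
      then show "2 * exp (- (4 * pi\<^sup>2 * A)) \<le> G v" by (simp add: G_def)
    qed auto
    also have "\<dots> \<le> integral UNIV G"
      by (rule integral_subset_le[OF _ i DC(1)]) (auto simp: G_def)
    finally have "2 * exp (- (4 * pi\<^sup>2 * A)) \<le> integral UNIV G" by simp
    then show ?thesis using exp_gt_zero[of "- (4 * pi\<^sup>2 * A)"] by linarith
  qed
  moreover have "(\<lambda>m. real_of_int (pnum (2 * m)) / main_term (2 * m)) \<longlonglongrightarrow> integral UNIV G"
    using lim unfolding n_def by (rule LIMSEQ_offset)
  ultimately show thesis by (rule that)
qed

text \<open>In the logarithm of \<open>main_term\<close> the summand 2 A / r dominates: (3 / 2) ln
  r, the bounded value of \<open>D\<close>, and the convergent ln (w m) all vanish after
  multiplication by r.\<close>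

lemma even_asymptotics:
  "(\<lambda>m::nat. log_plus (real_of_int (pnum (2 * m))))
     \<sim>[at_top] (\<lambda>m. 1 / 2 * kappa * sqrt ((1 - 1 / real p) * real (2 * m)))"
proof -
  obtain c where c: "0 < c"
    and lim: "(\<lambda>m. real_of_int (pnum (2 * m)) / main_term (2 * m)) \<longlonglongrightarrow> c"
    by (rule even_main_term) (rule that)
  obtain M where M: "0 \<le> M" "\<And>s. s \<in> sector 0 \<Longrightarrow> 0 < Re s \<Longrightarrow> norm (D s) \<le> M"
    using D_bound[of 0] by auto
  define P where "P m = real_of_int (pnum (2 * m))" for m
  define r where "r m = saddle (2 * m)" for m
  define \<delta> where "\<delta> m = Re (D (of_real (r m)))" for m
  define w where "w m = P m / main_term (2 * m)" for m
  have wlim: "w \<longlonglongrightarrow> c" using lim by (simp add: w_def[abs_def] P_def[abs_def])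
  have ev: "\<forall>\<^sub>F m in sequentially. 0 < m \<and> 0 < w m"
    using order_tendstoD(1)[OF wlim c] eventually_gt_at_top[of 0] by eventually_elim auto
  have lnw: "(\<lambda>m. ln (w m)) \<longlonglongrightarrow> ln c" using wlim c by (intro tendsto_ln) auto
  have r0: "r \<longlonglongrightarrow> 0"
    unfolding r_def saddle_def using A_pos by real_asymp
  have form: "\<forall>\<^sub>F m in sequentially. 1 + (ln (w m) * r m + 3 / 2 * (r m * ln (r m)) + \<delta> m * r m) / (2 * A)
      = log_plus (P m) / (1 / 2 * kappa * sqrt ((1 - 1 / real p) * real (2 * m)))"
    using ev
  proof eventually_elim
    case (elim m)
    have r: "0 < r m" using elim saddle_pos by (simp add: r_def)
    have mt: "main_term (2 * m) = exp (2 * A / r m + \<delta> m) * (r m * sqrt (r m))"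
      by (simp add: main_term_def width_def r_def \<delta>_def)
    have mpos: "0 < main_term (2 * m)" using r by (simp add: mt)
    have P: "P m = w m * main_term (2 * m)" using mpos by (simp add: w_def)
    then have "0 < P m" using elim mpos by simp
    \<comment> \<open>A positive integer is at least 1, so \<open>log_plus\<close> is the ordinary
      logarithm here.\<close>
    then have "1 \<le> P m" unfolding P_def by simp
    then have "log_plus (P m) = ln (P m)" by (simp add: log_plus_def)
    also have "\<dots> = ln (w m) + (2 * A / r m + \<delta> m + (ln (r m) + ln (r m) / 2))"
      unfolding P mt using elim r by (simp add: ln_mult ln_sqrt)
    finally have "log_plus (P m) / (2 * A / r m) = (ln (w m) + (2 * A / r m + \<delta> m + (ln (r m) + ln (r m) / 2))) / (2 * A / r m)"
      by simp
    also have "\<dots> = 1 + (ln (w m) * r m + 3 / 2 * (r m * ln (r m)) + \<delta> m * r m) / (2 * A)"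
      using r A_pos by (simp add: field_simps)
    also have "2 * A / r m = 1 / 2 * kappa * sqrt ((1 - 1 / real p) * real (2 * m))"
      unfolding r_def using elim by (intro exponent_eq) simp
    finally show ?case by simp
  qed
  have "(\<lambda>m. \<delta> m * r m) \<longlonglongrightarrow> 0"
  proof (rule Lim_null_comparison)
    show "\<forall>\<^sub>F m in sequentially. norm (\<delta> m * r m) \<le> M * \<bar>r m\<bar>"
      using eventually_gt_at_top[of 0]
    proof eventually_elim
      case (elim m)
      then have "0 < r m" using saddle_pos by (simp add: r_def)
      then have "\<bar>\<delta> m\<bar> \<le> M" unfolding \<delta>_def using M(2)[of "of_real (r m)"] abs_Re_le_cmod[of "D (of_real (r m))"]
        by (simp add: sector_def)
      then show ?case by (simp add: abs_mult mult_right_mono)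
    qed
    show "(\<lambda>m. M * \<bar>r m\<bar>) \<longlonglongrightarrow> 0" using tendsto_mult[OF tendsto_const[of M] tendsto_rabs[OF r0]] by simp
  qed
  moreover have "(\<lambda>m. r m * ln (r m)) \<longlonglongrightarrow> 0"
    unfolding r_def saddle_def using A_pos by real_asymp
  ultimately have "(\<lambda>m. 1 + (ln (w m) * r m + 3 / 2 * (r m * ln (r m)) + \<delta> m * r m) / (2 * A)) \<longlonglongrightarrow> 1 + (ln c * 0 + 3 / 2 * 0 + 0) / (2 * A)"
    using A_pos by (intro tendsto_intros lnw r0) auto
  from Lim_transform_eventually[OF this form]
  have "(\<lambda>m. log_plus (P m) / (1 / 2 * kappa * sqrt ((1 - 1 / real p) * real (2 * m)))) \<longlonglongrightarrow> 1"
    by simp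
  then show ?thesis unfolding P_def by (rule asymp_equivI')
qed

end

theorem theorem1p2:
  fixes p :: nat
  assumes "prime p" and "[p = 1] (mod 8)"
  shows
    "(\<lambda>m::nat. log_plus (real_of_int (signed_partition_number (2 * m) (legendre_char p))))
       \<sim>[at_top]
     (\<lambda>m. 1 / 2 * kappa * sqrt ((1 - 1 / real p) * real (2 * m)))
     \<and>
     (\<lambda>m::nat. real_of_int (signed_partition_number (2 * m + 1) (legendre_char p)))
       \<in> O[at_top](\<lambda>m. real m powr (- 19 / 20) *
           exp (1 / 2 * kappa * sqrt ((1 - 1 / real p) * real (2 * m + 1))))"
proof -
  interpret prime_1_mod_8 p using assms by unfold_locales
  show ?thesis using even_asymptotics odd_bigo by blast
qed

end
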